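(* Let $\xi=(\mathcal{E},p,T)$ be a Banach bundle with $T$ locally compact Hausdorff. A closed subspace $L$ of $\Gamma_0(\xi)$ is an M-ideal of $\Gamma_0(\xi)$ if and only if there exists a Banach subbundle $\eta=(\mathcal{F},p|_{\mathcal{F}},T)$ of $\xi$ such that $L=\Gamma_0(\eta)$ and each fiber $\mathcal{F}(t)$ is an M-ideal of the Banach space $\mathcal{E}(t)$.
   Context: $\mathbb{K}$ is the real or the complex field. A Banach bundle $\xi=(\mathcal{E},p,T)$ consists of a Hausdorff space $T$ (base space), a topological space $\mathcal{E}$ (bundle space, not assumed Hausdorff), and a continuous open surjection $p:\mathcal{E}\to T$ such that each fiber $\mathcal{E}(t)=p^{-1}(t)$ is a Banach space over $\mathbb{K}$ with origin $0_t$, and: addition $\{(x,y)\in\mathcal{E}\times\mathcal{E}: p(x)=p(y)\}\to\mathcal{E}$ and scalar multiplication $\mathbb{K}\times\mathcal{E}\to\mathcal{E}$ are continuous; $x\mapsto\|x\|$ is upper semi-continuous on $\mathcal{E}$; and if $(x_\iota)$ is a net in $\mathcal{E}$ with $p(x_\iota)\to t$ and $\|x_\iota\|\to 0$, then $x_\iota\to 0_t$. A Banach subbundle of $\xi$ is a triple $(\mathcal{F},p|_{\mathcal{F}},T)$, where $\mathcal{F}\subset\mathcal{E}$ carries the relative topology, $p|_{\mathcal{F}}$ is onto $T$ and open, and each $\mathcal{F}(t)=p^{-1}(t)\cap\mathcal{F}$ is a closed linear subspace of $\mathcal{E}(t)$. A section of $\xi$ is a continuous $f:T\to\mathcal{E}$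 with $p(f(t))=t$ for all $t\in T$; $\Gamma_0(\xi)$ is the Banach space, with norm $\|f\|=\sup_{t\in T}\|f(t)\|$, of sections vanishing at infinity, i.e. such that $\{t\in T:\|f(t)\|\geq\varepsilon\}$ is compact for every $\varepsilon>0$. For a subbundle $\eta$ of $\xi$, $\Gamma_0(\eta)$ is regarded as a subspace of $\Gamma_0(\xi)$ (the sections with values in $\mathcal{F}$). A closed subspace $Y$ of a Banach space $X$ is an M-ideal of $X$ if its polar (annihilator) $Z_1$ in the dual of $X$ has a closed complement $Z_2$ in the dual such that $\|z_1+z_2\|=\|z_1\|+\|z_2\|$ for all $z_i\in Z_i$, $i=1,2$. *)

theory Defs
  imports "HOL-Analysis.Analysis"
begin

section \<open>Scalars\<close>

text \<open>
  The scalar field is the real or the complex field, up to an isometric isomorphism of fields.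
\<close>

class real_or_complex = real_normed_field +
  assumes isometric_to_real_or_complex:
    "\<exists>\<phi> :: 'a \<Rightarrow> complex.
       (\<forall>x y. \<phi> (x + y) = \<phi> x + \<phi> y) \<and> (\<forall>x y. \<phi> (x * y) = \<phi> x * \<phi> y) \<and>
       (\<forall>x. cmod (\<phi> x) = norm x) \<and> (range \<phi> = \<real> \<or> range \<phi> = UNIV)"

instance real :: real_or_complex
proof
  show "\<exists>\<phi> :: real \<Rightarrow> complex.
       (\<forall>x y. \<phi> (x + y) = \<phi> x + \<phi> y) \<and> (\<forall>x y. \<phi> (x * y) = \<phi> x * \<phi> y) \<and>
       (\<forall>x. cmod (\<phi> x) = norm x) \<and> (range \<phi> = \<real> \<or> range \<phi> = UNIV)"
    by (rule exI[of _ complex_of_real]) (simp add: Reals_def)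
qed

instance complex :: real_or_complex
proof
  show "\<exists>\<phi> :: complex \<Rightarrow> complex.
       (\<forall>x y. \<phi> (x + y) = \<phi> x + \<phi> y) \<and> (\<forall>x y. \<phi> (x * y) = \<phi> x * \<phi> y) \<and>
       (\<forall>x. cmod (\<phi> x) = norm x) \<and> (range \<phi> = \<real> \<or> range \<phi> = UNIV)"
    by (rule exI[of _ id]) simp
qed


section \<open>Banach spaces with an explicit carrier\<close>

text \<open>
  The fibers of a bundle are subsets of one type, so normed spaces are given by a carrier set and
  explicit operations, which are only meaningful on the carrier.
\<close>

record ('k, 'v) nvs =
  vcarrier :: "'v set"
  vadd :: "'v \<Rightarrow> 'v \<Rightarrow> 'v"
  vzero :: "'v"
  vscale :: "'k \<Rightarrow> 'v \<Rightarrow> 'v"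
  vnorm :: "'v \<Rightarrow> real"

definition vector_space_axioms_on :: "('k::real_or_complex, 'v) nvs \<Rightarrow> bool" where
  "vector_space_axioms_on V \<longleftrightarrow>
     vzero V \<in> vcarrier V \<and>
     (\<forall>x\<in>vcarrier V. \<forall>y\<in>vcarrier V. vadd V x y \<in> vcarrier V) \<and>
     (\<forall>c. \<forall>x\<in>vcarrier V. vscale V c x \<in> vcarrier V) \<and>
     (\<forall>x\<in>vcarrier V. \<forall>y\<in>vcarrier V. \<forall>z\<in>vcarrier V.
        vadd V (vadd V x y) z = vadd V x (vadd V y z)) \<and>
     (\<forall>x\<in>vcarrier V. \<forall>y\<in>vcarrier V. vadd V x y = vadd V y x) \<and>
     (\<forall>x\<in>vcarrier V. vadd V (vzero V) x = x) \<and>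
     (\<forall>x\<in>vcarrier V. \<exists>y\<in>vcarrier V. vadd V x y = vzero V) \<and>
     (\<forall>c. \<forall>x\<in>vcarrier V. \<forall>y\<in>vcarrier V.
        vscale V c (vadd V x y) = vadd V (vscale V c x) (vscale V c y)) \<and>
     (\<forall>c d. \<forall>x\<in>vcarrier V. vscale V (c + d) x = vadd V (vscale V c x) (vscale V d x)) \<and>
     (\<forall>c d. \<forall>x\<in>vcarrier V. vscale V (c * d) x = vscale V c (vscale V d x)) \<and>
     (\<forall>x\<in>vcarrier V. vscale V 1 x = x)"

definition norm_axioms_on :: "('k::real_or_complex, 'v) nvs \<Rightarrow> bool" where
  "norm_axioms_on V \<longleftrightarrow>
     (\<forall>x\<in>vcarrier V. 0 \<le> vnorm V x) \<and>
     (\<forall>x\<in>vcarrier V. vnorm V x = 0 \<longleftrightarrow> x = vzero V) \<and>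
     (\<forall>x\<in>vcarrier V. \<forall>y\<in>vcarrier V. vnorm V (vadd V x y) \<le> vnorm V x + vnorm V y) \<and>
     (\<forall>c. \<forall>x\<in>vcarrier V. vnorm V (vscale V c x) = norm c * vnorm V x)"

text \<open>
  The locale \<^locale>\<open>Metric_space\<close> requires nonnegativity and symmetry of the distance also outside
  the carrier, whence the default value \<open>0\<close>.
\<close>

definition vdist :: "('k::real_or_complex, 'v) nvs \<Rightarrow> 'v \<Rightarrow> 'v \<Rightarrow> real" where
  "vdist V x y =
     (if x \<in> vcarrier V \<and> y \<in> vcarrier V then vnorm V (vadd V x (vscale V (- 1) y)) else 0)"

definition vtopology :: "('k::real_or_complex, 'v) nvs \<Rightarrow> 'v topology" where
  "vtopology V = Metric_space.mtopology (vcarrier V) (vdist V)"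

definition banach_space :: "('k::real_or_complex, 'v) nvs \<Rightarrow> bool" where
  "banach_space V \<longleftrightarrow>
     vector_space_axioms_on V \<and> norm_axioms_on V \<and>
     Metric_space.mcomplete (vcarrier V) (vdist V)"

definition closed_subspace :: "('k::real_or_complex, 'v) nvs \<Rightarrow> 'v set \<Rightarrow> bool" where
  "closed_subspace V Y \<longleftrightarrow>
     Y \<subseteq> vcarrier V \<and> vzero V \<in> Y \<and>
     (\<forall>x\<in>Y. \<forall>y\<in>Y. vadd V x y \<in> Y) \<and> (\<forall>c. \<forall>x\<in>Y. vscale V c x \<in> Y) \<and>
     closedin (vtopology V) Y"


section \<open>Duals and M-ideals\<close>

text \<open>
  Functionals are extended by \<open>0\<close> outside the carrier, so that they are determined by their
  restriction to the carrier and the pointwise operations preserve the dual.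
\<close>

definition bounded_functionals :: "('k::real_or_complex, 'v) nvs \<Rightarrow> ('v \<Rightarrow> 'k) set" where
  "bounded_functionals V =
     {f. (\<forall>x\<in>vcarrier V. \<forall>y\<in>vcarrier V. f (vadd V x y) = f x + f y) \<and>
         (\<forall>c. \<forall>x\<in>vcarrier V. f (vscale V c x) = c * f x) \<and>
         (\<exists>B. \<forall>x\<in>vcarrier V. norm (f x) \<le> B * vnorm V x) \<and>
         (\<forall>x. x \<notin> vcarrier V \<longrightarrow> f x = 0)}"

definition dual :: "('k::real_or_complex, 'v) nvs \<Rightarrow> ('k, 'v \<Rightarrow> 'k) nvs" where
  "dual V =
     \<lparr>vcarrier = bounded_functionals V,
      vadd = (\<lambda>f g x. f x + g x),
      vzero = (\<lambda>x. 0),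
      vscale = (\<lambda>c f x. c * f x),
      vnorm = (\<lambda>f. SUP x\<in>{x \<in> vcarrier V. vnorm V x \<le> 1}. norm (f x))\<rparr>"

definition annihilator :: "('k::real_or_complex, 'v) nvs \<Rightarrow> 'v set \<Rightarrow> ('v \<Rightarrow> 'k) set" where
  "annihilator V Y = {f \<in> vcarrier (dual V). \<forall>y\<in>Y. f y = 0}"

definition closed_complement ::
  "('k::real_or_complex, 'v) nvs \<Rightarrow> 'v set \<Rightarrow> 'v set \<Rightarrow> bool" where
  "closed_complement V Z1 Z2 \<longleftrightarrow>
     closed_subspace V Z2 \<and> Z1 \<inter> Z2 = {vzero V} \<and>
     (\<forall>x\<in>vcarrier V. \<exists>z1\<in>Z1. \<exists>z2\<in>Z2. x = vadd V z1 z2)"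

definition M_ideal :: "('k::real_or_complex, 'v) nvs \<Rightarrow> 'v set \<Rightarrow> bool" where
  "M_ideal V Y \<longleftrightarrow>
     closed_subspace V Y \<and>
     (\<exists>Z2. closed_complement (dual V) (annihilator V Y) Z2 \<and>
        (\<forall>z1\<in>annihilator V Y. \<forall>z2\<in>Z2.
           vnorm (dual V) (vadd (dual V) z1 z2) = vnorm (dual V) z1 + vnorm (dual V) z2))"


section \<open>Banach bundles\<close>

text \<open>
  The bundle space and the base space are the topological spaces given by the types \<open>'e\<close> and \<open>'t\<close>.
  The value of \<open>badd\<close> is only meaningful for two points of the same fiber.
\<close>

record ('k, 'e, 't) bundle_data =
  proj :: "'e \<Rightarrow> 't"
  badd :: "'e \<Rightarrow> 'e \<Rightarrow> 'e"
  bzero :: "'t \<Rightarrow> 'e"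
  bscale :: "'k \<Rightarrow> 'e \<Rightarrow> 'e"
  bnorm :: "'e \<Rightarrow> real"

definition fiber :: "('k, 'e, 't) bundle_data \<Rightarrow> 't \<Rightarrow> ('k, 'e) nvs" where
  "fiber \<xi> t =
     \<lparr>vcarrier = proj \<xi> -` {t}, vadd = badd \<xi>, vzero = bzero \<xi> t,
      vscale = bscale \<xi>, vnorm = bnorm \<xi>\<rparr>"

text \<open>
  In the last condition filters on the bundle space play the role of nets: a net converges
  if and only if the filter generated by its tails does.
\<close>

definition banach_bundle ::
  "('k::real_or_complex, 'e::topological_space, 't::t2_space) bundle_data \<Rightarrow> bool" where
  "banach_bundle \<xi> \<longleftrightarrow>
     continuous_on UNIV (proj \<xi>) \<and>
     open_map euclidean euclidean (proj \<xi>) \<and>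
     surj (proj \<xi>) \<and>
     (\<forall>t. banach_space (fiber \<xi> t)) \<and>
     continuous_on {(x, y). proj \<xi> x = proj \<xi> y} (\<lambda>(x, y). badd \<xi> x y) \<and>
     continuous_on UNIV (\<lambda>(c, x). bscale \<xi> c x) \<and>
     (\<forall>r. open {x. bnorm \<xi> x < r}) \<and>
     (\<forall>(F :: 'e filter) t.
        (proj \<xi> \<longlongrightarrow> t) F \<and> (bnorm \<xi> \<longlongrightarrow> 0) F \<longrightarrow> ((\<lambda>x. x) \<longlongrightarrow> bzero \<xi> t) F)"

definition banach_subbundle ::
  "('k::real_or_complex, 'e::topological_space, 't::t2_space) bundle_data \<Rightarrow> 'e set \<Rightarrow> bool" where
  "banach_subbundle \<xi> \<F> \<longleftrightarrow>
     proj \<xi> ` \<F> = UNIV \<and>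
     open_map (top_of_set \<F>) euclidean (proj \<xi>) \<and>
     (\<forall>t. closed_subspace (fiber \<xi> t) (proj \<xi> -` {t} \<inter> \<F>))"

definition is_section ::
  "('k, 'e::topological_space, 't::topological_space) bundle_data \<Rightarrow> ('t \<Rightarrow> 'e) \<Rightarrow> bool" where
  "is_section \<xi> f \<longleftrightarrow> continuous_on UNIV f \<and> (\<forall>t. proj \<xi> (f t) = t)"

definition vanishes_at_infinity ::
  "('k, 'e, 't::topological_space) bundle_data \<Rightarrow> ('t \<Rightarrow> 'e) \<Rightarrow> bool" where
  "vanishes_at_infinity \<xi> f \<longleftrightarrow> (\<forall>\<epsilon>>0. compact {t. bnorm \<xi> (f t) \<ge> \<epsilon>})"

definition Gamma0 ::
  "('k::real_or_complex, 'e::topological_space, 't::t2_space) bundle_data \<Rightarrow> ('k, 't \<Rightarrow> 'e) nvs" where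
  "Gamma0 \<xi> =
     \<lparr>vcarrier = {f. is_section \<xi> f \<and> vanishes_at_infinity \<xi> f},
      vadd = (\<lambda>f g t. badd \<xi> (f t) (g t)),
      vzero = bzero \<xi>,
      vscale = (\<lambda>c f t. bscale \<xi> c (f t)),
      vnorm = (\<lambda>f. SUP t. bnorm \<xi> (f t))\<rparr>"

definition Gamma0_sub ::
  "('k::real_or_complex, 'e::topological_space, 't::t2_space) bundle_data \<Rightarrow> 'e set
    \<Rightarrow> ('t \<Rightarrow> 'e) set" where
  "Gamma0_sub \<xi> \<F> = {f \<in> vcarrier (Gamma0 \<xi>). \<forall>t. f t \<in> \<F>}"

end

theory Submission
  imports Defs
begin

text \<open>
  By the Hahn--Banach theorem, a closed subspace \<open>Y\<close> of \<open>V\<close> is an M-ideal if and only if it has the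
  3-ball property: for \<open>x\<close> in the unit ball of \<open>V\<close>, \<open>y\<^sub>1, y\<^sub>2, y\<^sub>3\<close> in the unit ball of \<open>Y\<close> and
  \<open>e > 0\<close> some \<open>z\<close> in \<open>Y\<close> satisfies \<open>\<parallel>x + y\<^sub>i + z\<parallel> \<le> 1 + e\<close> for all \<open>i\<close>. This property passes from the
  fibers to the sections by gluing local solutions with convex combinations, and from the sections
  to the fibers by evaluation. Both need sections of the subbundle close to any given point of it;
  they are limits of selections whose oscillation tends to zero. That an M-ideal \<open>L\<close> of sections
  consists of all sections with values in the closure of its values follows from gluing again, since
  \<open>L\<close> is invariant under multiplication by continuous functions with values in \<open>[0, 1]\<close>.
\<close>

section \<open>Real parts of scalars\<close>

text \<open>The norm is only upper semicontinuous: a strict upper bound on the norm of a section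
  persists near a point, a lower bound does not. Everything that is glued must therefore be an upper
  bound for norms, which convex combinations respect as well. The definition of an M-ideal by
  functionals offers nothing of this kind, and duals of the section space and of the fibers are
  never compared; hence the detour through the 3-ball property. After that equivalence, functionals
  return only for the invariance under multiplication by functions. Continuous sections near a given
  point are not supplied by the axioms: the bundle need not be locally trivial. Openness of the
  projection supplies points over nearby base points and nothing more, so arbitrary choices come
  first and continuity is restored in a limit, for which the fibers have to be complete. Both scalar
  fields are treated together: the Hahn-Banach theorem is proved for real functionals, and a scalar
  that is 0 or a square root of -1 recovers functionals over the field.\<close>

definition scalar_embedding :: "'k::real_or_complex \<Rightarrow> complex" where
  "scalar_embedding = (SOME \<phi>. (\<forall>x y. \<phi> (x + y) = \<phi> x + \<phi> y) \<and> (\<forall>x y. \<phi> (x * y) = \<phi> x * \<phi> y) \<and>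
       (\<forall>x. cmod (\<phi> x) = norm x) \<and> (range \<phi> = \<real> \<or> range \<phi> = UNIV))"

definition repart :: "'k::real_or_complex \<Rightarrow> real" where
  "repart c = Re (scalar_embedding c)"

lemma scalar_embedding_add: "scalar_embedding (x + y) = scalar_embedding x + scalar_embedding y"
  and scalar_embedding_mult: "scalar_embedding (x * y) = scalar_embedding x * scalar_embedding y"
  and norm_scalar_embedding: "cmod (scalar_embedding x) = norm x"
  and range_scalar_embedding:
    "range (scalar_embedding :: 'k::real_or_complex \<Rightarrow> complex) = \<real> \<or>
     range (scalar_embedding :: 'k \<Rightarrow> complex) = UNIV"
  for x y :: "'k::real_or_complex"
  using someI_ex[OF isometric_to_real_or_complex[where ?'a = 'k]]
  unfolding scalar_embedding_def[symmetric] by blast+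

lemma scalar_embedding_diff: "scalar_embedding (x - y) = scalar_embedding x - scalar_embedding y"
  by (metis add_diff_cancel diff_add_cancel scalar_embedding_add)

lemma scalar_embedding_0: "scalar_embedding 0 = 0"
  by (metis norm_scalar_embedding norm_eq_zero)

lemma scalar_embedding_1: "scalar_embedding (1 :: 'k::real_or_complex) = 1"
proof -
  have "scalar_embedding (1 :: 'k) * scalar_embedding (1 :: 'k) = scalar_embedding (1 :: 'k)"
    by (metis mult_1 scalar_embedding_mult)
  moreover have "scalar_embedding (1 :: 'k) \<noteq> 0"
    by (metis norm_one norm_scalar_embedding norm_zero zero_neq_one)
  ultimately show ?thesis by simp
qed

lemma scalar_embedding_eq_iff: "scalar_embedding x = scalar_embedding y \<longleftrightarrow> x = y"
  by (metis eq_iff_diff_eq_0 norm_eq_zero norm_scalar_embedding scalar_embedding_diff)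

text \<open>The embedding is not assumed to fix the reals. Being isometric, it sends
  \<open>r\<close> to a point at distance |r| from 0 and |r - 1| from 1, and these two circles touch
  only at \<open>r\<close>.\<close>

lemma scalar_embedding_of_real:
  "scalar_embedding (of_real r :: 'k::real_or_complex) = complex_of_real r"
proof -
  let ?c = "scalar_embedding (of_real r :: 'k)"
  have n: "cmod ?c = \<bar>r\<bar>" by (simp add: norm_scalar_embedding)
  have "cmod (?c - 1) = norm (of_real r - 1 :: 'k)"
    by (metis norm_scalar_embedding scalar_embedding_1 scalar_embedding_diff)
  also have "\<dots> = \<bar>r - 1\<bar>"
    by (metis norm_of_real of_real_1 of_real_diff)
  finally have n1: "(cmod (?c - 1))\<^sup>2 = (r - 1)\<^sup>2" by simp
  have n2: "(Re ?c)\<^sup>2 + (Im ?c)\<^sup>2 = r\<^sup>2"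
    using n by (metis cmod_power2 power2_abs)
  have "(Re ?c - 1)\<^sup>2 + (Im ?c)\<^sup>2 = (r - 1)\<^sup>2"
    using n1 by (simp add: cmod_power2)
  with n2 have re: "Re ?c = r" by (simp add: power2_eq_square algebra_simps)
  with n2 have "Im ?c = 0" by simp
  with re show ?thesis by (simp add: complex_eq_iff)
qed

lemma repart_add: "repart (x + y) = repart x + repart y"
  by (simp add: repart_def scalar_embedding_add)

lemma repart_diff: "repart (x - y) = repart x - repart y"
  by (simp add: repart_def scalar_embedding_diff)

lemma repart_0 [simp]: "repart 0 = 0"
  by (simp add: repart_def scalar_embedding_0)

lemma repart_minus: "repart (- x) = - repart x"
  using repart_diff[of 0 x] by simp

lemma repart_of_real [simp]: "repart (of_real r) = r"
  by (simp add: repart_def scalar_embedding_of_real)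

lemma repart_of_real_mult [simp]: "repart (of_real r * c) = r * repart c"
  by (simp add: repart_def scalar_embedding_of_real scalar_embedding_mult)

lemma repart_le_norm: "repart c \<le> norm c"
  by (metis complex_Re_le_cmod norm_scalar_embedding repart_def)

lemma unimodular_rotation:
  fixes c :: "'k::real_or_complex"
  obtains u where "norm u = 1" "u * c = of_real (norm c)"
proof (cases "c = 0")
  case True
  then show ?thesis using that[of 1] by simp
next
  case False
  then show ?thesis
    by (intro that[of "of_real (norm c) / c"]) (simp_all add: norm_divide)
qed

text \<open>For complex scalars this is a square root of -1, for real scalars it is 0. The
  decomposition of \<open>c\<close> then holds over both fields, so a functional can be recovered
  from its real part by one formula.\<close>

definition imag_unit :: "'k::real_or_complex" where
  "imag_unit = (SOME j. (j = 0 \<or> j * j = - 1) \<and>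
     (\<forall>c. c = of_real (repart c) - j * of_real (repart (j * c))))"

lemma imag_unit_exists:
  "\<exists>j :: 'k::real_or_complex. (j = 0 \<or> j * j = - 1) \<and>
     (\<forall>c. c = of_real (repart c) - j * of_real (repart (j * c)))"
proof (cases "range (scalar_embedding :: 'k \<Rightarrow> complex) = \<real>")
  case True
  have "c = of_real (repart c)" for c :: 'k
  proof -
    have "scalar_embedding c \<in> \<real>" using True by blast
    then have "scalar_embedding c = of_real (repart c)"
      by (simp add: repart_def of_real_Re)
    then show ?thesis by (metis scalar_embedding_eq_iff scalar_embedding_of_real)
  qed
  then show ?thesis by (intro exI[of _ 0]) simp
next
  case False
  then obtain j :: 'k where j: "scalar_embedding j = \<i>"
    using range_scalar_embedding[where ?'k = 'k] by (metis UNIV_I imageE)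
  have "scalar_embedding (j * j + 1) = 0"
    by (simp add: scalar_embedding_add scalar_embedding_mult scalar_embedding_1 j)
  then have "j * j + 1 = 0"
    by (metis scalar_embedding_0 scalar_embedding_eq_iff)
  then have jj: "j * j = - 1" by (simp add: eq_neg_iff_add_eq_0)
  have "c = of_real (repart c) - j * of_real (repart (j * c))" for c
  proof -
    have "scalar_embedding (of_real (repart c) - j * of_real (repart (j * c))) = scalar_embedding c"
      by (simp add: scalar_embedding_diff scalar_embedding_add scalar_embedding_mult
          scalar_embedding_of_real j repart_def complex_eq_iff)
    then show ?thesis by (simp add: scalar_embedding_eq_iff)
  qed
  with jj show ?thesis by blast
qed

lemma imag_unit_cases: "(imag_unit :: 'k::real_or_complex) = 0 \<or> (imag_unit * imag_unit :: 'k) = - 1"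
  and scalar_decomp: "c = of_real (repart c) - imag_unit * of_real (repart (imag_unit * c))"
  for c :: "'k::real_or_complex"
  using someI_ex[OF imag_unit_exists[where ?'k = 'k]]
  unfolding imag_unit_def[symmetric] by blast+


section \<open>Vector spaces with a carrier and the Hahn--Banach theorem\<close>

locale kspace =
  fixes V :: "('k::real_or_complex, 'v) nvs"
  assumes axioms: "vector_space_axioms_on V"
begin

abbreviation C where "C \<equiv> vcarrier V"
abbreviation plus (infixl "\<oplus>" 65) where "x \<oplus> y \<equiv> vadd V x y"
abbreviation scale (infixr "\<odot>" 75) where "c \<odot> x \<equiv> vscale V c x"
abbreviation zero ("\<zero>") where "\<zero> \<equiv> vzero V"
abbreviation neg where "neg x \<equiv> vscale V (- 1) x"

lemma zero_closed [simp, intro]: "\<zero> \<in> C"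
  and add_closed [simp, intro]: "x \<in> C \<Longrightarrow> y \<in> C \<Longrightarrow> x \<oplus> y \<in> C"
  and scale_closed [simp, intro]: "x \<in> C \<Longrightarrow> c \<odot> x \<in> C"
  and add_assoc: "x \<in> C \<Longrightarrow> y \<in> C \<Longrightarrow> z \<in> C \<Longrightarrow> x \<oplus> y \<oplus> z = x \<oplus> (y \<oplus> z)"
  and add_commute: "x \<in> C \<Longrightarrow> y \<in> C \<Longrightarrow> x \<oplus> y = y \<oplus> x"
  and zero_add [simp]: "x \<in> C \<Longrightarrow> \<zero> \<oplus> x = x"
  and scale_add: "x \<in> C \<Longrightarrow> y \<in> C \<Longrightarrow> c \<odot> (x \<oplus> y) = c \<odot> x \<oplus> c \<odot> y"
  and add_scale: "x \<in> C \<Longrightarrow> (c + d) \<odot> x = c \<odot> x \<oplus> d \<odot> x"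
  and scale_one [simp]: "x \<in> C \<Longrightarrow> 1 \<odot> x = x"
  and ex_neg: "x \<in> C \<Longrightarrow> \<exists>y\<in>C. x \<oplus> y = \<zero>"
  by (insert axioms, unfold vector_space_axioms_on_def, metis+)

lemma scale_scale: "x \<in> C \<Longrightarrow> c \<odot> d \<odot> x = (c * d) \<odot> x"
  using axioms unfolding vector_space_axioms_on_def by metis

lemma add_left_commute: "x \<in> C \<Longrightarrow> y \<in> C \<Longrightarrow> z \<in> C \<Longrightarrow> x \<oplus> (y \<oplus> z) = y \<oplus> (x \<oplus> z)"
  by (metis add_assoc add_commute)

lemmas add_ac = add_assoc add_commute add_left_commute

lemma add_zero [simp]: "x \<in> C \<Longrightarrow> x \<oplus> \<zero> = x"
  by (metis add_commute zero_add zero_closed)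

lemma add_right_cancel: "x \<in> C \<Longrightarrow> y \<in> C \<Longrightarrow> z \<in> C \<Longrightarrow> x \<oplus> z = y \<oplus> z \<longleftrightarrow> x = y"
  by (metis add_assoc add_zero ex_neg)

lemma scale_0 [simp]: "x \<in> C \<Longrightarrow> 0 \<odot> x = \<zero>"
  by (metis add_right_cancel add_scale add_0 scale_closed zero_add zero_closed)

lemma scale_zero [simp]: "c \<odot> \<zero> = \<zero>"
  by (metis mult_zero_right scale_0 scale_scale zero_closed)

lemma add_neg [simp]: "x \<in> C \<Longrightarrow> x \<oplus> neg x = \<zero>"
  using add_scale[of x 1 "- 1"] by simp

lemma neg_add [simp]: "x \<in> C \<Longrightarrow> neg x \<oplus> x = \<zero>"
  by (metis add_commute add_neg scale_closed)

lemma neg_neg [simp]: "x \<in> C \<Longrightarrow> neg (neg x) = x"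
  by (simp add: scale_scale)

lemma add_neg_cancel [simp]: "x \<in> C \<Longrightarrow> y \<in> C \<Longrightarrow> x \<oplus> neg y \<oplus> y = x"
  by (simp add: add_assoc)

lemma add_add_swap: "a \<in> C \<Longrightarrow> b \<in> C \<Longrightarrow> c \<in> C \<Longrightarrow> d \<in> C \<Longrightarrow> a \<oplus> b \<oplus> (c \<oplus> d) = a \<oplus> c \<oplus> (b \<oplus> d)"
  by (simp add: add_assoc add_left_commute)

lemma add_neg_eq_zero_iff: "x \<in> C \<Longrightarrow> y \<in> C \<Longrightarrow> x \<oplus> neg y = \<zero> \<longleftrightarrow> x = y"
  by (metis add_neg_cancel add_neg zero_add)

section \<open>Sublinear functionals and the Hahn-Banach theorem\<close>

definition sublinear :: "('v \<Rightarrow> real) \<Rightarrow> bool" where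
  "sublinear q \<longleftrightarrow> (\<forall>x\<in>C. \<forall>y\<in>C. q (x \<oplus> y) \<le> q x + q y) \<and>
     (\<forall>r>0. \<forall>x\<in>C. q (of_real r \<odot> x) \<le> r * q x)"

definition real_linear :: "('v \<Rightarrow> real) \<Rightarrow> bool" where
  "real_linear u \<longleftrightarrow> (\<forall>x\<in>C. \<forall>y\<in>C. u (x \<oplus> y) = u x + u y) \<and>
     (\<forall>r. \<forall>x\<in>C. u (of_real r \<odot> x) = r * u x)"

lemma sublinearD:
  assumes "sublinear q"
  shows "x \<in> C \<Longrightarrow> y \<in> C \<Longrightarrow> q (x \<oplus> y) \<le> q x + q y"
    and "r > 0 \<Longrightarrow> x \<in> C \<Longrightarrow> q (of_real r \<odot> x) \<le> r * q x"
  using assms unfolding sublinear_def by blast+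

lemma sublinear_zero:
  assumes "sublinear q" shows "q \<zero> = 0"
proof -
  have "q \<zero> \<le> q \<zero> + q \<zero>"
    using sublinearD(1)[OF assms zero_closed zero_closed] by simp
  moreover have "q \<zero> \<le> (1/2) * q \<zero>"
    using sublinearD(2)[OF assms, of "1/2" \<zero>] by simp
  ultimately show ?thesis by simp
qed

text \<open>The missing inequality is the assumed one for the factor \<open>1 / r\<close>, applied
  to the multiple of \<open>x\<close> by \<open>r\<close>. Asking for one inequality only in
  \<open>sublinear\<close> spares work for functionals defined as infima.\<close>

lemma sublinear_scale:
  assumes q: "sublinear q" and r: "r \<ge> 0" and x: "x \<in> C"
  shows "q (of_real r \<odot> x) = r * q x"
proof (cases "r = 0")
  case True
  then show ?thesis using sublinear_zero[OF q] x by simp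
next
  case False
  with r have r: "r > 0" by simp
  have "of_real (1/r) \<odot> of_real r \<odot> x = x"
    using x r by (simp add: scale_scale flip: of_real_mult)
  then have "q x \<le> (1/r) * q (of_real r \<odot> x)"
    using sublinearD(2)[OF q, of "1/r" "of_real r \<odot> x"] r x by simp
  then have "r * q x \<le> q (of_real r \<odot> x)"
    using r by (simp add: field_simps)
  with sublinearD(2)[OF q r x] show ?thesis by simp
qed

lemma sublinear_neg:
  assumes q: "sublinear q" and x: "x \<in> C"
  shows "- q (neg x) \<le> q x"
  using sublinearD(1)[OF q x scale_closed[OF x]] sublinear_zero[OF q] x by (smt (verit) add_neg)

text \<open>
  Tilting towards \<open>a\<close>: the tilted functional is below the given one and attains \<open>- q a\<close> at
  \<open>- a\<close>, so that a minimal sublinear functional is additive in the direction \<open>a\<close>.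
\<close>

definition tilt :: "'v \<Rightarrow> ('v \<Rightarrow> real) \<Rightarrow> 'v \<Rightarrow> real" where
  "tilt a q x = (INF t\<in>{0..}. q (x \<oplus> of_real t \<odot> a) - t * q a)"

lemma tilt_le:
  assumes q: "sublinear q" and a: "a \<in> C" and x: "x \<in> C" and t: "t \<ge> 0"
  shows "tilt a q x \<le> q (x \<oplus> of_real t \<odot> a) - t * q a"
proof -
  have "bdd_below ((\<lambda>t. q (x \<oplus> of_real t \<odot> a) - t * q a) ` {0..})"
  proof (rule bdd_belowI2)
    fix s :: real assume s: "s \<in> {0..}"
    have "s * q a = q (of_real s \<odot> a)" using sublinear_scale[OF q _ a] s by simp
    also have "of_real s \<odot> a = x \<oplus> of_real s \<odot> a \<oplus> neg x"
      using x a by (simp add: add_commute[of x "of_real s \<odot> a"] add_assoc)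
    also have "q \<dots> \<le> q (x \<oplus> of_real s \<odot> a) + q (neg x)"
      by (intro sublinearD(1)[OF q]) (use x a in auto)
    finally show "- q (neg x) \<le> q (x \<oplus> of_real s \<odot> a) - s * q a" by simp
  qed
  then show ?thesis unfolding tilt_def by (rule cINF_lower) (use t in auto)
qed

lemma tilt_ge:
  assumes "\<And>t. t \<ge> 0 \<Longrightarrow> b \<le> q (x \<oplus> of_real t \<odot> a) - t * q a"
  shows "b \<le> tilt a q x"
  unfolding tilt_def by (rule cINF_greatest) (use assms in auto)

text \<open>The parameters of the two infima add: shifting \<open>x\<close> by \<open>s\<close>
  times \<open>a\<close> and \<open>y\<close> by \<open>t\<close> times \<open>a\<close> shifts the
  sum by \<open>s + t\<close> times \<open>a\<close> and subtracts \<open>(s + t) * q a\<close>.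
  Scaling by \<open>r\<close> likewise scales the parameter.\<close>

lemma sublinear_tilt:
  assumes q: "sublinear q" and a: "a \<in> C"
  shows "sublinear (tilt a q)"
proof -
  have add: "tilt a q (x \<oplus> y) \<le> tilt a q x + tilt a q y" if x: "x \<in> C" and y: "y \<in> C" for x y
  proof -
    have "tilt a q (x \<oplus> y) - tilt a q x \<le> tilt a q y"
    proof (rule tilt_ge)
      fix t :: real assume t: "t \<ge> 0"
      have "tilt a q (x \<oplus> y) - (q (y \<oplus> of_real t \<odot> a) - t * q a) \<le> tilt a q x"
      proof (rule tilt_ge)
        fix s :: real assume s: "s \<ge> 0"
        have "x \<oplus> y \<oplus> of_real (s + t) \<odot> a = x \<oplus> of_real s \<odot> a \<oplus> (y \<oplus> of_real t \<odot> a)"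
          using x y a by (simp add: add_scale add_add_swap)
        then have "q (x \<oplus> y \<oplus> of_real (s + t) \<odot> a) \<le> q (x \<oplus> of_real s \<odot> a) + q (y \<oplus> of_real t \<odot> a)"
          using sublinearD(1)[OF q, of "x \<oplus> of_real s \<odot> a" "y \<oplus> of_real t \<odot> a"] x y a by simp
        moreover have "tilt a q (x \<oplus> y) \<le> q (x \<oplus> y \<oplus> of_real (s + t) \<odot> a) - (s + t) * q a"
          by (rule tilt_le[OF q a]) (use x y s t in auto)
        ultimately show "tilt a q (x \<oplus> y) - (q (y \<oplus> of_real t \<odot> a) - t * q a)
            \<le> q (x \<oplus> of_real s \<odot> a) - s * q a"
          by (simp add: algebra_simps)
      qed
      then show "tilt a q (x \<oplus> y) - tilt a q x \<le> q (y \<oplus> of_real t \<odot> a) - t * q a" by simp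
    qed
    then show ?thesis by simp
  qed
  have scale: "tilt a q (of_real r \<odot> x) \<le> r * tilt a q x" if r: "r > 0" and x: "x \<in> C" for r x
  proof -
    have "tilt a q (of_real r \<odot> x) / r \<le> tilt a q x"
    proof (rule tilt_ge)
      fix t :: real assume t: "t \<ge> 0"
      have "tilt a q (of_real r \<odot> x) \<le> q (of_real r \<odot> x \<oplus> of_real (r * t) \<odot> a) - (r * t) * q a"
        by (rule tilt_le[OF q a]) (use x r t in auto)
      also have "of_real r \<odot> x \<oplus> of_real (r * t) \<odot> a = of_real r \<odot> (x \<oplus> of_real t \<odot> a)"
        using x a by (simp add: scale_add scale_scale)
      also have "q \<dots> = r * q (x \<oplus> of_real t \<odot> a)"
        by (rule sublinear_scale[OF q]) (use x a r in auto)
      finally show "tilt a q (of_real r \<odot> x) / r \<le> q (x \<oplus> of_real t \<odot> a) - t * q a"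
        using r by (simp add: field_simps)
    qed
    then show ?thesis using r by (simp add: field_simps)
  qed
  show ?thesis unfolding sublinear_def using add scale by blast
qed

text \<open>Zorn's lemma for the reversed pointwise order. The infimum of a chain is again sublinear
  because of two members of a chain one lies below the other, and it is finite because each member
  \<open>q\<close> satisfies \<open>- p (neg x) \<le> q x\<close>.\<close>

lemma minimal_sublinear:
  assumes p: "sublinear p"
  shows "\<exists>m. sublinear m \<and> (\<forall>x\<in>C. m x \<le> p x) \<and>
    (\<forall>q. sublinear q \<longrightarrow> (\<forall>x\<in>C. q x \<le> m x) \<longrightarrow> (\<forall>x\<in>C. q x = m x))"
proof -
  \<comment> \<open>Values off the carrier are set to 0; otherwise the pointwise order on the
    carrier would not be antisymmetric.\<close>
  define A where "A = {q. sublinear q \<and> (\<forall>x\<in>C. q x \<le> p x) \<and> (\<forall>x. x \<notin> C \<longrightarrow> q x = 0)}"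
  define P where "P = (\<lambda>q q' :: 'v \<Rightarrow> real. \<forall>x\<in>C. q' x \<le> q x)"
  have cut: "(\<lambda>x. if x \<in> C then q x else 0) \<in> A" if "sublinear q" "\<forall>x\<in>C. q x \<le> p x" for q
    using that unfolding A_def sublinear_def by simp
  have "partial_order_on A (relation_of P A)"
    unfolding partial_order_on_def preorder_on_def refl_on_def trans_def antisym_def relation_of_def
  proof (intro conjI allI impI)
    fix q q' assume "(q, q') \<in> {(a, b) \<in> A \<times> A. P a b}" "(q', q) \<in> {(a, b) \<in> A \<times> A. P a b}"
    then have q: "q \<in> A" "q' \<in> A" "P q q'" "P q' q" by auto
    show "q = q'"
    proof (rule ext)
      fix x show "q x = q' x"
        using q unfolding P_def A_def by (cases "x \<in> C") (simp_all add: antisym)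
    qed
  qed (auto simp: P_def intro: order_trans)
  moreover have "\<exists>u\<in>A. \<forall>a\<in>K. P a u" if K: "K \<in> Chains (relation_of P A)" for K
  proof (cases "K = {}")
    case True
    then show ?thesis using cut[OF p] by auto
  next
    case False
    have KA: "K \<subseteq> A" using K unfolding Chains_def relation_of_def by auto
    have chain: "P f g \<or> P g f" if "f \<in> K" "g \<in> K" for f g
      using K that unfolding Chains_def relation_of_def by auto
    define k where "k x = (INF f\<in>K. f x)" for x
    have bdd: "bdd_below ((\<lambda>f. f x) ` K)" if x: "x \<in> C" for x
    proof (rule bdd_belowI2)
      fix f assume "f \<in> K"
      then have f: "f \<in> A" using KA by blast
      then have "f (neg x) \<le> p (neg x)" using x by (auto simp: A_def)
      moreover have "- f (neg x) \<le> f x" by (rule sublinear_neg) (use f x in \<open>auto simp: A_def\<close>)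
      ultimately show "- p (neg x) \<le> f x" by simp
    qed
    have le: "k x \<le> f x" if "x \<in> C" "f \<in> K" for x f
      unfolding k_def by (rule cINF_lower[OF bdd]) (use that in auto)
    have ge: "b \<le> k x" if "\<And>f. f \<in> K \<Longrightarrow> b \<le> f x" for b x
      unfolding k_def by (rule cINF_greatest[OF False]) (use that in auto)
    have "sublinear k"
      unfolding sublinear_def
    proof (intro conjI ballI allI impI)
      fix x y assume x: "x \<in> C" and y: "y \<in> C"
      have "k (x \<oplus> y) - k x \<le> k y"
      proof (rule ge)
        fix g assume g: "g \<in> K"
        have "k (x \<oplus> y) - g y \<le> k x"
        proof (rule ge)
          fix f assume f: "f \<in> K"
          obtain h where h: "h \<in> K" "h x \<le> f x" "h y \<le> g y"
            using chain[OF f g] f g x y unfolding P_def by force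
          have "k (x \<oplus> y) \<le> h (x \<oplus> y)" using le[OF _ h(1)] x y by simp
          also have "\<dots> \<le> h x + h y"
            by (rule sublinearD(1)) (use h KA x y in \<open>auto simp: A_def\<close>)
          finally show "k (x \<oplus> y) - g y \<le> f x" using h by simp
        qed
        then show "k (x \<oplus> y) - k x \<le> g y" by simp
      qed
      then show "k (x \<oplus> y) \<le> k x + k y" by simp
    next
      fix r :: real and x assume r: "r > 0" and x: "x \<in> C"
      have "k (of_real r \<odot> x) / r \<le> k x"
      proof (rule ge)
        fix f assume f: "f \<in> K"
        have "k (of_real r \<odot> x) \<le> f (of_real r \<odot> x)" using le[OF _ f] x by simp
        also have "\<dots> \<le> r * f x"
          by (rule sublinearD(2)) (use f KA x r in \<open>auto simp: A_def\<close>)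
        finally show "k (of_real r \<odot> x) / r \<le> f x" using r by (simp add: field_simps)
      qed
      then show "k (of_real r \<odot> x) \<le> r * k x" using r by (simp add: field_simps)
    qed
    moreover have "\<forall>x\<in>C. k x \<le> p x"
    proof
      fix x assume x: "x \<in> C"
      from False obtain f where f: "f \<in> K" by blast
      with KA have "f x \<le> p x" using x by (auto simp: A_def)
      with le[OF x f] show "k x \<le> p x" by simp
    qed
    ultimately have "(\<lambda>x. if x \<in> C then k x else 0) \<in> A" by (rule cut)
    moreover have "\<forall>a\<in>K. P a (\<lambda>x. if x \<in> C then k x else 0)"
      unfolding P_def using le by simp
    ultimately show ?thesis by blast
  qed
  ultimately obtain m where m: "m \<in> A" and min: "\<And>q. q \<in> A \<Longrightarrow> P m q \<Longrightarrow> q = m"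
    using predicate_Zorn[of A P] by metis
  show ?thesis
  proof (intro exI[of _ m] conjI allI impI ballI)
    show "sublinear m" "\<And>x. x \<in> C \<Longrightarrow> m x \<le> p x" using m by (auto simp: A_def)
    fix q x assume q: "sublinear q" "\<forall>x\<in>C. q x \<le> m x" and x: "x \<in> C"
    have "(\<lambda>x. if x \<in> C then q x else 0) = m"
    proof (rule min)
      show "(\<lambda>x. if x \<in> C then q x else 0) \<in> A"
        by (rule cut) (use q m in \<open>auto simp: A_def intro: order_trans\<close>)
    qed (use q in \<open>auto simp: P_def\<close>)
    then have "(if x \<in> C then q x else 0) = m x" by (rule fun_cong)
    then show "q x = m x" using x by simp
  qed
qed

text \<open>A minimal functional cannot be lowered by tilting towards any \<open>y\<close>, which
  makes it additive. Starting below \<open>tilt a p\<close> instead of \<open>p\<close> forces the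
  value \<open>p a\<close> at \<open>a\<close>.\<close>

theorem hahn_banach:
  assumes p: "sublinear p" and a: "a \<in> C"
  obtains u where "real_linear u" "\<And>x. x \<in> C \<Longrightarrow> u x \<le> p x" "u a = p a"
proof -
  obtain m where m: "sublinear m" and mle': "\<forall>x\<in>C. m x \<le> tilt a p x"
    and min: "\<forall>q. sublinear q \<longrightarrow> (\<forall>x\<in>C. q x \<le> m x) \<longrightarrow> (\<forall>x\<in>C. q x = m x)"
    using minimal_sublinear[OF sublinear_tilt[OF p a]] by (elim exE conjE)
  have mle: "m x \<le> tilt a p x" if "x \<in> C" for x using mle' that by (rule bspec)
  have tp: "tilt a p x \<le> p x" if "x \<in> C" for x
    using tilt_le[OF p a that, of 0] that a by simp
  have add: "m (x \<oplus> y) = m x + m y" if x: "x \<in> C" and y: "y \<in> C" for x y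
  proof (rule antisym)
    show "m (x \<oplus> y) \<le> m x + m y" by (rule sublinearD(1)[OF m x y])
    have "tilt y m z \<le> m z" if "z \<in> C" for z
      using tilt_le[OF m y that, of 0] that y by simp
    then have "m x = tilt y m x" using min[rule_format, OF sublinear_tilt[OF m y] _ x] by simp
    also have "\<dots> \<le> m (x \<oplus> y) - m y" using tilt_le[OF m y x, of 1] y by simp
    finally show "m x + m y \<le> m (x \<oplus> y)" by simp
  qed
  have neg: "m (neg x) = - m x" if "x \<in> C" for x
    using add[OF that scale_closed[OF that], of "- 1"] that sublinear_zero[OF m] by simp
  have scale: "m (of_real r \<odot> x) = r * m x" if x: "x \<in> C" for r x
  proof (cases "r \<ge> 0")
    case True
    then show ?thesis by (rule sublinear_scale[OF m _ x])
  next
    case False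
    have "of_real r \<odot> x = neg (of_real (- r) \<odot> x)" using x by (simp add: scale_scale)
    also have "m \<dots> = - (- r * m x)"
      using neg[of "of_real (- r) \<odot> x"] sublinear_scale[OF m _ x, of "- r"] False x by simp
    finally show ?thesis by simp
  qed
  show ?thesis
  proof (rule that[of m])
    show "real_linear m" unfolding real_linear_def using add scale by simp
    show le: "m x \<le> p x" if "x \<in> C" for x using mle[OF that] tp[OF that] by simp
    \<comment> \<open>At \<open>neg a\<close> the tilt with parameter 1 reaches the origin, so
      \<open>m (neg a) \<le> - p a\<close>; additivity turns this into
      \<open>p a \<le> m a\<close>.\<close>
    have "m (neg a) \<le> p \<zero> - p a"
      using mle[of "neg a"] tilt_le[OF p a, of "neg a" 1] a by simp
    then have "p a \<le> m a" using neg[OF a] sublinear_zero[OF p] by simp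
    with le[OF a] show "m a = p a" by simp
  qed
qed

end

section \<open>Normed spaces with a carrier and their duals\<close>

lemma le_if_le_add_eps_mult:
  fixes a b k :: real
  assumes "\<And>e. e > 0 \<Longrightarrow> a \<le> b + e * k" and "k \<ge> 0"
  shows "a \<le> b"
proof (rule field_le_epsilon)
  fix d :: real assume d: "d > 0"
  have "a \<le> b + (d / (k + 1)) * k" by (rule assms(1)) (use d assms(2) in simp)
  also have "(d / (k + 1)) * k \<le> d" using d assms(2) by (simp add: field_simps)
  finally show "a \<le> b + d" by simp
qed

lemma convex_less:
  fixes a b c r :: real
  assumes "0 \<le> r" "r \<le> 1" "a < c" "b < c" shows "r * a + (1 - r) * b < c"
  using convex_bound_lt[of a c b r "1 - r"] assms by simp

locale knorm = kspace V for V :: "('k::real_or_complex, 'v) nvs" +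
  assumes norm_axioms: "norm_axioms_on V"
begin

abbreviation n where "n x \<equiv> vnorm V x"

lemma n_ge_0 [simp]: "x \<in> C \<Longrightarrow> 0 \<le> n x"
  and n_eq_0_iff: "x \<in> C \<Longrightarrow> n x = 0 \<longleftrightarrow> x = \<zero>"
  and n_add: "x \<in> C \<Longrightarrow> y \<in> C \<Longrightarrow> n (x \<oplus> y) \<le> n x + n y"
  and n_scale: "x \<in> C \<Longrightarrow> n (c \<odot> x) = norm c * n x"
  by (insert norm_axioms, unfold norm_axioms_on_def, metis+)

lemma n_zero [simp]: "n \<zero> = 0"
  by (simp add: n_eq_0_iff)

lemma n_neg [simp]: "x \<in> C \<Longrightarrow> n (neg x) = n x"
  by (simp add: n_scale)

lemma n_diff_commute:
  assumes x: "x \<in> C" and y: "y \<in> C"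
  shows "n (x \<oplus> neg y) = n (y \<oplus> neg x)"
proof -
  have "x \<oplus> neg y = neg (y \<oplus> neg x)"
    using x y by (simp add: scale_add add_commute)
  then show ?thesis using x y by simp
qed

lemma n_diff_triangle:
  assumes x: "x \<in> C" and y: "y \<in> C" and z: "z \<in> C"
  shows "n (x \<oplus> neg z) \<le> n (x \<oplus> neg y) + n (y \<oplus> neg z)"
proof -
  have "x \<oplus> neg z = x \<oplus> neg y \<oplus> (y \<oplus> neg z)"
    using x y z by (simp flip: add_assoc)
  then show ?thesis using n_add[of "x \<oplus> neg y" "y \<oplus> neg z"] x y z by simp
qed

lemma n_le_add_diff:
  assumes x: "x \<in> C" and y: "y \<in> C"
  shows "n x \<le> n y + n (x \<oplus> neg y)"
  using n_add[of "x \<oplus> neg y" y] x y by simp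

lemma metric: "Metric_space C (vdist V)"
proof
  fix x y z
  show "0 \<le> vdist V x y" by (simp add: vdist_def)
  show "vdist V x y = vdist V y x" using n_diff_commute by (simp add: vdist_def)
  show "x \<in> C \<Longrightarrow> y \<in> C \<Longrightarrow> vdist V x y = 0 \<longleftrightarrow> x = y"
    by (simp add: vdist_def n_eq_0_iff add_neg_eq_zero_iff)
  show "x \<in> C \<Longrightarrow> y \<in> C \<Longrightarrow> z \<in> C \<Longrightarrow> vdist V x z \<le> vdist V x y + vdist V y z"
    using n_diff_triangle by (simp add: vdist_def)
qed

lemma closedin_iff:
  "closedin (vtopology V) Y \<longleftrightarrow>
     Y \<subseteq> C \<and> (\<forall>x\<in>C. (\<forall>e>0. \<exists>y\<in>Y. n (x \<oplus> neg y) < e) \<longrightarrow> x \<in> Y)"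
proof -
  interpret Metric_space C "vdist V" by (rule metric)
  show ?thesis
    unfolding vtopology_def closedin_metric disjnt_iff in_mball
    by (auto simp: vdist_def subset_iff) (metis (no_types, lifting) not_less)+
qed

section \<open>The dual space\<close>

abbreviation D where "D \<equiv> bounded_functionals V"
abbreviation dn where "dn f \<equiv> vnorm (dual V) f"

lemma D_add: "f \<in> D \<Longrightarrow> x \<in> C \<Longrightarrow> y \<in> C \<Longrightarrow> f (x \<oplus> y) = f x + f y"
  and D_scale: "f \<in> D \<Longrightarrow> x \<in> C \<Longrightarrow> f (c \<odot> x) = c * f x"
  and D_outside: "f \<in> D \<Longrightarrow> x \<notin> C \<Longrightarrow> f x = 0"
  unfolding bounded_functionals_def by simp_all

lemma D_zero: "f \<in> D \<Longrightarrow> f \<zero> = 0"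
  using D_scale[of f \<zero> 0] by simp

lemma D_neg: "f \<in> D \<Longrightarrow> x \<in> C \<Longrightarrow> f (neg x) = - f x"
  by (simp add: D_scale)

lemma DI:
  assumes "\<And>x y. x \<in> C \<Longrightarrow> y \<in> C \<Longrightarrow> f (x \<oplus> y) = f x + f y"
    and "\<And>c x. x \<in> C \<Longrightarrow> f (c \<odot> x) = c * f x"
    and "\<And>x. x \<in> C \<Longrightarrow> norm (f x) \<le> B * n x"
    and "\<And>x. x \<notin> C \<Longrightarrow> f x = 0"
  shows "f \<in> D"
  using assms unfolding bounded_functionals_def by blast

lemma D_bdd_above:
  assumes "f \<in> D" shows "bdd_above ((\<lambda>x. norm (f x)) ` {x \<in> C. n x \<le> 1})"
proof -
  obtain B where B: "\<And>x. x \<in> C \<Longrightarrow> norm (f x) \<le> B * n x"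
    using assms unfolding bounded_functionals_def by blast
  show ?thesis
  proof (rule bdd_aboveI2)
    fix x assume "x \<in> {x \<in> C. n x \<le> 1}"
    then have x: "x \<in> C" "n x \<le> 1" by auto
    have "norm (f x) \<le> B * n x" by (rule B[OF x(1)])
    also have "\<dots> \<le> \<bar>B\<bar> * n x" by (rule mult_right_mono) (use x in auto)
    also have "\<dots> \<le> \<bar>B\<bar>" using x by (simp add: mult_left_le)
    finally show "norm (f x) \<le> \<bar>B\<bar>" .
  qed
qed

lemma dn_def: "dn f = (SUP x\<in>{x \<in> C. n x \<le> 1}. norm (f x))"
  by (simp add: dual_def)

lemma dual_simps [simp]:
  "vcarrier (dual V) = D" "vadd (dual V) = (\<lambda>f g x. f x + g x)"
  "vzero (dual V) = (\<lambda>x. 0)" "vscale (dual V) = (\<lambda>c f x. c * f x)"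
  by (simp_all add: dual_def)

lemma norm_le_dn: "f \<in> D \<Longrightarrow> x \<in> C \<Longrightarrow> n x \<le> 1 \<Longrightarrow> norm (f x) \<le> dn f"
  unfolding dn_def by (rule cSUP_upper) (auto intro: D_bdd_above)

lemma dn_le: "(\<And>x. x \<in> C \<Longrightarrow> n x \<le> 1 \<Longrightarrow> norm (f x) \<le> B) \<Longrightarrow> dn f \<le> B"
  unfolding dn_def by (rule cSUP_least) (auto intro: exI[of _ \<zero>])

lemma dn_ge_0: "f \<in> D \<Longrightarrow> 0 \<le> dn f"
  using norm_le_dn[of f \<zero>] by (simp add: D_zero)

lemma normalize:
  assumes x: "x \<in> C" and "x \<noteq> \<zero>"
  obtains y where "y = of_real (1 / n x) \<odot> x" "y \<in> C" "n y = 1" "x = of_real (n x) \<odot> y" "n x > 0"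
proof -
  have pos: "n x > 0" using assms n_eq_0_iff[OF x] n_ge_0[OF x] by linarith
  show ?thesis
    by (rule that[OF refl]) (use x pos in \<open>simp_all add: n_scale scale_scale norm_divide flip: of_real_mult\<close>)
qed

lemma dual_bound:
  assumes f: "f \<in> D" and x: "x \<in> C"
  shows "norm (f x) \<le> dn f * n x"
proof (cases "x = \<zero>")
  case True
  then show ?thesis using f by (simp add: D_zero)
next
  case False
  then obtain y where y: "y \<in> C" "n y = 1" "x = of_real (n x) \<odot> y" "n x > 0"
    using normalize[OF x] by metis
  have "norm (f x) = n x * norm (f y)"
    using y f by (metis D_scale norm_mult norm_of_real abs_of_pos)
  also have "\<dots> \<le> n x * dn f" using norm_le_dn[OF f y(1)] y by (simp add: mult_left_mono)
  finally show ?thesis by (simp add: mult.commute)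
qed

lemma repart_bound: "f \<in> D \<Longrightarrow> x \<in> C \<Longrightarrow> repart (f x) \<le> dn f * n x"
  using dual_bound repart_le_norm order_trans by blast

lemma rotate_into_reals:
  assumes f: "f \<in> D" and x: "x \<in> C"
  obtains u where "norm u = 1" "f (u \<odot> x) = of_real (norm (f x))" "n (u \<odot> x) = n x"
proof -
  obtain u where "norm u = 1" "u * f x = of_real (norm (f x))" by (rule unimodular_rotation)
  with that[of u] show ?thesis using f x by (simp add: D_scale n_scale)
qed

text \<open>The unit ball is invariant under unimodular scalars, so the supremum defining the dual
  norm may be taken over real parts. Unlike absolute values, real parts of different functionals can
  be added without loss.\<close>

lemma dn_approx:
  assumes f: "f \<in> D" and e: "e > 0"
  obtains x where "x \<in> C" "n x \<le> 1" "dn f - e < repart (f x)"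
proof -
  have "\<exists>x\<in>{x \<in> C. n x \<le> 1}. dn f - e < norm (f x)"
    unfolding dn_def
    by (subst less_cSUP_iff[symmetric]) (use e D_bdd_above[OF f] in \<open>auto intro: exI[of _ \<zero>]\<close>)
  then obtain x where x: "x \<in> C" "n x \<le> 1" "dn f - e < norm (f x)" by auto
  obtain u where u: "norm u = 1" "f (u \<odot> x) = of_real (norm (f x))" "n (u \<odot> x) = n x"
    by (rule rotate_into_reals[OF f x(1)])
  show ?thesis by (rule that[of "u \<odot> x"]) (use u x in auto)
qed

lemma dual_closed:
  shows D_zeroI: "(\<lambda>x. 0) \<in> D"
    and D_addI: "f \<in> D \<Longrightarrow> g \<in> D \<Longrightarrow> (\<lambda>x. f x + g x) \<in> D"
    and D_scaleI: "f \<in> D \<Longrightarrow> (\<lambda>x. c * f x) \<in> D"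
proof -
  show "(\<lambda>x. 0) \<in> D" by (rule DI[of _ 0]) auto
  show "(\<lambda>x. f x + g x) \<in> D" if f: "f \<in> D" and g: "g \<in> D"
  proof (rule DI)
    fix x assume x: "x \<in> C"
    have "norm (f x + g x) \<le> norm (f x) + norm (g x)" by (rule norm_triangle_ineq)
    also have "\<dots> \<le> (dn f + dn g) * n x"
      using dual_bound[OF f x] dual_bound[OF g x] by (simp add: algebra_simps)
    finally show "norm (f x + g x) \<le> (dn f + dn g) * n x" .
  qed (use f g in \<open>simp_all add: D_add D_scale D_outside algebra_simps\<close>)
  show "(\<lambda>x. c * f x) \<in> D" if f: "f \<in> D"
  proof (rule DI)
    fix x assume x: "x \<in> C"
    show "norm (c * f x) \<le> (norm c * dn f) * n x"
      using dual_bound[OF f x] by (simp add: norm_mult mult_left_mono mult.assoc)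
  qed (use f in \<open>simp_all add: D_add D_scale D_outside algebra_simps\<close>)
qed

lemma D_diffI: "f \<in> D \<Longrightarrow> g \<in> D \<Longrightarrow> (\<lambda>x. f x - g x) \<in> D"
  using D_addI[of f "\<lambda>x. - 1 * g x"] D_scaleI[of g "- 1"] by simp

lemma dn_eq_0_iff:
  assumes f: "f \<in> D" shows "dn f = 0 \<longleftrightarrow> f = (\<lambda>x. 0)"
proof
  assume *: "dn f = 0"
  show "f = (\<lambda>x. 0)"
  proof
    fix x show "f x = 0"
      using dual_bound[OF f, of x] D_outside[OF f, of x] * by (cases "x \<in> C") auto
  qed
next
  assume "f = (\<lambda>x. 0)"
  then have "dn f \<le> 0" by (intro dn_le) simp
  with dn_ge_0[OF f] show "dn f = 0" by simp
qed

lemma dn_add: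
  assumes f: "f \<in> D" and g: "g \<in> D" shows "dn (\<lambda>x. f x + g x) \<le> dn f + dn g"
  by (rule dn_le) (use norm_triangle_mono norm_le_dn[OF f] norm_le_dn[OF g] in blast)

lemma dn_scale:
  assumes f: "f \<in> D" shows "dn (\<lambda>x. c * f x) = norm c * dn f"
proof (rule antisym)
  show le: "dn (\<lambda>x. c * f x) \<le> norm c * dn f" 
    by (rule dn_le) (use norm_le_dn[OF f] in \<open>simp add: norm_mult mult_left_mono\<close>)
  show "norm c * dn f \<le> dn (\<lambda>x. c * f x)"
  proof (cases "c = 0")
    case True
    then show ?thesis using dn_ge_0[OF D_scaleI[OF f, of c]] by simp
  next
    case False
    have "dn f \<le> dn (\<lambda>x. c * f x) / norm c"
    proof (rule dn_le)
      fix x assume "x \<in> C" "n x \<le> 1"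
      then have "norm (c * f x) \<le> dn (\<lambda>x. c * f x)" by (rule norm_le_dn[OF D_scaleI[OF f]])
      then show "norm (f x) \<le> dn (\<lambda>x. c * f x) / norm c"
        using False by (simp add: norm_mult field_simps)
    qed
    then show ?thesis using False by (simp add: field_simps)
  qed
qed

lemma knorm_dual: "knorm (dual V)"
proof
  show "vector_space_axioms_on (dual V)"
    unfolding vector_space_axioms_on_def
  proof (intro conjI ballI allI)
    fix f assume f: "f \<in> vcarrier (dual V)"
    show "\<exists>g\<in>vcarrier (dual V). vadd (dual V) f g = vzero (dual V)"
      by (rule bexI[of _ "\<lambda>x. - 1 * f x"]) (use f in \<open>auto simp: D_scaleI[of f "- 1", simplified]\<close>)
  qed (auto simp: dual_closed algebra_simps)
  show "norm_axioms_on (dual V)"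
    unfolding norm_axioms_on_def using dn_ge_0 dn_eq_0_iff dn_add dn_scale by simp
qed

text \<open>The functional is \<open>u x - j * u (j x)\<close> with \<open>j = imag_unit\<close>;
  for \<open>j = 0\<close> it reduces to \<open>u\<close>. The bound on the modulus follows from the
  bound on \<open>u\<close> by rotating \<open>f x\<close> to a nonnegative real.\<close>

lemma ex_functional_of_real_part:
  assumes u: "real_linear u" and B: "\<And>x. x \<in> C \<Longrightarrow> u x \<le> B * n x" and "B \<ge> 0"
  obtains f where "f \<in> D" "\<And>x. x \<in> C \<Longrightarrow> repart (f x) = u x" "dn f \<le> B"
proof -
  let ?j = "imag_unit :: 'k"
  define f where "f x = (if x \<in> C then of_real (u x) - ?j * of_real (u (?j \<odot> x)) else 0)" for x
  have u_add: "u (x \<oplus> y) = u x + u y" if "x \<in> C" "y \<in> C" for x y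
    using u that unfolding real_linear_def by blast
  have u_scale: "u (of_real r \<odot> x) = r * u x" if "x \<in> C" for x r
    using u that unfolding real_linear_def by blast
  have u_zero: "u \<zero> = 0" using u_scale[of \<zero> 0] by simp
  have f_add: "f (x \<oplus> y) = f x + f y" if "x \<in> C" "y \<in> C" for x y
    using that by (simp add: f_def u_add scale_add algebra_simps)
  have f_real: "f (of_real r \<odot> x) = of_real r * f x" if x: "x \<in> C" for x r
  proof -
    have "?j \<odot> of_real r \<odot> x = of_real r \<odot> ?j \<odot> x" using x by (simp add: scale_scale mult.commute)
    then show ?thesis using x by (simp add: f_def u_scale algebra_simps)
  qed
  have f_imag: "f (?j \<odot> x) = ?j * f x" if x: "x \<in> C" for x
    using imag_unit_cases[where ?'k = 'k]
  proof
    assume "?j = 0"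
    then show ?thesis using x by (simp add: f_def u_zero)
  next
    assume jj: "?j * ?j = - 1"
    have "u (- 1 \<odot> x) = - u x" using u_scale[OF x, of "- 1"] by simp
    moreover have "?j * (?j * c) = - c" for c
      using jj by (metis mult.assoc mult_minus1)
    ultimately show ?thesis using x jj by (simp add: f_def scale_scale right_diff_distrib)
  qed
  have f_scale: "f (c \<odot> x) = c * f x" if x: "x \<in> C" for c x
  proof -
    have c: "c = of_real (repart c) + of_real (- repart (?j * c)) * ?j"
      using scalar_decomp[of c] by (simp add: algebra_simps)
    have "c \<odot> x = of_real (repart c) \<odot> x \<oplus> of_real (- repart (?j * c)) \<odot> ?j \<odot> x"
      by (subst c) (simp only: add_scale[OF x] scale_scale[OF x])
    then have "f (c \<odot> x) = of_real (repart c) * f x + of_real (- repart (?j * c)) * (?j * f x)"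
      using f_add[of "of_real (repart c) \<odot> x" "of_real (- repart (?j * c)) \<odot> ?j \<odot> x"]
        f_real[of "?j \<odot> x" "- repart (?j * c)"] f_real[OF x] f_imag[OF x] x by simp
    also have "\<dots> = (of_real (repart c) + of_real (- repart (?j * c)) * ?j) * f x"
      by (simp add: algebra_simps)
    also have "\<dots> = c * f x" by (simp only: c[symmetric])
    finally show ?thesis .
  qed
  have f_re: "repart (f x) = u x" if x: "x \<in> C" for x
  proof -
    \<comment> \<open>This says that \<open>j\<close> has real part 0. Decomposing a real scalar
      \<open>r\<close> and taking real parts gives
      \<open>r * repart j * repart j = 0\<close>.\<close>
    have "repart (?j * of_real r) = 0" for r
    proof -
      have "r = repart (of_real (repart (of_real r)) - ?j * of_real (repart (?j * of_real r)))"
        using scalar_decomp[of "of_real r :: 'k"] by (metis repart_of_real)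
      then have "repart (?j * of_real (repart (?j * of_real r))) = 0"
        by (simp add: repart_diff)
      then have "repart (?j * of_real r) * repart ?j = 0"
        by (metis mult.commute repart_of_real_mult)
      moreover have "repart (?j * of_real r) = r * repart ?j"
        by (metis mult.commute repart_of_real_mult)
      ultimately show ?thesis by auto
    qed
    then show ?thesis using x by (simp add: f_def repart_diff)
  qed
  have bound: "norm (f x) \<le> B * n x" if x: "x \<in> C" for x
  proof -
    obtain w where w: "norm w = 1" "w * f x = of_real (norm (f x))" by (rule unimodular_rotation)
    have "norm (f x) = repart (f (w \<odot> x))" using w f_scale[OF x] by simp
    also have "\<dots> = u (w \<odot> x)" using x by (simp add: f_re)
    also have "\<dots> \<le> B * n x" using B[of "w \<odot> x"] x w by (simp add: n_scale)
    finally show ?thesis .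
  qed
  have f: "f \<in> D"
    by (rule DI[of _ B]) (use f_add f_scale bound in \<open>auto simp: f_def\<close>)
  moreover have "dn f \<le> B"
  proof (rule dn_le)
    fix x assume x: "x \<in> C" "n x \<le> 1"
    then have "B * n x \<le> B" using \<open>B \<ge> 0\<close> by (simp add: mult_left_le)
    with bound[OF x(1)] show "norm (f x) \<le> B" by simp
  qed
  ultimately show ?thesis using that f_re by blast
qed

end

section \<open>M-ideals and the 3-ball property\<close>

text \<open>The point \<open>- z\<close> lies in \<open>Y\<close> and in the balls of radius
  \<open>1 + e\<close> about the three centres \<open>x + y\<close>. The unit balls about these
  centres share the point \<open>x\<close> because the \<open>y\<close> are in the unit ball, and
  each meets \<open>Y\<close> in its \<open>y\<close> because \<open>x\<close> is: these are the
  hypotheses on the balls in the usual intersection property.\<close>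

definition three_ball :: "('k::real_or_complex, 'v) nvs \<Rightarrow> 'v set \<Rightarrow> bool" where
  "three_ball V Y \<longleftrightarrow>
     (\<forall>x\<in>vcarrier V. \<forall>y1\<in>Y. \<forall>y2\<in>Y. \<forall>y3\<in>Y. \<forall>e>0.
        vnorm V x \<le> 1 \<longrightarrow> vnorm V y1 \<le> 1 \<longrightarrow> vnorm V y2 \<le> 1 \<longrightarrow> vnorm V y3 \<le> 1 \<longrightarrow>
        (\<exists>z\<in>Y. \<forall>y\<in>{y1, y2, y3}. vnorm V (vadd V (vadd V x y) z) \<le> 1 + e))"

definition cube :: "('k::real_or_complex, 'v) nvs \<Rightarrow> ('k, 'v \<times> 'v \<times> 'v) nvs" where
  "cube V = \<lparr>vcarrier = vcarrier V \<times> vcarrier V \<times> vcarrier V,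
     vadd = (\<lambda>(x, y, z) (x', y', z'). (vadd V x x', vadd V y y', vadd V z z')),
     vzero = (vzero V, vzero V, vzero V),
     vscale = (\<lambda>c (x, y, z). (vscale V c x, vscale V c y, vscale V c z)),
     vnorm = (\<lambda>(x, y, z). max (vnorm V x) (max (vnorm V y) (vnorm V z)))\<rparr>"

lemma (in kspace) kspace_cube: "kspace (cube V)"
proof
  show "vector_space_axioms_on (cube V)"
    unfolding vector_space_axioms_on_def
  proof (intro conjI)
    show "\<forall>x\<in>vcarrier (cube V). \<exists>y\<in>vcarrier (cube V). vadd (cube V) x y = vzero (cube V)"
      using ex_neg unfolding cube_def by fastforce
  qed (auto simp: cube_def add_assoc scale_add add_scale scale_scale intro: add_commute)
qed

context knorm
begin

context
  fixes Y
  assumes Y: "closed_subspace V Y"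
begin

lemma
  shows Y_sub: "y \<in> Y \<Longrightarrow> y \<in> C"
    and Y_zero: "\<zero> \<in> Y"
    and Y_add: "y \<in> Y \<Longrightarrow> y' \<in> Y \<Longrightarrow> y \<oplus> y' \<in> Y"
    and Y_scale: "y \<in> Y \<Longrightarrow> c \<odot> y \<in> Y"
    and Y_closed: "x \<in> C \<Longrightarrow> (\<And>e. e > 0 \<Longrightarrow> \<exists>y\<in>Y. n (x \<oplus> neg y) < e) \<Longrightarrow> x \<in> Y"
  using Y unfolding closed_subspace_def closedin_iff by auto

text \<open>
  The lower bound \<open>c\<close> at \<open>a\<close> serves both the norm-preserving extension (\<open>a = c = 0\<close>) and the
  separation of a point from \<open>Y\<close> (\<open>f = 0\<close>).
\<close>

lemma hahn_banach_extension:
  assumes f: "f \<in> D" and B: "B \<ge> 0" and fB: "\<And>y. y \<in> Y \<Longrightarrow> norm (f y) \<le> B * n y"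
    and a: "a \<in> C" and c: "\<And>y. y \<in> Y \<Longrightarrow> c \<le> B * n (a \<oplus> neg y) + repart (f y)"
  obtains g where "g \<in> D" "dn g \<le> B" "\<forall>y\<in>Y. g y = f y" "c \<le> repart (g a)"
proof -
  note [simp] = Y_sub
  \<comment> \<open>The inf-convolution of \<open>B * n\<close> with the real part of
    \<open>f\<close> on \<open>Y\<close>. A functional below it is below \<open>B * n\<close> (take
    \<open>y = 0\<close>) and below \<open>repart (f y)\<close> on \<open>Y\<close> (take
    \<open>x = y\<close>); the latter is an equality by linearity.\<close>
  define p where "p x = (INF y\<in>Y. B * n (x \<oplus> neg y) + repart (f y))" for x
  have rf: "repart (f (neg y)) = - repart (f y)" if "y \<in> Y" for y
    using that f by (simp add: D_neg repart_minus)
  have bdd: "bdd_below ((\<lambda>y. B * n (x \<oplus> neg y) + repart (f y)) ` Y)" if x: "x \<in> C" for x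
  proof (rule bdd_belowI2)
    fix y assume y: "y \<in> Y"
    have "n y \<le> n x + n (x \<oplus> neg y)"
      using n_le_add_diff[of y x] n_diff_commute[of x y] x y by simp
    then have "B * n y \<le> B * n x + B * n (x \<oplus> neg y)"
      using B by (metis distrib_left mult_left_mono)
    moreover have "- repart (f y) \<le> B * n y"
      using fB[OF Y_scale[OF y, of "- 1"]] repart_le_norm[of "f (neg y)"] rf[OF y] y by simp
    ultimately show "- (B * n x) \<le> B * n (x \<oplus> neg y) + repart (f y)" by simp
  qed
  have le: "p x \<le> B * n (x \<oplus> neg y) + repart (f y)" if "x \<in> C" "y \<in> Y" for x y
    unfolding p_def by (rule cINF_lower[OF bdd]) (use that in auto)
  have ge: "b \<le> p x" if "\<And>y. y \<in> Y \<Longrightarrow> b \<le> B * n (x \<oplus> neg y) + repart (f y)" for b x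
    unfolding p_def by (rule cINF_greatest) (use that Y_zero in auto)
  have "sublinear p"
    unfolding sublinear_def
  proof (intro conjI ballI allI impI)
    fix x x' assume x: "x \<in> C" and x': "x' \<in> C"
    have "p (x \<oplus> x') - p x \<le> p x'"
    proof (rule ge)
      fix y' assume y': "y' \<in> Y"
      have "p (x \<oplus> x') - (B * n (x' \<oplus> neg y') + repart (f y')) \<le> p x"
      proof (rule ge)
        fix y assume y: "y \<in> Y"
        have "x \<oplus> x' \<oplus> neg (y \<oplus> y') = x \<oplus> neg y \<oplus> (x' \<oplus> neg y')"
          using x x' y y' by (simp add: scale_add add_add_swap)
        then have "n (x \<oplus> x' \<oplus> neg (y \<oplus> y')) \<le> n (x \<oplus> neg y) + n (x' \<oplus> neg y')"
          using n_add[of "x \<oplus> neg y" "x' \<oplus> neg y'"] x x' y y' by simp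
        then have "B * n (x \<oplus> x' \<oplus> neg (y \<oplus> y')) \<le> B * n (x \<oplus> neg y) + B * n (x' \<oplus> neg y')"
          using B by (metis distrib_left mult_left_mono)
        moreover have "p (x \<oplus> x') \<le> B * n (x \<oplus> x' \<oplus> neg (y \<oplus> y')) + repart (f (y \<oplus> y'))"
          by (rule le) (use x x' y y' Y_add in auto)
        ultimately show "p (x \<oplus> x') - (B * n (x' \<oplus> neg y') + repart (f y'))
            \<le> B * n (x \<oplus> neg y) + repart (f y)"
          using f y y' by (simp add: D_add repart_add)
      qed
      then show "p (x \<oplus> x') - p x \<le> B * n (x' \<oplus> neg y') + repart (f y')" by simp
    qed
    then show "p (x \<oplus> x') \<le> p x + p x'" by simp
  next
    fix r :: real and x assume r: "r > 0" and x: "x \<in> C"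
    have "p (of_real r \<odot> x) / r \<le> p x"
    proof (rule ge)
      fix y assume y: "y \<in> Y"
      have "of_real r \<odot> x \<oplus> neg (of_real r \<odot> y) = of_real r \<odot> (x \<oplus> neg y)"
        using x y by (simp add: scale_add scale_scale)
      then have "p (of_real r \<odot> x) \<le> B * (r * n (x \<oplus> neg y)) + r * repart (f y)"
        using le[of "of_real r \<odot> x" "of_real r \<odot> y"] x y r f Y_scale
        by (simp add: n_scale D_scale)
      then show "p (of_real r \<odot> x) / r \<le> B * n (x \<oplus> neg y) + repart (f y)"
        using r by (simp add: field_simps)
    qed
    then show "p (of_real r \<odot> x) \<le> r * p x" using r by (simp add: field_simps)
  qed
  then obtain u where u: "real_linear u" and up: "\<And>x. x \<in> C \<Longrightarrow> u x \<le> p x" and ua: "u a = p a"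
    using hahn_banach[OF _ a] by blast
  have uB: "u x \<le> B * n x" if x: "x \<in> C" for x
    using up[OF x] le[OF x Y_zero] x f by (simp add: D_zero)
  have uY_le: "u y \<le> repart (f y)" if y: "y \<in> Y" for y
    using up[of y] le[of y y] y by simp
  have uY: "u y = repart (f y)" if y: "y \<in> Y" for y
  proof -
    have "u (of_real (- 1) \<odot> y) = (- 1) * u y"
      using u y Y_sub unfolding real_linear_def by blast
    then have "u (neg y) = - u y" by simp
    then show ?thesis using uY_le[OF y] uY_le[OF Y_scale[OF y, of "- 1"]] rf[OF y] by simp
  qed
  obtain g where g: "g \<in> D" "\<And>x. x \<in> C \<Longrightarrow> repart (g x) = u x" "dn g \<le> B"
    using ex_functional_of_real_part[OF u uB B] by blast
  have "g y = f y" if y: "y \<in> Y" for y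
  proof -
    \<comment> \<open>As \<open>Y\<close> is a subspace over the whole field, the real parts agree
      on all multiples of \<open>y\<close>; the factors 1 and \<open>imag_unit\<close> then
      determine the scalar.\<close>
    have "repart (g (c \<odot> y)) = repart (f (c \<odot> y))" for c
      using g(2)[of "c \<odot> y"] uY[OF Y_scale[OF y, of c]] y by simp
    then have "repart (c * g y) = repart (c * f y)" for c
      using y g(1) f by (simp add: D_scale)
    from this[of 1] this[of imag_unit] show ?thesis
      using scalar_decomp[of "g y"] scalar_decomp[of "f y"] by simp
  qed
  moreover have "c \<le> repart (g a)" using ge[OF c] ua g(2)[OF a] by simp
  ultimately show ?thesis using that[OF g(1) g(3)] by blast
qed

lemma annihilator_separates:
  assumes x: "x \<in> C" and "\<And>f. f \<in> annihilator V Y \<Longrightarrow> f x = 0"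
  shows "x \<in> Y"
proof (rule ccontr)
  assume "x \<notin> Y"
  then obtain e where e: "e > 0" "\<And>y. y \<in> Y \<Longrightarrow> e \<le> n (x \<oplus> neg y)"
    using Y_closed[OF x] by (meson not_less)
  obtain g where g: "g \<in> D" "\<forall>y\<in>Y. g y = 0" "e \<le> repart (g x)"
    by (rule hahn_banach_extension[OF D_zeroI _ _ x, of 1 e]) (use e Y_sub in auto)
  then have "g \<in> annihilator V Y" by (simp add: annihilator_def)
  with assms(2) have "g x = 0" by blast
  with g e show False by simp
qed

section \<open>Functionals normed by the subspace\<close>

lemma annihilatorD: "f \<in> annihilator V Y \<Longrightarrow> f \<in> D" "f \<in> annihilator V Y \<Longrightarrow> y \<in> Y \<Longrightarrow> f y = 0"
  by (simp_all add: annihilator_def)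

lemma annihilatorI: "f \<in> D \<Longrightarrow> (\<And>y. y \<in> Y \<Longrightarrow> f y = 0) \<Longrightarrow> f \<in> annihilator V Y"
  by (simp add: annihilator_def)

text \<open>This will be the complement of the annihilator if \<open>Y\<close> has the 3-ball property.\<close>

definition normed_by_Y :: "('v \<Rightarrow> 'k) set" where
  "normed_by_Y = {f \<in> D. \<forall>e>0. \<exists>y\<in>Y. n y \<le> 1 \<and> dn f - e < repart (f y)}"

lemma normed_by_YD:
  assumes "f \<in> normed_by_Y" "e > 0"
  obtains y where "y \<in> Y" "n y \<le> 1" "dn f - e < repart (f y)"
  using assms unfolding normed_by_Y_def by blast

lemma normed_by_Y_D: "f \<in> normed_by_Y \<Longrightarrow> f \<in> D"
  by (simp add: normed_by_Y_def)

text \<open>The norm of the restriction to \<open>Y\<close> is approached inside \<open>Y\<close>.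
  An extension of the same norm is therefore normed by \<open>Y\<close>, and it differs from
  \<open>f\<close> by an element of the annihilator.\<close>

lemma norm_preserving_extension:
  assumes f: "f \<in> D"
  obtains g where "g \<in> normed_by_Y" "\<forall>y\<in>Y. g y = f y"
proof -
  define B where "B = (SUP y\<in>{y \<in> Y. n y \<le> 1}. norm (f y))"
  have bdd: "bdd_above ((\<lambda>y. norm (f y)) ` {y \<in> Y. n y \<le> 1})"
    by (rule bdd_above_mono[OF D_bdd_above[OF f]]) (use Y_sub in auto)
  have up: "norm (f y) \<le> B" if "y \<in> Y" "n y \<le> 1" for y
    unfolding B_def by (rule cSUP_upper[OF _ bdd]) (use that in auto)
  have B: "B \<ge> 0" using up[OF Y_zero] f by (simp add: D_zero)
  have fB: "norm (f y) \<le> B * n y" if y: "y \<in> Y" for y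
  proof (cases "y = \<zero>")
    case True
    then show ?thesis using f by (simp add: D_zero)
  next
    case False
    obtain y' where y': "y' = of_real (1 / n y) \<odot> y" "n y' = 1" "y = of_real (n y) \<odot> y'" "n y > 0"
      by (rule normalize[OF Y_sub[OF y] False])
    have y'Y: "y' \<in> Y" using y'(1) Y_scale[OF y] by simp
    have "norm (f y) = norm (f (of_real (n y) \<odot> y'))" using y'(3) by simp
    also have "\<dots> = n y * norm (f y')"
      using D_scale[OF f Y_sub[OF y'Y], of "of_real (n y)"] y'(4) by (simp add: norm_mult)
    finally have "norm (f y) = n y * norm (f y')" .
    also have "\<dots> \<le> n y * B" using up[OF y'Y] y' by (simp add: mult_left_mono)
    finally show ?thesis by (simp add: mult.commute)
  qed
  have c: "0 \<le> B * n (\<zero> \<oplus> neg y) + repart (f y)" if y: "y \<in> Y" for y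
    using fB[OF Y_scale[OF y, of "- 1"]] repart_le_norm[of "f (neg y)"] y f
    by (simp add: D_neg repart_minus Y_sub)
  obtain g where g: "g \<in> D" "dn g \<le> B" "\<forall>y\<in>Y. g y = f y"
    by (rule hahn_banach_extension[OF f B fB zero_closed c])
  have "g \<in> normed_by_Y"
    unfolding normed_by_Y_def
  proof (intro CollectI conjI allI impI)
    fix e :: real assume e: "e > 0"
    have "\<exists>y\<in>{y \<in> Y. n y \<le> 1}. B - e < norm (f y)"
      unfolding B_def
      by (subst less_cSUP_iff[symmetric]) (use e bdd Y_zero in \<open>auto intro: exI[of _ \<zero>]\<close>)
    then obtain y where y: "y \<in> Y" "n y \<le> 1" "B - e < norm (f y)" by blast
    obtain u where u: "norm u = 1" "f (u \<odot> y) = of_real (norm (f y))" "n (u \<odot> y) = n y"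
      by (rule rotate_into_reals[OF f Y_sub[OF y(1)]])
    have "u \<odot> y \<in> Y" by (rule Y_scale[OF y(1)])
    moreover from this have "dn g - e < repart (g (u \<odot> y))" using g u y by simp
    ultimately show "\<exists>y\<in>Y. n y \<le> 1 \<and> dn g - e < repart (g y)" using u y by metis
  qed (rule g)
  with g that show ?thesis by blast
qed

lemma normed_by_Y_scale:
  assumes b: "b \<in> normed_by_Y" shows "(\<lambda>x. c * b x) \<in> normed_by_Y"
  unfolding normed_by_Y_def
proof (intro CollectI conjI allI impI)
  have bD: "b \<in> D" by (rule normed_by_Y_D[OF b])
  show "(\<lambda>x. c * b x) \<in> D" by (rule D_scaleI[OF bD])
  fix e :: real assume e: "e > 0"
  obtain u where u: "norm u = 1" "u * c = of_real (norm c)" by (rule unimodular_rotation)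
  obtain y where y: "y \<in> Y" "n y \<le> 1" "dn b - e / (norm c + 1) < repart (b y)"
    by (rule normed_by_YD[OF b, of "e / (norm c + 1)"]) (use e in \<open>auto simp: add_nonneg_pos\<close>)
  have "c * b (u \<odot> y) = of_real (norm c) * b y"
    using D_scale[OF bD Y_sub[OF y(1)]] u by (simp add: mult.assoc[symmetric] mult.commute)
  then have re: "repart (c * b (u \<odot> y)) = norm c * repart (b y)" by simp
  have "norm c * dn b \<le> norm c * (repart (b y) + e / (norm c + 1))"
    by (rule mult_left_mono) (use y in auto)
  moreover have "norm c * (e / (norm c + 1)) < e"
  proof -
    have "norm c + 1 > 0" by (simp add: add_nonneg_pos)
    then have "norm c / (norm c + 1) < 1" by simp
    from mult_strict_left_mono[OF this e] show ?thesis by (simp add: mult.commute)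
  qed
  ultimately have "dn (\<lambda>x. c * b x) - e < repart (c * b (u \<odot> y))"
    unfolding re dn_scale[OF bD] by (simp add: distrib_left)
  moreover have "n (u \<odot> y) \<le> 1" using y u by (simp add: n_scale Y_sub)
  ultimately show "\<exists>y\<in>Y. n y \<le> 1 \<and> dn (\<lambda>x. c * b x) - e < repart (c * b y)"
    using Y_scale[OF y(1)] by blast
qed

lemma normed_by_Y_closed:
  assumes f: "f \<in> D" and lim: "\<And>e. e > 0 \<Longrightarrow> \<exists>g\<in>normed_by_Y. dn (\<lambda>x. f x - g x) < e"
  shows "f \<in> normed_by_Y"
  unfolding normed_by_Y_def
proof (intro CollectI conjI allI impI)
  fix e :: real assume e: "e > 0"
  obtain g where g: "g \<in> normed_by_Y" "dn (\<lambda>x. f x - g x) < e / 3" using lim[of "e / 3"] e by auto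
  have gD: "g \<in> D" by (rule normed_by_Y_D[OF g(1)])
  obtain y where y: "y \<in> Y" "n y \<le> 1" "dn g - e / 3 < repart (g y)"
    by (rule normed_by_YD[OF g(1), of "e / 3"]) (use e in auto)
  have "dn f \<le> dn g + dn (\<lambda>x. f x - g x)"
    using dn_add[OF gD D_diffI[OF f gD]] by simp
  moreover have "norm (f y - g y) \<le> dn (\<lambda>x. f x - g x)"
    by (rule norm_le_dn[OF D_diffI[OF f gD]]) (use y Y_sub in auto)
  moreover have "repart (g y) - repart (f y) \<le> norm (f y - g y)"
    by (metis norm_minus_commute repart_diff repart_le_norm)
  ultimately have "dn f - e < repart (f y)" using g(2) y(3) by simp
  with y show "\<exists>y\<in>Y. n y \<le> 1 \<and> dn f - e < repart (f y)" by blast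
qed (rule f)

lemma annihilator_Int_normed_by_Y:
  assumes "f \<in> annihilator V Y" "f \<in> normed_by_Y"
  shows "f = (\<lambda>x. 0)"
proof -
  have f: "f \<in> D" by (rule annihilatorD(1)[OF assms(1)])
  have "dn f \<le> 0"
  proof (rule field_le_epsilon)
    fix e :: real assume "e > 0"
    then obtain y where "y \<in> Y" "dn f - e < repart (f y)" by (rule normed_by_YD[OF assms(2)])
    then show "dn f \<le> 0 + e" using annihilatorD(2)[OF assms(1)] by simp
  qed
  with dn_ge_0[OF f] dn_eq_0_iff[OF f] show ?thesis by simp
qed

context
  assumes ball: "three_ball V Y"
begin

lemma three_ballE:
  assumes "x \<in> C" "y1 \<in> Y" "y2 \<in> Y" "y3 \<in> Y" "n x \<le> 1" "n y1 \<le> 1" "n y2 \<le> 1" "n y3 \<le> 1" "e > 0"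
  obtains z where "z \<in> Y" "n (x \<oplus> y1 \<oplus> z) \<le> 1 + e" "n (x \<oplus> y2 \<oplus> z) \<le> 1 + e"
    "n (x \<oplus> y3 \<oplus> z) \<le> 1 + e"
proof -
  have "\<exists>z\<in>Y. \<forall>y\<in>{y1, y2, y3}. n (x \<oplus> y \<oplus> z) \<le> 1 + e"
    using ball[unfolded three_ball_def, rule_format, OF assms(1-4,9,5-8)] .
  then show ?thesis using that by auto
qed

text \<open>Let \<open>x\<close> nearly norm \<open>a\<close> and \<open>y \<in> Y\<close> nearly
  norm \<open>b\<close>. The ball property moves \<open>x\<close> by some \<open>z \<in> Y\<close>
  so that \<open>x + y + z\<close> and \<open>x - y + z\<close> are almost in the unit ball. The
  second point bounds the possible loss \<open>- b (x + z)\<close>. Since \<open>a\<close> sees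
  neither \<open>y\<close> nor \<open>z\<close>, the sum \<open>a + b\<close> nearly reaches
  \<open>dn a + dn b\<close> at the first point.\<close>

lemma dn_add_of_three_ball:
  assumes a: "a \<in> annihilator V Y" and b: "b \<in> normed_by_Y"
  shows "dn (\<lambda>x. a x + b x) = dn a + dn b"
proof (rule antisym)
  have aD: "a \<in> D" and bD: "b \<in> D" using annihilatorD(1)[OF a] normed_by_Y_D[OF b] by auto
  have abD: "(\<lambda>x. a x + b x) \<in> D" by (rule D_addI[OF aD bD])
  show "dn (\<lambda>x. a x + b x) \<le> dn a + dn b" by (rule dn_add[OF aD bD])
  show "dn a + dn b \<le> dn (\<lambda>x. a x + b x)"
  proof (rule le_if_le_add_eps_mult)
    fix e :: real assume e: "e > 0"
    obtain x where x: "x \<in> C" "n x \<le> 1" "dn a - e < repart (a x)" by (rule dn_approx[OF aD e])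
    obtain y where y: "y \<in> Y" "n y \<le> 1" "dn b - e < repart (b y)" by (rule normed_by_YD[OF b e])
    have yC: "y \<in> C" by (rule Y_sub[OF y(1)])
    \<comment> \<open>Only the two centres given by \<open>y\<close> and \<open>neg y\<close>
      matter; the third slot repeats \<open>y\<close>.\<close>
    obtain z where z: "z \<in> Y" "n (x \<oplus> y \<oplus> z) \<le> 1 + e" "n (x \<oplus> neg y \<oplus> z) \<le> 1 + e"
      by (rule three_ballE[OF x(1) y(1) Y_scale[OF y(1)] y(1) x(2) y(2) _ y(2) e, of "- 1"])
        (use y yC in auto)
    have zC: "z \<in> C" by (rule Y_sub[OF z(1)])
    have "repart (- b (x \<oplus> neg y \<oplus> z)) \<le> norm (b (x \<oplus> neg y \<oplus> z))"
      using repart_le_norm[of "- b (x \<oplus> neg y \<oplus> z)"] by simp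
    also have "\<dots> \<le> dn b * n (x \<oplus> neg y \<oplus> z)" by (rule dual_bound[OF bD]) (use x yC zC in auto)
    also have "\<dots> \<le> dn b * (1 + e)" by (rule mult_left_mono[OF z(3) dn_ge_0[OF bD]])
    finally have 1: "repart (b y) - repart (b x) - repart (b z) \<le> dn b * (1 + e)"
      using bD x yC zC by (simp add: D_add D_neg repart_add repart_diff repart_minus)
    have "repart (a (x \<oplus> y \<oplus> z) + b (x \<oplus> y \<oplus> z)) \<le> dn (\<lambda>x. a x + b x) * n (x \<oplus> y \<oplus> z)"
      by (rule repart_bound[OF abD]) (use x yC zC in auto)
    also have "\<dots> \<le> dn (\<lambda>x. a x + b x) * (1 + e)" by (rule mult_left_mono[OF z(2) dn_ge_0[OF abD]])
    finally have 2: "repart (a x) + repart (b x) + repart (b y) + repart (b z) \<le> dn (\<lambda>x. a x + b x) * (1 + e)"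
      using aD bD x yC zC annihilatorD(2)[OF a y(1)] annihilatorD(2)[OF a z(1)]
      by (simp add: D_add repart_add)
    show "dn a + dn b \<le> dn (\<lambda>x. a x + b x) + e * (dn (\<lambda>x. a x + b x) + dn b + 3)"
      using 1 2 x(3) y(3) by (simp add: algebra_simps)
  qed (use dn_ge_0[OF abD] dn_ge_0[OF bD] in simp)
qed

text \<open>
  The three balls are used here: if three functionals normed by \<open>Y\<close> have a sum \<open>v\<close> that
  vanishes on \<open>Y\<close>, then the common centre found by the ball property shows \<open>repart (v x) \<le> 0\<close>.
\<close>

lemma normed_by_Y_add:
  assumes b1: "b1 \<in> normed_by_Y" and b2: "b2 \<in> normed_by_Y"
  shows "(\<lambda>x. b1 x + b2 x) \<in> normed_by_Y"
proof -
  have D1: "b1 \<in> D" and D2: "b2 \<in> D" using normed_by_Y_D b1 b2 by auto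
  \<comment> \<open>The candidate for the sum: a functional normed by \<open>Y\<close> that agrees
    with it on \<open>Y\<close>. With \<open>b3 = - g\<close> the claim becomes
    \<open>v = 0\<close>, where \<open>v\<close> is known to vanish on \<open>Y\<close>.\<close>
  obtain g where g: "g \<in> normed_by_Y" and gY: "\<forall>y\<in>Y. g y = b1 y + b2 y"
    by (rule norm_preserving_extension[OF D_addI[OF D1 D2]])
  define b3 where "b3 = (\<lambda>x. - 1 * g x)"
  have b3: "b3 \<in> normed_by_Y" unfolding b3_def by (rule normed_by_Y_scale[OF g])
  have D3: "b3 \<in> D" by (rule normed_by_Y_D[OF b3])
  define v where "v = (\<lambda>x. b1 x + b2 x + b3 x)"
  have vD: "v \<in> D" unfolding v_def by (intro D_addI D1 D2 D3)
  have vY: "v y = 0" if "y \<in> Y" for y using gY that by (simp add: v_def b3_def)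
  have neg: "repart (v x) \<le> 0" if x: "x \<in> C" "n x \<le> 1" for x
  proof (rule le_if_le_add_eps_mult)
    fix e :: real assume e: "e > 0"
    obtain y1 where y1: "y1 \<in> Y" "n y1 \<le> 1" "dn b1 - e < repart (b1 y1)" by (rule normed_by_YD[OF b1 e])
    obtain y2 where y2: "y2 \<in> Y" "n y2 \<le> 1" "dn b2 - e < repart (b2 y2)" by (rule normed_by_YD[OF b2 e])
    obtain y3 where y3: "y3 \<in> Y" "n y3 \<le> 1" "dn b3 - e < repart (b3 y3)" by (rule normed_by_YD[OF b3 e])
    obtain z where z: "z \<in> Y" "n (x \<oplus> y1 \<oplus> z) \<le> 1 + e" "n (x \<oplus> y2 \<oplus> z) \<le> 1 + e"
      "n (x \<oplus> y3 \<oplus> z) \<le> 1 + e"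
      by (rule three_ballE[OF x(1) y1(1) y2(1) y3(1) x(2) y1(2) y2(2) y3(2) e])
    \<comment> \<open>Almost all of the norm of \<open>b\<close> is spent on \<open>y\<close>, so
      little is left for \<open>x + z\<close>. Summed over the three functionals, the contribution
      of \<open>z\<close> disappears because \<open>v z = 0\<close>.\<close>
    have key: "repart (b x) + repart (b z) \<le> e + e * dn b"
      if b: "b \<in> D" and y: "y \<in> Y" "dn b - e < repart (b y)" "n (x \<oplus> y \<oplus> z) \<le> 1 + e" for b y
    proof -
      have "repart (b (x \<oplus> y \<oplus> z)) \<le> dn b * n (x \<oplus> y \<oplus> z)"
        by (rule repart_bound[OF b]) (use x y z Y_sub in auto)
      also have "\<dots> \<le> dn b * (1 + e)" by (rule mult_left_mono[OF y(3) dn_ge_0[OF b]])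
      finally show ?thesis
        using b y x z Y_sub by (simp add: D_add repart_add algebra_simps)
    qed
    have "repart (v x) + repart (v z) \<le> 3 * e + e * dn b1 + e * dn b2 + e * dn b3"
      using key[OF D1 y1(1,3) z(2)] key[OF D2 y2(1,3) z(3)] key[OF D3 y3(1,3) z(4)]
      by (simp add: v_def repart_add)
    then show "repart (v x) \<le> 0 + e * (3 + dn b1 + dn b2 + dn b3)"
      using vY[OF z(1)] by (simp add: algebra_simps)
  qed (use dn_ge_0[OF D1] dn_ge_0[OF D2] dn_ge_0[OF D3] in simp)
  have "dn v \<le> 0"
  proof (rule field_le_epsilon)
    fix e :: real assume "e > 0"
    then obtain x where "x \<in> C" "n x \<le> 1" "dn v - e < repart (v x)" by (rule dn_approx[OF vD])
    with neg[of x] show "dn v \<le> 0 + e" by simp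
  qed
  then have "v = (\<lambda>x. 0)" using dn_ge_0[OF vD] dn_eq_0_iff[OF vD] by simp
  then have "b1 x + b2 x = g x" for x by (simp add: v_def b3_def fun_eq_iff)
  then show ?thesis using g by simp
qed

lemma M_ideal_of_three_ball: "M_ideal V Y"
  unfolding M_ideal_def
proof (intro conjI exI[of _ normed_by_Y])
  interpret W: knorm "dual V" by (rule knorm_dual)
  have zero: "(\<lambda>x. 0) \<in> normed_by_Y"
    using D_zeroI Y_zero dn_eq_0_iff[OF D_zeroI] by (auto simp: normed_by_Y_def intro!: bexI[of _ \<zero>])
  have "closed_subspace (dual V) normed_by_Y"
    unfolding closed_subspace_def W.closedin_iff
    using normed_by_Y_D zero normed_by_Y_add normed_by_Y_scale normed_by_Y_closed by auto
  moreover have "annihilator V Y \<inter> normed_by_Y = {\<lambda>x. 0}"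
    using annihilator_Int_normed_by_Y zero D_zeroI by (auto intro: annihilatorI)
  moreover have "\<exists>a\<in>annihilator V Y. \<exists>b\<in>normed_by_Y. f = (\<lambda>x. a x + b x)" if f: "f \<in> D" for f
  proof -
    obtain g where g: "g \<in> normed_by_Y" "\<forall>y\<in>Y. g y = f y"
      by (rule norm_preserving_extension[OF f])
    have "(\<lambda>x. f x - g x) \<in> annihilator V Y"
      by (rule annihilatorI) (use D_diffI[OF f normed_by_Y_D] g in auto)
    then show ?thesis using g(1) by (intro bexI) auto
  qed
  ultimately show "closed_complement (dual V) (annihilator V Y) normed_by_Y"
    unfolding closed_complement_def by simp
  show "\<forall>z1\<in>annihilator V Y. \<forall>z2\<in>normed_by_Y.
      vnorm (dual V) (vadd (dual V) z1 z2) = vnorm (dual V) z1 + vnorm (dual V) z2"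
    using dn_add_of_three_ball by simp
qed (rule Y)

end

section \<open>From M-ideals to the 3-ball property\<close>

lemma functional_vanishes:
  assumes f: "f \<in> D" and le: "\<And>y. y \<in> Y \<Longrightarrow> repart (f y) \<le> 0" and y: "y \<in> Y"
  shows "f y = 0"
proof -
  obtain u where "f (u \<odot> y) = of_real (norm (f y))" by (rule rotate_into_reals[OF f Y_sub[OF y]])
  with le[OF Y_scale[OF y, of u]] show ?thesis by simp
qed

text \<open>
  The distance of \<open>(x + y\<^sub>1, x + y\<^sub>2, x + y\<^sub>3)\<close> from the diagonal of \<open>Y\<^sup>3\<close> is given by three functionals
  with sum in the annihilator; the complementary parts of the three then cancel.
\<close>

lemma three_ball_of_M_ideal:
  assumes "M_ideal V Y"
  shows "three_ball V Y"
  unfolding three_ball_def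
proof (intro ballI allI impI)
  interpret W: kspace "cube V" by (rule kspace_cube)
  note [simp] = Y_sub
  obtain Z where "closed_complement (dual V) (annihilator V Y) Z"
    and Zn: "\<And>a b. a \<in> annihilator V Y \<Longrightarrow> b \<in> Z \<Longrightarrow> dn (\<lambda>x. a x + b x) = dn a + dn b"
    using assms unfolding M_ideal_def by auto
  then have ZD: "b \<in> Z \<Longrightarrow> b \<in> D" and Zadd: "b \<in> Z \<Longrightarrow> b' \<in> Z \<Longrightarrow> (\<lambda>x. b x + b' x) \<in> Z"
    and Zint: "b \<in> annihilator V Y \<Longrightarrow> b \<in> Z \<Longrightarrow> b = (\<lambda>x. 0)"
    and Zdec: "f \<in> D \<Longrightarrow> \<exists>a\<in>annihilator V Y. \<exists>b\<in>Z. f = (\<lambda>x. a x + b x)" for b b' f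
    unfolding closed_complement_def closed_subspace_def by auto
  fix x y1 y2 y3 and e :: real
  assume x: "x \<in> C" "n x \<le> 1" and Y1: "y1 \<in> Y" "n y1 \<le> 1" and Y2: "y2 \<in> Y" "n y2 \<le> 1"
    and Y3: "y3 \<in> Y" "n y3 \<le> 1" and e: "e > 0"
  \<comment> \<open>Once \<open>p\<close> is known to be at most 1 at the given triple, an almost
    optimal \<open>z\<close> serves all three centres at once.\<close>
  define N where "N = (\<lambda>(v1, v2, v3) z. max (n (v1 \<oplus> z)) (max (n (v2 \<oplus> z)) (n (v3 \<oplus> z))))"
  define p where "p v = (INF z\<in>Y. N v z)" for v
  have p_le: "p v \<le> N v z" if "v \<in> W.C" "z \<in> Y" for v z
    unfolding p_def
    by (rule cINF_lower[OF bdd_belowI2[of _ 0]]) (use that in \<open>auto simp: N_def cube_def le_max_iff_disj\<close>)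
  have p_ge: "b \<le> p v" if "\<And>z. z \<in> Y \<Longrightarrow> b \<le> N v z" for b v
    unfolding p_def by (rule cINF_greatest) (use that Y_zero in auto)
  have N_add: "N (W.plus v v') (z \<oplus> z') \<le> N v z + N v' z'"
    if v: "v \<in> W.C" "v' \<in> W.C" and z: "z \<in> Y" "z' \<in> Y" for v v' z z'
  proof -
    have *: "n (w \<oplus> w' \<oplus> (z \<oplus> z')) \<le> n (w \<oplus> z) + n (w' \<oplus> z')" if "w \<in> C" "w' \<in> C" for w w'
      using n_add[of "w \<oplus> z" "w' \<oplus> z'"] that z by (simp add: add_add_swap)
    show ?thesis
      using v unfolding N_def cube_def by (auto intro!: order_trans[OF *] add_mono simp: le_max_iff_disj)
  qed
  have N_scale: "N (W.scale (of_real r) v) (of_real r \<odot> z) = r * N v z"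
    if v: "v \<in> W.C" and z: "z \<in> Y" and r: "r > 0" for r v z
  proof -
    have *: "n (of_real r \<odot> w \<oplus> of_real r \<odot> z) = r * n (w \<oplus> z)" if "w \<in> C" for w
      using that z r by (simp add: n_scale flip: scale_add)
    show ?thesis
      using v r unfolding N_def cube_def by (auto simp: * max_mult_distrib_left)
  qed
  have "W.sublinear p"
    unfolding W.sublinear_def
  proof (intro conjI ballI allI impI)
    fix v v' assume v: "v \<in> W.C" and v': "v' \<in> W.C"
    have "p (W.plus v v') - p v \<le> p v'"
    proof (rule p_ge)
      fix z' assume z': "z' \<in> Y"
      have "p (W.plus v v') - N v' z' \<le> p v"
      proof (rule p_ge)
        fix z assume z: "z \<in> Y"
        show "p (W.plus v v') - N v' z' \<le> N v z"
          using p_le[OF W.add_closed[OF v v'] Y_add[OF z z']] N_add[OF v v' z z'] by simp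
      qed
      then show "p (W.plus v v') - p v \<le> N v' z'" by simp
    qed
    then show "p (W.plus v v') \<le> p v + p v'" by simp
  next
    fix r :: real and v assume r: "r > 0" and v: "v \<in> W.C"
    have "p (W.scale (of_real r) v) / r \<le> p v"
    proof (rule p_ge)
      fix z assume z: "z \<in> Y"
      show "p (W.scale (of_real r) v) / r \<le> N v z"
        using p_le[OF W.scale_closed[OF v] Y_scale[OF z]] N_scale[OF v z r] r
        by (metis mult.commute pos_divide_le_eq)
    qed
    then show "p (W.scale (of_real r) v) \<le> r * p v" using r by (simp add: field_simps)
  qed
  moreover have aW: "(x \<oplus> y1, x \<oplus> y2, x \<oplus> y3) \<in> W.C" using x Y1 Y2 Y3 by (simp add: cube_def)
  ultimately obtain u where u: "W.real_linear u" and up: "\<And>v. v \<in> W.C \<Longrightarrow> u v \<le> p v"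
    and ua: "u (x \<oplus> y1, x \<oplus> y2, x \<oplus> y3) = p (x \<oplus> y1, x \<oplus> y2, x \<oplus> y3)"
    by (rule W.hahn_banach) blast
  have u_add: "u (v1 \<oplus> w1, v2 \<oplus> w2, v3 \<oplus> w3) = u (v1, v2, v3) + u (w1, w2, w3)"
    if "v1 \<in> C" "v2 \<in> C" "v3 \<in> C" "w1 \<in> C" "w2 \<in> C" "w3 \<in> C" for v1 v2 v3 w1 w2 w3
    using u[unfolded W.real_linear_def, THEN conjunct1, rule_format, of "(v1, v2, v3)" "(w1, w2, w3)"] that
    by (simp add: cube_def)
  have u_scale: "u (of_real r \<odot> v1, of_real r \<odot> v2, of_real r \<odot> v3) = r * u (v1, v2, v3)"
    if "v1 \<in> C" "v2 \<in> C" "v3 \<in> C" for r v1 v2 v3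
    using u[unfolded W.real_linear_def, THEN conjunct2, rule_format, of "(v1, v2, v3)" r] that
    by (simp add: cube_def)
  have uN: "u (v1, v2, v3) \<le> N (v1, v2, v3) z" if "v1 \<in> C" "v2 \<in> C" "v3 \<in> C" "z \<in> Y" for v1 v2 v3 z
    using up[of "(v1, v2, v3)"] p_le[of "(v1, v2, v3)" z] that by (simp add: cube_def)
  have split: "u (v1, v2, v3) = u (v1, \<zero>, \<zero>) + u (\<zero>, v2, \<zero>) + u (\<zero>, \<zero>, v3)"
    if "v1 \<in> C" "v2 \<in> C" "v3 \<in> C" for v1 v2 v3
    using u_add[of v1 "\<zero>" "\<zero>" "\<zero>" v2 v3] u_add[of "\<zero>" v2 "\<zero>" "\<zero>" "\<zero>" v3] that by simp
  have lin1: "real_linear (\<lambda>v. u (v, \<zero>, \<zero>))"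
    unfolding real_linear_def
  proof (intro conjI ballI allI)
    fix v w assume "v \<in> C" "w \<in> C"
    then show "u (v \<oplus> w, \<zero>, \<zero>) = u (v, \<zero>, \<zero>) + u (w, \<zero>, \<zero>)"
      using u_add[of v \<zero> \<zero> w \<zero> \<zero>] by simp
  next
    fix r :: real and v assume "v \<in> C"
    then show "u (of_real r \<odot> v, \<zero>, \<zero>) = r * u (v, \<zero>, \<zero>)"
      using u_scale[of v \<zero> \<zero> r] by simp
  qed
  have bnd1: "u (v, \<zero>, \<zero>) \<le> 1 * n v" if "v \<in> C" for v
    using uN[of v \<zero> \<zero> \<zero>] that Y_zero by (simp add: N_def max_absorb1 max_absorb2)
  obtain f1 where f1: "f1 \<in> D" "\<And>v. v \<in> C \<Longrightarrow> repart (f1 v) = u (v, \<zero>, \<zero>)"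
    using ex_functional_of_real_part[OF lin1 bnd1] zero_le_one by blast
  have lin2: "real_linear (\<lambda>v. u (\<zero>, v, \<zero>))"
    unfolding real_linear_def
  proof (intro conjI ballI allI)
    fix v w assume "v \<in> C" "w \<in> C"
    then show "u (\<zero>, v \<oplus> w, \<zero>) = u (\<zero>, v, \<zero>) + u (\<zero>, w, \<zero>)"
      using u_add[of \<zero> v \<zero> \<zero> w \<zero>] by simp
  next
    fix r :: real and v assume "v \<in> C"
    then show "u (\<zero>, of_real r \<odot> v, \<zero>) = r * u (\<zero>, v, \<zero>)"
      using u_scale[of \<zero> v \<zero> r] by simp
  qed
  have bnd2: "u (\<zero>, v, \<zero>) \<le> 1 * n v" if "v \<in> C" for v
    using uN[of \<zero> v \<zero> \<zero>] that Y_zero by (simp add: N_def max_absorb1 max_absorb2)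
  obtain f2 where f2: "f2 \<in> D" "\<And>v. v \<in> C \<Longrightarrow> repart (f2 v) = u (\<zero>, v, \<zero>)"
    using ex_functional_of_real_part[OF lin2 bnd2] zero_le_one by blast
  have lin3: "real_linear (\<lambda>v. u (\<zero>, \<zero>, v))"
    unfolding real_linear_def
  proof (intro conjI ballI allI)
    fix v w assume "v \<in> C" "w \<in> C"
    then show "u (\<zero>, \<zero>, v \<oplus> w) = u (\<zero>, \<zero>, v) + u (\<zero>, \<zero>, w)"
      using u_add[of \<zero> \<zero> v \<zero> \<zero> w] by simp
  next
    fix r :: real and v assume "v \<in> C"
    then show "u (\<zero>, \<zero>, of_real r \<odot> v) = r * u (\<zero>, \<zero>, v)"
      using u_scale[of \<zero> \<zero> v r] by simp
  qed
  have bnd3: "u (\<zero>, \<zero>, v) \<le> 1 * n v" if "v \<in> C" for v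
    using uN[of \<zero> \<zero> v \<zero>] that Y_zero by (simp add: N_def max_absorb1 max_absorb2)
  obtain f3 where f3: "f3 \<in> D" "\<And>v. v \<in> C \<Longrightarrow> repart (f3 v) = u (\<zero>, \<zero>, v)"
    using ex_functional_of_real_part[OF lin3 bnd3] zero_le_one by blast
  have u_sum: "u (v1, v2, v3) = repart (f1 v1) + repart (f2 v2) + repart (f3 v3)"
    if "v1 \<in> C" "v2 \<in> C" "v3 \<in> C" for v1 v2 v3
    using split[OF that] f1(2)[OF that(1)] f2(2)[OF that(2)] f3(2)[OF that(3)] by linarith
  define s where "s = (\<lambda>v. f1 v + f2 v + f3 v)"
  have sD: "s \<in> D" unfolding s_def by (intro D_addI f1 f2 f3)
  \<comment> \<open>The shift by \<open>neg y\<close> takes the triple \<open>(y, y, y)\<close> to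
    the origin, so \<open>u\<close> is at most 0 on it.\<close>
  have "repart (s y) \<le> 0" if y: "y \<in> Y" for y
    using uN[of y y y "neg y"] u_sum[of y y y] y Y_scale[OF y, of "- 1"]
    by (simp add: s_def repart_add N_def)
  then have sA: "s \<in> annihilator V Y"
    by (intro annihilatorI sD functional_vanishes[OF sD])
  \<comment> \<open>The norm dual to a maximum of norms is the sum of the dual norms, and
    \<open>u\<close> is dominated by the maximum norm (shift 0).\<close>
  have dn_sum: "dn f1 + dn f2 + dn f3 \<le> 1"
  proof (rule le_if_le_add_eps_mult)
    fix d :: real assume d: "d > 0"
    obtain v1 where v1: "v1 \<in> C" "n v1 \<le> 1" "dn f1 - d < repart (f1 v1)" by (rule dn_approx[OF f1(1) d])
    obtain v2 where v2: "v2 \<in> C" "n v2 \<le> 1" "dn f2 - d < repart (f2 v2)" by (rule dn_approx[OF f2(1) d])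
    obtain v3 where v3: "v3 \<in> C" "n v3 \<le> 1" "dn f3 - d < repart (f3 v3)" by (rule dn_approx[OF f3(1) d])
    have "u (v1, v2, v3) \<le> N (v1, v2, v3) \<zero>" by (rule uN) (use v1 v2 v3 Y_zero in auto)
    also have "\<dots> \<le> 1" using v1 v2 v3 by (simp add: N_def)
    finally show "dn f1 + dn f2 + dn f3 \<le> 1 + d * 3"
      using u_sum[OF v1(1) v2(1) v3(1)] v1(3) v2(3) v3(3) by simp
  qed simp
  obtain a1 b1 where 1: "a1 \<in> annihilator V Y" "b1 \<in> Z" "f1 = (\<lambda>x. a1 x + b1 x)" using Zdec[OF f1(1)] by blast
  obtain a2 b2 where 2: "a2 \<in> annihilator V Y" "b2 \<in> Z" "f2 = (\<lambda>x. a2 x + b2 x)" using Zdec[OF f2(1)] by blast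
  obtain a3 b3 where 3: "a3 \<in> annihilator V Y" "b3 \<in> Z" "f3 = (\<lambda>x. a3 x + b3 x)" using Zdec[OF f3(1)] by blast
  \<comment> \<open>On \<open>Y\<close> the sum of the \<open>b\<close> parts equals
    \<open>s\<close> minus the \<open>a\<close> parts, hence 0. It lies in \<open>Z\<close> as well,
    so it vanishes everywhere.\<close>
  have "(\<lambda>x. b1 x + b2 x + b3 x) = (\<lambda>x. 0)"
  proof (rule Zint)
    show "(\<lambda>x. b1 x + b2 x + b3 x) \<in> Z" by (intro Zadd 1 2 3)
    show "(\<lambda>x. b1 x + b2 x + b3 x) \<in> annihilator V Y"
    proof (rule annihilatorI)
      show "(\<lambda>x. b1 x + b2 x + b3 x) \<in> D" by (intro D_addI ZD 1 2 3)
      fix y assume y: "y \<in> Y"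
      show "b1 y + b2 y + b3 y = 0"
        using annihilatorD(2)[OF sA y] annihilatorD(2)[OF 1(1) y] annihilatorD(2)[OF 2(1) y]
          annihilatorD(2)[OF 3(1) y] by (simp add: s_def 1(3) 2(3) 3(3))
    qed
  qed
  then have b0: "b1 x + b2 x + b3 x = 0" by (rule fun_cong)
  \<comment> \<open>Since \<open>a\<close> ignores \<open>y\<close>, the norm of \<open>a\<close> is
    charged to \<open>x\<close> and that of \<open>b\<close> to \<open>y\<close>; additivity of the
    norm makes this \<open>dn f\<close>. The remaining terms \<open>repart (b x)\<close> cancel over
    the three functionals.\<close>
  have part: "repart (f (x \<oplus> y)) \<le> dn f + repart (b x)"
    if a: "a \<in> annihilator V Y" and b: "b \<in> Z" and f: "f = (\<lambda>x. a x + b x)" and y: "y \<in> Y" "n y \<le> 1"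
    for a b f y
  proof -
    have aD: "a \<in> D" and bD: "b \<in> D" using annihilatorD(1)[OF a] ZD[OF b] .
    have "f (x \<oplus> y) = a x + b x + b y"
      using f aD bD x y annihilatorD(2)[OF a y(1)] by (simp add: D_add)
    moreover have "repart (a x) \<le> dn a"
      using norm_le_dn[OF aD x] repart_le_norm[of "a x"] by simp
    moreover have "repart (b y) \<le> dn b"
      using norm_le_dn[OF bD Y_sub y(2)] repart_le_norm[of "b y"] y by simp
    ultimately show ?thesis using Zn[OF a b] f by (simp add: repart_add)
  qed
  have "repart (b1 x) + repart (b2 x) + repart (b3 x) = 0" using b0 by (metis repart_0 repart_add)
  then have "p (x \<oplus> y1, x \<oplus> y2, x \<oplus> y3) \<le> 1"
    using part[OF 1 Y1] part[OF 2 Y2] part[OF 3 Y3] dn_sum ua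
      u_sum[of "x \<oplus> y1" "x \<oplus> y2" "x \<oplus> y3"] x Y1 Y2 Y3 by simp
  then have "\<not> 1 + e \<le> p (x \<oplus> y1, x \<oplus> y2, x \<oplus> y3)" using e by simp
  then have "\<exists>z\<in>Y. \<not> 1 + e \<le> N (x \<oplus> y1, x \<oplus> y2, x \<oplus> y3) z" using p_ge by blast
  then have "\<exists>z\<in>Y. N (x \<oplus> y1, x \<oplus> y2, x \<oplus> y3) z \<le> 1 + e" by (meson linear)
  then show "\<exists>z\<in>Y. \<forall>y\<in>{y1, y2, y3}. n (x \<oplus> y \<oplus> z) \<le> 1 + e"
    by (simp add: N_def)
qed

lemma M_ideal_iff_three_ball: "M_ideal V Y \<longleftrightarrow> three_ball V Y"
  using M_ideal_of_three_ball three_ball_of_M_ideal by blast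

end

end

section \<open>Convex combinations and limits\<close>

context kspace
begin

definition mix :: "real \<Rightarrow> 'v \<Rightarrow> 'v \<Rightarrow> 'v" where
  "mix r x y = of_real r \<odot> x \<oplus> of_real (1 - r) \<odot> y"

lemma mix_closed [simp]: "x \<in> C \<Longrightarrow> y \<in> C \<Longrightarrow> mix r x y \<in> C"
  by (simp add: mix_def)

lemma mix_same: "x \<in> C \<Longrightarrow> mix r x x = x"
  using add_scale[of x "of_real r" "of_real (1 - r)"] by (simp add: mix_def)

lemma mix_1: "x \<in> C \<Longrightarrow> y \<in> C \<Longrightarrow> mix 1 x y = x"
  and mix_0: "x \<in> C \<Longrightarrow> y \<in> C \<Longrightarrow> mix 0 x y = y"
  by (simp_all add: mix_def)

lemma mix_add: "x \<in> C \<Longrightarrow> y \<in> C \<Longrightarrow> x' \<in> C \<Longrightarrow> y' \<in> C \<Longrightarrow>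
    mix r x y \<oplus> mix r x' y' = mix r (x \<oplus> x') (y \<oplus> y')"
  unfolding mix_def by (simp add: scale_add add_add_swap del: of_real_diff)

lemma scale_mix: "x \<in> C \<Longrightarrow> y \<in> C \<Longrightarrow> c \<odot> mix r x y = mix r (c \<odot> x) (c \<odot> y)"
  by (simp add: mix_def scale_add scale_scale mult.commute)

lemma add_mix: "w \<in> C \<Longrightarrow> x \<in> C \<Longrightarrow> y \<in> C \<Longrightarrow> w \<oplus> mix r x y = mix r (w \<oplus> x) (w \<oplus> y)"
  using mix_add[of w w x y r] by (simp add: mix_same)

end

context knorm
begin

lemma n_mix: "x \<in> C \<Longrightarrow> y \<in> C \<Longrightarrow> 0 \<le> r \<Longrightarrow> r \<le> 1 \<Longrightarrow> n (mix r x y) \<le> r * n x + (1 - r) * n y"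
  using n_add[of "of_real r \<odot> x" "of_real (1 - r) \<odot> y"]
  unfolding mix_def by (simp add: n_scale norm_of_real del: of_real_diff)

lemma limit_of_geometric:
  assumes complete: "Metric_space.mcomplete C (vdist V)"
    and \<sigma>: "\<And>k. \<sigma> k \<in> C" and step: "\<And>k. n (\<sigma> (Suc k) \<oplus> neg (\<sigma> k)) \<le> c / 2 ^ k"
  obtains x where "x \<in> C" "\<And>k. n (x \<oplus> neg (\<sigma> k)) \<le> 2 * c / 2 ^ k"
proof -
  interpret Metric_space C "vdist V" by (rule metric)
  \<comment> \<open>The bound \<open>2 * c / 2 ^ k\<close> alone is not inductive; the subtracted
    tail is what makes the next step fit.\<close>
  have tele: "n (\<sigma> (k + m) \<oplus> neg (\<sigma> k)) \<le> 2 * c / 2 ^ k - 2 * c / 2 ^ (k + m)" for k m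
  proof (induction m)
    case 0
    then show ?case using \<sigma> by simp
  next
    case (Suc m)
    have "n (\<sigma> (k + Suc m) \<oplus> neg (\<sigma> k)) \<le> c / 2 ^ (k + m) + n (\<sigma> (k + m) \<oplus> neg (\<sigma> k))"
      using n_diff_triangle[OF \<sigma> \<sigma> \<sigma>, of "Suc (k + m)" k "k + m"] step[of "k + m"] by simp
    moreover have "2 * c / 2 ^ (k + Suc m) = c / 2 ^ (k + m)" by simp
    moreover have "2 * c / 2 ^ (k + m) = c / 2 ^ (k + m) + c / 2 ^ (k + m)" by simp
    ultimately show ?case using Suc by linarith
  qed
  have c: "c \<ge> 0" using order_trans[OF n_ge_0 step[of 0]] \<sigma> by simp
  have tele': "n (\<sigma> i \<oplus> neg (\<sigma> k)) \<le> 2 * c / 2 ^ k" if "k \<le> i" for i k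
    using tele[of k "i - k"] that c by (smt (verit) divide_nonneg_nonneg le_add_diff_inverse zero_le_power)
  have "MCauchy \<sigma>"
    unfolding MCauchy_def
  proof (intro conjI allI impI)
    show "range \<sigma> \<subseteq> C" using \<sigma> by auto
    fix \<epsilon> :: real assume \<epsilon>: "\<epsilon> > 0"
    have "(\<lambda>k. 4 * c / 2 ^ k) \<longlonglongrightarrow> 0"
      by (rule LIMSEQ_divide_realpow_zero) simp
    from order_tendstoD(2)[OF this \<epsilon>] obtain K where K: "4 * c / 2 ^ K < \<epsilon>"
      unfolding eventually_sequentially by blast
    have "vdist V (\<sigma> i) (\<sigma> j) < \<epsilon>" if "K \<le> i" "K \<le> j" for i j
    proof -
      have "n (\<sigma> i \<oplus> neg (\<sigma> j)) \<le> n (\<sigma> i \<oplus> neg (\<sigma> K)) + n (\<sigma> j \<oplus> neg (\<sigma> K))"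
        using n_diff_triangle[OF \<sigma> \<sigma> \<sigma>, of i j K] n_diff_commute[OF \<sigma> \<sigma>, of K j] by simp
      then show ?thesis using tele'[OF that(1)] tele'[OF that(2)] K \<sigma> by (simp add: vdist_def)
    qed
    then show "\<exists>N. \<forall>n n'. N \<le> n \<longrightarrow> N \<le> n' \<longrightarrow> vdist V (\<sigma> n) (\<sigma> n') < \<epsilon>" by blast
  qed
  then obtain x where x: "limitin mtopology \<sigma> x sequentially"
    using complete unfolding mcomplete_def by blast
  then have xC: "x \<in> C" by (metis limitin_mspace)
  have "n (x \<oplus> neg (\<sigma> k)) \<le> 2 * c / 2 ^ k" for k
  proof (rule field_le_epsilon)
    fix e :: real assume e: "e > 0"
    then obtain K where K: "\<And>i. K \<le> i \<Longrightarrow> vdist V (\<sigma> i) x < e"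
      using x unfolding limitin_metric eventually_sequentially by blast
    let ?i = "max K k"
    have "n (x \<oplus> neg (\<sigma> k)) \<le> n (\<sigma> ?i \<oplus> neg x) + n (\<sigma> ?i \<oplus> neg (\<sigma> k))"
      using n_diff_triangle[OF xC \<sigma> \<sigma>, of k "?i"] n_diff_commute[OF xC \<sigma>, of "?i"] by simp
    then show "n (x \<oplus> neg (\<sigma> k)) \<le> 2 * c / 2 ^ k + e"
      using K[of "?i"] tele'[of k "?i"] \<sigma> xC by (simp add: vdist_def)
  qed
  with xC that show ?thesis by blast
qed

end

section \<open>Banach bundles\<close>

locale bundle_locale =
  fixes \<xi> :: "('k::real_or_complex, 'e::topological_space, 't::t2_space) bundle_data"
  assumes is_bundle: "banach_bundle \<xi>"
begin

abbreviation p where "p \<equiv> proj \<xi>"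
abbreviation plus (infixl "\<oplus>" 65) where "x \<oplus> y \<equiv> badd \<xi> x y"
abbreviation scale (infixr "\<odot>" 75) where "c \<odot> x \<equiv> bscale \<xi> c x"
abbreviation N where "N x \<equiv> bnorm \<xi> x"
abbreviation d where "d x y \<equiv> bnorm \<xi> (badd \<xi> x (bscale \<xi> (- 1) y))"

definition bmix :: "real \<Rightarrow> 'e \<Rightarrow> 'e \<Rightarrow> 'e" where
  "bmix r x y = of_real r \<odot> x \<oplus> of_real (1 - r) \<odot> y"

lemma fiber_simps [simp]:
  "vcarrier (fiber \<xi> t) = p -` {t}" "vadd (fiber \<xi> t) = badd \<xi>" "vzero (fiber \<xi> t) = bzero \<xi> t"
  "vscale (fiber \<xi> t) = bscale \<xi>" "vnorm (fiber \<xi> t) = bnorm \<xi>"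
  by (simp_all add: fiber_def)

lemma knorm_fiber: "knorm (fiber \<xi> t)"
  and complete_fiber: "Metric_space.mcomplete (p -` {t}) (vdist (fiber \<xi> t))"
  using is_bundle unfolding banach_bundle_def banach_space_def
  by (auto simp: knorm_def kspace_def knorm_axioms_def)

lemma kspace_fiber: "kspace (fiber \<xi> t)"
  using knorm_fiber by (simp add: knorm_def)

lemma mix_fiber [simp]: "kspace.mix (fiber \<xi> t) = bmix"
  by (intro ext) (simp add: kspace.mix_def[OF kspace_fiber] bmix_def)

lemma p_zero [simp]: "p (bzero \<xi> t) = t"
  using kspace.zero_closed[OF kspace_fiber, of t] by simp

lemma p_add [simp]: "p x = p y \<Longrightarrow> p (x \<oplus> y) = p y"
  using kspace.add_closed[OF kspace_fiber, of x "p x" y] by simp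

lemma p_scale [simp]: "p (c \<odot> x) = p x"
  using kspace.scale_closed[OF kspace_fiber, of x "p x" c] by simp

lemma p_bmix [simp]: "p x = p y \<Longrightarrow> p (bmix r x y) = p y"
  by (simp add: bmix_def)

lemma N_ge_0 [simp]: "0 \<le> N x"
  using knorm.n_ge_0[OF knorm_fiber, of x "p x"] by simp

lemma N_zero [simp]: "N (bzero \<xi> t) = 0"
  using knorm.n_zero[OF knorm_fiber, of t] by simp

lemma N_add: "p x = p y \<Longrightarrow> N (x \<oplus> y) \<le> N x + N y"
  using knorm.n_add[OF knorm_fiber, of x "p x" y] by simp

lemma N_scale: "N (c \<odot> x) = norm c * N x"
  using knorm.n_scale[OF knorm_fiber, of x "p x" c] by simp

lemma N_bmix: "p x = p y \<Longrightarrow> 0 \<le> r \<Longrightarrow> r \<le> 1 \<Longrightarrow> N (bmix r x y) \<le> r * N x + (1 - r) * N y"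
  using knorm.n_mix[OF knorm_fiber, of x "p x" y r] by simp

lemma add_zero [simp]: "p x = t \<Longrightarrow> x \<oplus> bzero \<xi> t = x"
  using kspace.add_zero[OF kspace_fiber, of x t] by simp

lemma scale_one [simp]: "1 \<odot> x = x"
  using kspace.scale_one[OF kspace_fiber, of x "p x"] by simp

lemma scale_bzero [simp]: "c \<odot> bzero \<xi> t = bzero \<xi> t"
  using kspace.scale_zero[OF kspace_fiber, of t c] by simp

lemma scale_0 [simp]: "0 \<odot> x = bzero \<xi> (p x)"
  using kspace.scale_0[OF kspace_fiber, of x "p x"] by simp

lemma add_neg [simp]: "x \<oplus> - 1 \<odot> x = bzero \<xi> (p x)"
  using kspace.add_neg[OF kspace_fiber, of x "p x"] by simp

lemma add_neg_cancel: "p x = p y \<Longrightarrow> x \<oplus> - 1 \<odot> y \<oplus> y = x"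
  using kspace.add_neg_cancel[OF kspace_fiber, of x "p x" y] by simp

lemma d_commute: "p x = p y \<Longrightarrow> d x y = d y x"
  using knorm.n_diff_commute[OF knorm_fiber, of x "p x" y] by simp

lemma d_triangle: "p x = p y \<Longrightarrow> p y = p z \<Longrightarrow> d x z \<le> d x y + d y z"
  using knorm.n_diff_triangle[OF knorm_fiber, of x "p x" y z] by simp

lemma N_le_add_d: "p x = p y \<Longrightarrow> N x \<le> N y + d x y"
  using knorm.n_le_add_diff[OF knorm_fiber, of x "p x" y] by simp

lemma bmix_same [simp]: "bmix r x x = x"
  using kspace.mix_same[OF kspace_fiber, of x "p x" r] by simp

lemma bmix_1 [simp]: "p x = p y \<Longrightarrow> bmix 1 x y = x"
  and bmix_0 [simp]: "p x = p y \<Longrightarrow> bmix 0 x y = y"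
  using kspace.mix_1[OF kspace_fiber, of x "p x" y] kspace.mix_0[OF kspace_fiber, of x "p x" y]
  by simp_all

lemma add_bmix: "p w = p x \<Longrightarrow> p x = p y \<Longrightarrow> w \<oplus> bmix r x y = bmix r (w \<oplus> x) (w \<oplus> y)"
  using kspace.add_mix[OF kspace_fiber, of w "p w" x y r] by simp

lemma d_bmix:
  assumes "p x = p x'" "p y = p x'" "p y' = p x'" "0 \<le> r" "r \<le> 1"
  shows "d (bmix r x y) (bmix r x' y') \<le> r * d x x' + (1 - r) * d y y'"
proof -
  interpret F: knorm "fiber \<xi> (p x')" by (rule knorm_fiber)
  have "bmix r x y \<oplus> - 1 \<odot> bmix r x' y' = bmix r (x \<oplus> - 1 \<odot> x') (y \<oplus> - 1 \<odot> y')"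
    using F.mix_add[of x y "- 1 \<odot> x'" "- 1 \<odot> y'" r] F.scale_mix[of x' y' "- 1" r] assms by simp
  then show ?thesis
    using N_bmix[of "x \<oplus> - 1 \<odot> x'" "y \<oplus> - 1 \<odot> y'" r] assms by simp
qed

lemma d_bmix_right:
  assumes "p x = p w" "p y = p w" "0 \<le> r" "r \<le> 1"
  shows "d (bmix r x y) w \<le> r * d x w + (1 - r) * d y w"
  using d_bmix[of x w y w r] assms by simp

section \<open>The topology of the bundle space\<close>

lemma cont_p: "continuous_on UNIV p"
  and open_image_p: "open U \<Longrightarrow> open (p ` U)"
  and cont_add: "continuous_on {(x, y). p x = p y} (\<lambda>(x, y). x \<oplus> y)"
  and cont_scale: "continuous_on UNIV (\<lambda>(c, x). c \<odot> x)"
  and open_N: "open {x. N x < r}"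
  using is_bundle unfolding banach_bundle_def open_map_def by auto

lemma open_vimage_p: "open G \<Longrightarrow> open (p -` G)"
  using cont_p by (rule open_vimage[rotated])

lemma cont_add_comp:
  assumes "continuous_on S f" "continuous_on S g" "\<And>s. s \<in> S \<Longrightarrow> p (f s) = p (g s)"
  shows "continuous_on S (\<lambda>s. f s \<oplus> g s)"
  using continuous_on_compose2[OF cont_add continuous_on_Pair[OF assms(1,2)]] assms(3) by auto

lemma cont_scale_comp:
  assumes "continuous_on S c" "continuous_on S f"
  shows "continuous_on S (\<lambda>s. c s \<odot> f s)"
  using continuous_on_compose2[OF cont_scale continuous_on_Pair[OF assms]] by auto

lemma cont_bmix_comp:
  assumes "continuous_on S r" "continuous_on S f" "continuous_on S g"
    "\<And>s. s \<in> S \<Longrightarrow> p (f s) = p (g s)"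
  shows "continuous_on S (\<lambda>s. bmix (r s) (f s) (g s))"
  unfolding bmix_def using assms
  by (intro cont_add_comp cont_scale_comp continuous_intros) auto

lemma cont_diff_comp:
  assumes "continuous_on S f" "continuous_on S g" "\<And>s. s \<in> S \<Longrightarrow> p (f s) = p (g s)"
  shows "continuous_on S (\<lambda>s. f s \<oplus> - 1 \<odot> g s)"
  using assms by (intro cont_add_comp cont_scale_comp continuous_intros) auto

lemma open_N_less:
  assumes "continuous_on UNIV f" shows "open {s. N (f s) < r}"
  using open_vimage[OF open_N assms, of r] by (simp add: vimage_def)

text \<open>The condition on nets is applied to the coarsest filter along which \<open>p\<close>
  tends to \<open>t\<close> and the norm tends to 0. It is generated by the sets of points of small
  norm over a neighbourhood of \<open>t\<close>, so one of these lies in \<open>A\<close>.\<close>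

lemma nbhd_of_zero:
  assumes "open A" "bzero \<xi> t \<in> A"
  obtains G \<delta> where "open G" "t \<in> G" "\<delta> > 0" "\<forall>x. p x \<in> G \<longrightarrow> N x < \<delta> \<longrightarrow> x \<in> A"
proof -
  let ?F = "inf (filtercomap p (nhds t)) (filtercomap N (nhds 0))"
  have "(p \<longlongrightarrow> t) ?F" "(N \<longlongrightarrow> 0) ?F"
    by (meson filterlim_filtercomap filterlim_mono inf_le1 inf_le2 order_refl)+
  then have "((\<lambda>x. x) \<longlongrightarrow> bzero \<xi> t) ?F"
    using is_bundle unfolding banach_bundle_def by blast
  then have "eventually (\<lambda>x. x \<in> A) ?F"
    using assms by (simp add: tendsto_def)
  then obtain P Q where P: "eventually P (nhds t)" and Q: "eventually Q (nhds 0)"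
    and PQ: "\<And>x. P (p x) \<Longrightarrow> Q (N x) \<Longrightarrow> x \<in> A"
    unfolding eventually_inf eventually_filtercomap by blast
  obtain G where G: "open G" "t \<in> G" "\<And>s. s \<in> G \<Longrightarrow> P s"
    using P unfolding eventually_nhds by blast
  obtain \<delta> where \<delta>: "\<delta> > 0" "\<And>r. dist r 0 < \<delta> \<Longrightarrow> Q r"
    using Q unfolding eventually_nhds_metric by blast
  show ?thesis by (rule that[OF G(1,2) \<delta>(1)]) (use G \<delta> PQ in auto)
qed

lemma ex_nbhds_of_open_on_fiber_product:
  assumes "continuous_on {(x, y). p x = p y} (\<lambda>(x, y). m x y)" "open W" "m x y \<in> W" "p x = p y"
  obtains U U' where "open U" "open U'" "x \<in> U" "y \<in> U'"
    "\<forall>u\<in>U. \<forall>v\<in>U'. p u = p v \<longrightarrow> m u v \<in> W"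
proof -
  let ?S = "{(x, y). p x = p y}"
  obtain A where A: "open A" "A \<inter> ?S = (\<lambda>(x, y). m x y) -` W \<inter> ?S"
    using assms(1,2) unfolding continuous_on_open_invariant by meson
  have "(x, y) \<in> A" using A(2) assms(3,4) by auto
  then obtain U U' where U: "open U" "open U'" "(x, y) \<in> U \<times> U'" "U \<times> U' \<subseteq> A"
    by (rule open_prod_elim[OF A(1)])
  show ?thesis
  proof (rule that[OF U(1,2)]; (intro ballI impI)?)
    fix u v assume "u \<in> U" "v \<in> U'" "p u = p v"
    then have "(u, v) \<in> A \<inter> ?S" using U(4) by auto
    then show "m u v \<in> W" unfolding A(2) by simp
  qed (use U in auto)
qed

text \<open>The fiberwise distance is upper semicontinuous on the fiber product, being the norm of a
  continuous difference. Closeness at one base point thereby carries over to neighbouring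
  ones.\<close>

lemma nbhds_d_less:
  assumes "p x = p y" "d x y < r"
  obtains U U' where "open U" "open U'" "x \<in> U" "y \<in> U'"
    "\<forall>u\<in>U. \<forall>v\<in>U'. p u = p v \<longrightarrow> d u v < r"
proof -
  have "continuous_on {(x, y). p x = p y} (\<lambda>(x, y). x \<oplus> - 1 \<odot> y)"
    unfolding case_prod_unfold by (rule cont_diff_comp) (auto intro: continuous_intros)
  then show ?thesis
    by (rule ex_nbhds_of_open_on_fiber_product[OF _ open_N[of r], of "\<lambda>x y. x \<oplus> - 1 \<odot> y" x y])
      (use assms that in auto)
qed

text \<open>Continuity of addition at the pair formed by the origin over \<open>p e\<close> and
  \<open>e\<close>, combined with the known neighbourhoods of the origin, gives one radius for all
  \<open>b\<close> near \<open>e\<close>. This turns estimates of fiberwise distances into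
  membership in open sets.\<close>

lemma nbhd_tube:
  assumes "open W" "e \<in> W"
  obtains U \<delta> where "open U" "e \<in> U" "\<delta> > 0"
    "\<forall>b\<in>U. \<forall>x. p x = p b \<longrightarrow> d x b < \<delta> \<longrightarrow> x \<in> W"
proof -
  have e: "bzero \<xi> (p e) \<oplus> e \<in> W"
    using kspace.zero_add[OF kspace_fiber, of e "p e"] assms by simp
  obtain A B where A: "open A" "bzero \<xi> (p e) \<in> A" and B: "open B" "e \<in> B"
    and AB: "\<forall>u\<in>A. \<forall>v\<in>B. p u = p v \<longrightarrow> u \<oplus> v \<in> W"
    by (rule ex_nbhds_of_open_on_fiber_product[OF cont_add assms(1) e p_zero])
  obtain G \<delta> where G: "open G" "p e \<in> G" "\<delta> > 0" "\<forall>x. p x \<in> G \<longrightarrow> N x < \<delta> \<longrightarrow> x \<in> A"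
    by (rule nbhd_of_zero[OF A])
  show ?thesis
  proof (rule that[of "B \<inter> p -` G" \<delta>]; (intro ballI allI impI)?)
    fix b x assume b: "b \<in> B \<inter> p -` G" and x: "p x = p b" "d x b < \<delta>"
    have "x \<oplus> - 1 \<odot> b \<in> A" by (rule G(4)[rule_format]) (use b x in auto)
    then have "x \<oplus> - 1 \<odot> b \<oplus> b \<in> W" by (rule AB[rule_format]) (use b x in auto)
    then show "x \<in> W" using add_neg_cancel[OF x(1)] by simp
  qed (use G B open_vimage_p in auto)
qed

end

section \<open>Oscillation of discontinuous selections\<close>

context bundle_locale
begin

text \<open>
  A discontinuous selection \<open>f\<close> has oscillation below \<open>\<delta>\<close> at \<open>t\<close> if it is uniformly \<open>\<delta>\<close>-close to
  all points of some open set meeting the fiber over \<open>t\<close>; the set need not contain \<open>f t\<close>.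
\<close>

definition osc_less :: "real \<Rightarrow> ('t \<Rightarrow> 'e) \<Rightarrow> 't \<Rightarrow> bool" where
  "osc_less \<delta> f t \<longleftrightarrow> (\<exists>U. open U \<and> t \<in> p ` U \<and> (\<forall>x\<in>U. d x (f (p x)) < \<delta>))"

text \<open>The bound is not strict because \<open>osc_le_bmix\<close> loses an arbitrarily small
  amount, which this form absorbs.\<close>

definition osc_le :: "real \<Rightarrow> ('t \<Rightarrow> 'e) \<Rightarrow> 't \<Rightarrow> bool" where
  "osc_le \<epsilon> f t \<longleftrightarrow> (\<forall>\<delta>>\<epsilon>. osc_less \<delta> f t)"

definition selection :: "('t \<Rightarrow> 'e) \<Rightarrow> bool" where
  "selection f \<longleftrightarrow> (\<forall>t. p (f t) = t)"

lemma selectionD [simp]: "selection f \<Longrightarrow> p (f t) = t"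
  by (simp add: selection_def)

text \<open>The open set witnessing small oscillation may miss \<open>f t\<close>, but its point
  \<open>x0\<close> over \<open>t\<close> is close to \<open>f t\<close>. Hence nearby points of the
  witness are close to points \<open>b\<close> near \<open>f t\<close>; the value \<open>f s\<close>
  is close to the former and so lies in the tube around the latter.\<close>

lemma continuous_at_of_osc_less:
  assumes f: "selection f" and osc: "\<And>\<delta>. \<delta> > 0 \<Longrightarrow> osc_less \<delta> f t"
  shows "continuous (at t) f"
  unfolding continuous_at_open
proof (intro allI impI)
  fix W assume "open W \<and> f t \<in> W"
  then have W: "open W" "f t \<in> W" by auto
  obtain U0 \<delta> where U0: "open U0" "f t \<in> U0" "\<delta> > 0"
    "\<forall>b\<in>U0. \<forall>x. p x = p b \<longrightarrow> d x b < \<delta> \<longrightarrow> x \<in> W"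
    by (rule nbhd_tube[OF W])
  obtain U1 where U1: "open U1" "t \<in> p ` U1" "\<forall>x\<in>U1. d x (f (p x)) < \<delta> / 2"
    using osc[of "\<delta> / 2"] U0(3) unfolding osc_less_def by auto
  then obtain x0 where x0: "x0 \<in> U1" "p x0 = t" by auto
  obtain U2 U3 where U2: "open U2" "open U3" "x0 \<in> U2" "f t \<in> U3"
    "\<forall>u\<in>U2. \<forall>v\<in>U3. p u = p v \<longrightarrow> d u v < \<delta> / 2"
    by (rule nbhds_d_less[of x0 "f t" "\<delta> / 2"]) (use x0 U1 f in auto)
  \<comment> \<open>Openness of \<open>p\<close> makes \<open>?S\<close> a neighbourhood of
    \<open>t\<close> over each point of which there are both an \<open>x\<close> near
    \<open>x0\<close> and a \<open>b\<close> near \<open>f t\<close>.\<close>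
  let ?S = "p ` (U1 \<inter> U2) \<inter> p ` (U0 \<inter> U3)"
  show "\<exists>S. open S \<and> t \<in> S \<and> (\<forall>s\<in>S. f s \<in> W)"
  proof (intro exI[of _ ?S] conjI ballI)
    show "open ?S" using U0 U1 U2 by (intro open_Int open_image_p)
    have "t \<in> p ` (U1 \<inter> U2)" by (rule image_eqI[of _ _ x0]) (use U2 x0 in auto)
    moreover have "t \<in> p ` (U0 \<inter> U3)" by (rule image_eqI[of _ _ "f t"]) (use U0 U2 f in auto)
    ultimately show "t \<in> ?S" by blast
    fix s assume "s \<in> ?S"
    then obtain x b where x: "x \<in> U1" "x \<in> U2" "p x = s" and b: "b \<in> U0" "b \<in> U3" "p b = s" by auto
    have "d (f s) b \<le> d (f s) x + d x b" by (rule d_triangle) (use x b f in auto)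
    also have "d (f s) x = d x (f s)" by (rule d_commute) (use x f in auto)
    also have "d x (f s) < \<delta> / 2" using U1 x by auto
    also have "d x b < \<delta> / 2" using U2 x b by auto
    finally show "f s \<in> W" using U0(4) b f by auto
  qed
qed

lemma osc_less_cong:
  assumes "osc_less \<delta> f t" "open G" "t \<in> G" "\<And>s. s \<in> G \<Longrightarrow> f s = g s"
  shows "osc_less \<delta> g t"
proof -
  obtain U where U: "open U" "t \<in> p ` U" "\<forall>x\<in>U. d x (f (p x)) < \<delta>"
    using assms(1) unfolding osc_less_def by blast
  then show ?thesis
    unfolding osc_less_def
    by (intro exI[of _ "U \<inter> p -` G"]) (use assms open_vimage_p in auto)
qed

lemma osc_less_perturb:
  assumes "osc_less \<delta> f t" "selection f" "selection g" "\<And>s. d (f s) (g s) \<le> c"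
  shows "osc_less (\<delta> + c) g t"
proof -
  obtain U where U: "open U" "t \<in> p ` U" "\<forall>x\<in>U. d x (f (p x)) < \<delta>"
    using assms(1) unfolding osc_less_def by blast
  have "d x (g (p x)) < \<delta> + c" if "x \<in> U" for x
    using d_triangle[of x "f (p x)" "g (p x)"] U(3) that assms(2,3) assms(4)[of "p x"] by fastforce
  with U show ?thesis unfolding osc_less_def by blast
qed

lemma osc_less_zero: "\<delta> > 0 \<Longrightarrow> osc_less \<delta> (bzero \<xi>) t"
  unfolding osc_less_def
proof (intro exI conjI)
  show "open {x. N x < \<delta>}" by (rule open_N)
  show "\<delta> > 0 \<Longrightarrow> t \<in> p ` {x. N x < \<delta>}" by (rule image_eqI[of _ _ "bzero \<xi> t"]) auto
qed auto

lemma osc_le_zero: "\<epsilon> \<ge> 0 \<Longrightarrow> osc_le \<epsilon> (bzero \<xi>) t"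
  unfolding osc_le_def using osc_less_zero by auto

lemma osc_le_cong:
  "osc_le \<epsilon> f t \<Longrightarrow> open G \<Longrightarrow> t \<in> G \<Longrightarrow> (\<And>s. s \<in> G \<Longrightarrow> f s = g s) \<Longrightarrow> osc_le \<epsilon> g t"
  unfolding osc_le_def using osc_less_cong by metis

text \<open>The new witness is built around the combination of a point \<open>x1\<close> of the
  first witness with a point \<open>x2\<close> of the second. Its points are
  \<open>\<eta>\<close>-close to combinations of points of the two witnesses, which in turn are
  close to the combination of the values of \<open>f\<close> and \<open>g\<close>.\<close>

lemma osc_le_bmix:
  assumes f: "selection f" and g: "selection g" and \<phi>: "continuous_on UNIV \<phi>" "\<And>s. 0 \<le> \<phi> s \<and> \<phi> s \<le> 1"
    and osc: "osc_le \<epsilon> f t" "osc_le \<epsilon> g t"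
  shows "osc_le \<epsilon> (\<lambda>s. bmix (\<phi> s) (f s) (g s)) t"
  unfolding osc_le_def
proof (intro allI impI)
  fix \<delta> assume \<delta>: "\<epsilon> < \<delta>"
  define \<eta> where "\<eta> = (\<delta> - \<epsilon>) / 2"
  have \<eta>: "\<eta> > 0" "\<epsilon> + \<eta> > \<epsilon>" "\<epsilon> + \<eta> + \<eta> = \<delta>" using \<delta> by (auto simp: \<eta>_def field_simps)
  obtain U1 where U1: "open U1" "t \<in> p ` U1" "\<forall>x\<in>U1. d x (f (p x)) < \<epsilon> + \<eta>"
    using osc(1) \<eta> unfolding osc_le_def osc_less_def by blast
  obtain U2 where U2: "open U2" "t \<in> p ` U2" "\<forall>x\<in>U2. d x (g (p x)) < \<epsilon> + \<eta>"
    using osc(2) \<eta> unfolding osc_le_def osc_less_def by blast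
  obtain x1 x2 where x1: "x1 \<in> U1" "p x1 = t" and x2: "x2 \<in> U2" "p x2 = t" using U1 U2 by auto
  let ?m = "\<lambda>x y. bmix (\<phi> (p x)) x y"
  obtain V V' where V: "open V" "open V'" "?m x1 x2 \<in> V" "?m x1 x2 \<in> V'"
    "\<forall>u\<in>V. \<forall>v\<in>V'. p u = p v \<longrightarrow> d u v < \<eta>"
    by (rule nbhds_d_less[of "?m x1 x2" "?m x1 x2" \<eta>]) (use \<eta> in auto)
  have "continuous_on {(x, y). p x = p y} (\<lambda>z. bmix (\<phi> (p (fst z))) (fst z) (snd z))"
    by (rule cont_bmix_comp)
      (auto intro!: continuous_intros continuous_on_compose2[OF \<phi>(1)] continuous_on_compose2[OF cont_p])
  then have "continuous_on {(x, y). p x = p y} (\<lambda>(x, y). ?m x y)"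
    by (simp add: case_prod_unfold)
  then obtain A B where A: "open A" "open B" "x1 \<in> A" "x2 \<in> B"
    "\<forall>u\<in>A. \<forall>v\<in>B. p u = p v \<longrightarrow> ?m u v \<in> V'"
    by (rule ex_nbhds_of_open_on_fiber_product[OF _ V(2), of ?m x1 x2]) (use V x1 x2 in auto)
  let ?U = "V \<inter> p -` (p ` (U1 \<inter> A) \<inter> p ` (U2 \<inter> B))"
  show "osc_less \<delta> (\<lambda>s. bmix (\<phi> s) (f s) (g s)) t"
    unfolding osc_less_def
  proof (intro exI[of _ ?U] conjI ballI)
    show "open ?U" using U1 U2 A V by (intro open_Int open_vimage_p open_image_p)
    have "t \<in> p ` (U1 \<inter> A)" by (rule image_eqI[of _ _ x1]) (use x1 A in auto)
    moreover have "t \<in> p ` (U2 \<inter> B)" by (rule image_eqI[of _ _ x2]) (use x2 A in auto)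
    ultimately show "t \<in> p ` ?U"
      by (intro image_eqI[of _ _ "?m x1 x2"]) (use x1 x2 V in auto)
    fix x assume x: "x \<in> ?U"
    then obtain y1 y2 where y1: "y1 \<in> U1" "y1 \<in> A" "p y1 = p x" and y2: "y2 \<in> U2" "y2 \<in> B" "p y2 = p x"
      by auto
    let ?s = "p x"
    have y: "p y1 = p y2" using y1 y2 by simp
    have "?m y1 y2 \<in> V'" using A(5) y1(2) y2(2) y by blast
    then have "d x (?m y1 y2) < \<eta>" using V(5) x y1 y2 by auto
    moreover have "d (?m y1 y2) (bmix (\<phi> ?s) (f ?s) (g ?s)) \<le> \<phi> ?s * d y1 (f ?s) + (1 - \<phi> ?s) * d y2 (g ?s)"
      unfolding y1(3) by (rule d_bmix) (use y1 y2 f g \<phi>(2) in auto)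
    moreover have "\<phi> ?s * d y1 (f ?s) + (1 - \<phi> ?s) * d y2 (g ?s) < \<epsilon> + \<eta>"
      by (rule convex_less) (use \<phi>(2) U1 U2 y1 y2 in \<open>auto dest!: bspec\<close>)
    moreover have "d x (bmix (\<phi> ?s) (f ?s) (g ?s)) \<le> d x (?m y1 y2) + d (?m y1 y2) (bmix (\<phi> ?s) (f ?s) (g ?s))"
      by (rule d_triangle) (use y1 y2 f g in auto)
    ultimately show "d x (bmix (\<phi> ?s) (f ?s) (g ?s)) < \<delta>" using \<eta>(3) by linarith
  qed
qed

end

section \<open>Cut-off functions and gluing over a locally compact base\<close>

locale lc_bundle = bundle_locale \<xi>
  for \<xi> :: "('k::real_or_complex, 'e::topological_space, 't::t2_space) bundle_data" +
  assumes locally_compact: "locally_compact_space (euclidean :: 't topology)"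
begin

lemma compact_nbhd:
  obtains G K where "open G" "compact K" "(t :: 't) \<in> G" "G \<subseteq> K"
  using locally_compact that unfolding locally_compact_space_def by (simp, metis)

text \<open>The values 1 and 0 have to be taken on open sets, because in \<open>glue\<close> a
  property passes from one function to another only if they agree on a neighbourhood
  (\<open>Q_cong\<close>).\<close>

lemma bump:
  fixes K G :: "'t set"
  assumes "compact K" "open G" "K \<subseteq> G"
  obtains \<phi> V M where "continuous_on UNIV \<phi>" "\<forall>s. 0 \<le> \<phi> s \<and> \<phi> s \<le> (1::real)"
    "open V" "K \<subseteq> V" "\<forall>s\<in>V. \<phi> s = 1" "open M" "- G \<subseteq> M" "\<forall>s\<in>M. \<phi> s = 0"
proof -
  have "Hausdorff_space (euclidean :: 't topology)"
    unfolding Hausdorff_space_def disjnt_def using hausdorff by auto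
  then have "completely_regular_space (euclidean :: 't topology)"
    using locally_compact_regular_imp_completely_regular_space[OF locally_compact] by blast
  then obtain \<psi> :: "'t \<Rightarrow> real" where \<psi>: "continuous_map euclidean euclideanreal \<psi>"
    "\<psi> ` (- G) \<subseteq> {0}" "\<psi> ` K \<subseteq> {1}"
    by (rule Urysohn_completely_regular_compact_closed_alt[of euclidean K "- G" 0 1])
      (use assms in \<open>auto simp: disjnt_def\<close>)
  then have c: "continuous_on UNIV \<psi>" by simp
  \<comment> \<open>Truncation makes the Urysohn function constant where it exceeds 2/3 and where it
    is below 1/3.\<close>
  let ?\<phi> = "\<lambda>s. min 1 (max 0 (3 * \<psi> s - 1))"
  show ?thesis
  proof (rule that)
    show "continuous_on UNIV ?\<phi>" by (intro continuous_intros c)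
    show "open {s. 2/3 < \<psi> s}" "open {s. \<psi> s < 1/3}"
      by (intro open_Collect_less continuous_intros c)+
    show "K \<subseteq> {s. 2/3 < \<psi> s}" "- G \<subseteq> {s. \<psi> s < 1/3}" using \<psi> by auto
  qed auto
qed

text \<open>
  Gluing along a finite cover, one function at a time: a partition of unity is not needed, because
  convex combinations of two functions suffice.
\<close>

lemma glue:
  assumes A: "\<And>f. f \<in> A \<Longrightarrow> selection f"
    and A_mix: "\<And>f g \<phi>. f \<in> A \<Longrightarrow> g \<in> A \<Longrightarrow> continuous_on UNIV \<phi> \<Longrightarrow> \<forall>s. 0 \<le> \<phi> s \<and> \<phi> s \<le> 1 \<Longrightarrow>
      (\<lambda>s. bmix (\<phi> s) (f s) (g s)) \<in> A"
    and Q_mix: "\<And>f g \<phi> t. f \<in> A \<Longrightarrow> g \<in> A \<Longrightarrow> continuous_on UNIV \<phi> \<Longrightarrow> \<forall>s. 0 \<le> \<phi> s \<and> \<phi> s \<le> 1 \<Longrightarrow>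
      Q f t \<Longrightarrow> Q g t \<Longrightarrow> Q (\<lambda>s. bmix (\<phi> s) (f s) (g s)) t"
    and Q_cong: "\<And>f g G t. open G \<Longrightarrow> t \<in> G \<Longrightarrow> \<forall>s\<in>G. f s = g s \<Longrightarrow> Q f t \<Longrightarrow> Q g t"
    and K: "compact K" "f0 \<in> A" "\<And>t. t \<notin> K \<Longrightarrow> Q f0 t"
    and loc: "\<And>t. t \<in> K \<Longrightarrow> \<exists>f\<in>A. \<exists>G. open G \<and> t \<in> G \<and> (\<forall>s\<in>G. Q f s)"
  shows "\<exists>f\<in>A. \<forall>t. Q f t"
proof -
  define good where "good fG \<longleftrightarrow> fst fG \<in> A \<and> open (snd fG) \<and> (\<forall>s\<in>snd fG. Q (fst fG) s)"
    for fG :: "('t \<Rightarrow> 'e) \<times> 't set"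
  \<comment> \<open>\<open>G\<close> is the region where \<open>f\<close> is already good, and
    \<open>S\<close> holds the patches still to be used. Compactness of the complement of
    \<open>G\<close> is what provides the cut-off functions.\<close>
  have step: "\<exists>h\<in>A. \<forall>t. Q h t"
    if "finite S" "f \<in> A" "open G" "\<forall>s\<in>G. Q f s" "compact (- G)" "\<forall>fG\<in>S. good fG" "G \<union> \<Union>(snd ` S) = UNIV"
    for S f G
    using that
  proof (induction S arbitrary: f G rule: finite_induct)
    case empty
    then show ?case by auto
  next
    case (insert gH S)
    obtain g H where gH: "gH = (g, H)" by (cases gH)
    have g: "g \<in> A" "open H" "\<forall>s\<in>H. Q g s" using insert.prems(5) by (auto simp: gH good_def)
    \<comment> \<open>The part that only the patch \<open>H\<close> can cover. It is compact, so
      there is a cut-off function that is 1 near \<open>R\<close> and 0 near the complement of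
      \<open>H\<close>.\<close>
    define R where "R = - (G \<union> \<Union>(snd ` S))"
    have "open (\<Union>(snd ` S))" using insert.prems(5) by (auto simp: good_def)
    then have "closed R" using insert.prems(2) unfolding R_def by (intro closed_Compl open_Un)
    moreover have "R = R \<inter> - G" by (auto simp: R_def)
    ultimately have "compact R" using insert.prems(4) by (metis closed_Int_compact)
    moreover have "R \<subseteq> H" using insert.prems(6) by (auto simp: R_def gH)
    ultimately obtain \<phi> V M where \<phi>: "continuous_on UNIV \<phi>" "\<forall>s. 0 \<le> \<phi> s \<and> \<phi> s \<le> (1::real)"
      and V: "open V" "R \<subseteq> V" "\<forall>s\<in>V. \<phi> s = 1" and M: "open M" "- H \<subseteq> M" "\<forall>s\<in>M. \<phi> s = 0"
      using bump[OF _ g(2)] by metis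
    define h where "h s = bmix (\<phi> s) (g s) (f s)" for s
    have hA: "h \<in> A" unfolding h_def by (rule A_mix) (use g insert.prems \<phi> in auto)
    have hg: "\<forall>s\<in>V. g s = h s" "\<forall>s\<in>M. f s = h s"
      using V(3) M(3) A[OF g(1)] A[OF insert.prems(1)] by (simp_all add: h_def)
    \<comment> \<open>Near points of \<open>V\<close> the new function is \<open>g\<close>, near
      points of \<open>M\<close> it is \<open>f\<close>; at the remaining points both are good,
      hence so is their convex combination.\<close>
    have Qh: "Q h s" if s: "s \<in> G \<union> (V \<inter> H)" for s
    proof -
      consider "s \<in> V \<inter> H" | "s \<in> G \<inter> M" | "s \<in> G \<inter> H" using s M(2) by auto
      then show ?thesis
      proof cases
        case 1
        then show ?thesis using Q_cong[OF V(1) _ hg(1), of s] g(3) by auto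
      next
        case 2
        then show ?thesis using Q_cong[OF M(1) _ hg(2), of s] insert.prems(3) by auto
      next
        case 3
        then show ?thesis unfolding h_def
          by (intro Q_mix) (use g insert.prems \<phi> in auto)
      qed
    qed
    show ?case
    proof (rule insert.IH[OF hA])
      show "open (G \<union> (V \<inter> H))" using insert.prems(2) V g by auto
      show "\<forall>s\<in>G \<union> (V \<inter> H). Q h s" using Qh by blast
      have "closed (- (G \<union> (V \<inter> H)))" using insert.prems(2) V g by auto
      moreover have "- (G \<union> (V \<inter> H)) = - (G \<union> (V \<inter> H)) \<inter> - G" by auto
      ultimately show "compact (- (G \<union> (V \<inter> H)))" using insert.prems(4) by (metis closed_Int_compact)
      show "\<forall>fG\<in>S. good fG" using insert.prems(5) by auto
      show "G \<union> (V \<inter> H) \<union> \<Union>(snd ` S) = UNIV" using V(2) \<open>R \<subseteq> H\<close> by (auto simp: R_def)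
    qed
  qed
  have "K \<subseteq> \<Union>(snd ` {fG. good fG})"
  proof
    fix t assume "t \<in> K"
    from loc[OF this] obtain f G where "f \<in> A" "open G" "t \<in> G" "\<forall>s\<in>G. Q f s" by blast
    then have "good (f, G)" "t \<in> snd (f, G)" by (auto simp: good_def)
    then show "t \<in> \<Union>(snd ` {fG. good fG})" by blast
  qed
  then obtain S where S: "S \<subseteq> {fG. good fG}" "finite S" "K \<subseteq> \<Union>(snd ` S)"
    using compactE_image[OF K(1), of "{fG. good fG}" snd] by (auto simp: good_def)
  \<comment> \<open>The induction starts with \<open>f0\<close>, which is good on the open set
    \<open>- K\<close>.\<close>
  show ?thesis
  proof (rule step[OF S(2) K(2)])
    show "open (- K)" using compact_imp_closed[OF K(1)] by auto
  qed (use K S in auto)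
qed

end

section \<open>The space of sections vanishing at infinity\<close>

context bundle_locale
begin

abbreviation G where "G \<equiv> vcarrier (Gamma0 \<xi>)"
abbreviation SN where "SN f \<equiv> vnorm (Gamma0 \<xi>) f"

lemma Gamma0_simps [simp]:
  "vadd (Gamma0 \<xi>) = (\<lambda>f g t. f t \<oplus> g t)" "vzero (Gamma0 \<xi>) = bzero \<xi>"
  "vscale (Gamma0 \<xi>) = (\<lambda>c f t. c \<odot> f t)"
  by (simp_all add: Gamma0_def)

lemma SN_def: "SN f = (SUP t. N (f t))"
  by (simp add: Gamma0_def)

text \<open>Upper semicontinuity makes the superlevel sets closed, so it suffices to place them in
  compact sets. In this form vanishing at infinity passes to sums and combinations without further
  closedness arguments.\<close>

lemma mem_G_iff:
  "f \<in> G \<longleftrightarrow> selection f \<and> continuous_on UNIV f \<and>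
     (\<forall>\<epsilon>>0. \<exists>K. compact K \<and> (\<forall>t. t \<notin> K \<longrightarrow> N (f t) < \<epsilon>))"
proof -
  have "(\<forall>\<epsilon>>0. compact {t. \<epsilon> \<le> N (f t)}) \<longleftrightarrow>
      (\<forall>\<epsilon>>0. \<exists>K. compact K \<and> (\<forall>t. t \<notin> K \<longrightarrow> N (f t) < \<epsilon>))" if f: "continuous_on UNIV f"
  proof (intro iffI allI impI)
    fix \<epsilon> :: real assume "\<epsilon> > 0" "\<forall>\<epsilon>>0. compact {t. \<epsilon> \<le> N (f t)}"
    then show "\<exists>K. compact K \<and> (\<forall>t. t \<notin> K \<longrightarrow> N (f t) < \<epsilon>)"
      by (intro exI[of _ "{t. \<epsilon> \<le> N (f t)}"]) auto
  next
    fix \<epsilon> :: real assume "\<epsilon> > 0" "\<forall>\<epsilon>>0. \<exists>K. compact K \<and> (\<forall>t. t \<notin> K \<longrightarrow> N (f t) < \<epsilon>)"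
    then obtain K where K: "compact K" "\<And>t. t \<notin> K \<Longrightarrow> N (f t) < \<epsilon>" by blast
    have "{t. \<epsilon> \<le> N (f t)} = - {t. N (f t) < \<epsilon>}" by auto
    then have "closed {t. \<epsilon> \<le> N (f t)}" using open_N_less[OF f, of \<epsilon>] by (simp add: closed_def)
    moreover have "{t. \<epsilon> \<le> N (f t)} = {t. \<epsilon> \<le> N (f t)} \<inter> K" using K(2) by force
    ultimately show "compact {t. \<epsilon> \<le> N (f t)}" using K(1) by (metis closed_Int_compact)
  qed
  then show ?thesis
    by (auto simp: Gamma0_def is_section_def vanishes_at_infinity_def selection_def)
qed

lemma G_selection: "f \<in> G \<Longrightarrow> selection f"
  and G_continuous: "f \<in> G \<Longrightarrow> continuous_on UNIV f"
  by (simp_all add: mem_G_iff)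

lemma G_p [simp]: "f \<in> G \<Longrightarrow> p (f t) = t"
  by (simp add: G_selection)

lemma G_small_outside_compact:
  assumes "f \<in> G" "\<epsilon> > 0"
  obtains K where "compact K" "\<forall>t. t \<notin> K \<longrightarrow> N (f t) < \<epsilon>"
  using assms unfolding mem_G_iff by blast

lemma continuous_of_osc_less:
  assumes "selection f" "\<And>\<delta> t. \<delta> > 0 \<Longrightarrow> osc_less \<delta> f t"
  shows "continuous_on UNIV f"
  using continuous_at_of_osc_less[OF assms] by (simp add: continuous_at_imp_continuous_on)

lemma selection_zero: "selection (bzero \<xi>)"
  by (simp add: selection_def)

text \<open>Continuity of the zero section is not an axiom. It is the case of oscillation 0,
  witnessed by the open sets of points of norm below \<open>\<delta>\<close>.\<close>

lemma G_zero: "bzero \<xi> \<in> G"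
  unfolding mem_G_iff
  by (auto intro!: selection_zero continuous_of_osc_less osc_less_zero exI[of _ "{}"])

lemma G_add:
  assumes f: "f \<in> G" and g: "g \<in> G" shows "(\<lambda>t. f t \<oplus> g t) \<in> G"
  unfolding mem_G_iff
proof (intro conjI allI impI)
  show "selection (\<lambda>t. f t \<oplus> g t)" using f g by (simp add: selection_def)
  show "continuous_on UNIV (\<lambda>t. f t \<oplus> g t)"
    using f g by (intro cont_add_comp G_continuous) auto
  fix \<epsilon> :: real assume \<epsilon>: "\<epsilon> > 0"
  then have \<epsilon>2: "\<epsilon> / 2 > 0" by simp
  obtain K where K: "compact K" "\<forall>t. t \<notin> K \<longrightarrow> N (f t) < \<epsilon> / 2" by (rule G_small_outside_compact[OF f \<epsilon>2])
  obtain K' where K': "compact K'" "\<forall>t. t \<notin> K' \<longrightarrow> N (g t) < \<epsilon> / 2" by (rule G_small_outside_compact[OF g \<epsilon>2])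
  have "N (f t \<oplus> g t) < \<epsilon>" if "t \<notin> K \<union> K'" for t
  proof -
    have "N (f t) < \<epsilon> / 2" "N (g t) < \<epsilon> / 2" using that K(2) K'(2) by auto
    moreover have "N (f t \<oplus> g t) \<le> N (f t) + N (g t)" by (rule N_add) (use f g in auto)
    ultimately show ?thesis by linarith
  qed
  then show "\<exists>K. compact K \<and> (\<forall>t. t \<notin> K \<longrightarrow> N (f t \<oplus> g t) < \<epsilon>)"
    using compact_Un[OF K(1) K'(1)] by blast
qed

lemma G_scale:
  assumes f: "f \<in> G" shows "(\<lambda>t. c \<odot> f t) \<in> G"
  unfolding mem_G_iff
proof (intro conjI allI impI)
  show "selection (\<lambda>t. c \<odot> f t)" using f by (simp add: selection_def)
  show "continuous_on UNIV (\<lambda>t. c \<odot> f t)"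
    using f by (intro cont_scale_comp G_continuous continuous_intros)
  fix \<epsilon> :: real assume \<epsilon>: "\<epsilon> > 0"
  have c: "norm c + 1 > 0" by (simp add: add_nonneg_pos)
  obtain K where K: "compact K" "\<forall>t. t \<notin> K \<longrightarrow> N (f t) < \<epsilon> / (norm c + 1)"
    by (rule G_small_outside_compact[OF f, of "\<epsilon> / (norm c + 1)"]) (use \<epsilon> c in auto)
  have "N (c \<odot> f t) < \<epsilon>" if "t \<notin> K" for t
  proof -
    have "N (f t) < \<epsilon> / (norm c + 1)" using that K(2) by blast
    then have "(norm c + 1) * N (f t) < \<epsilon>" using c by (simp add: less_divide_eq mult.commute)
    moreover have "norm c * N (f t) \<le> (norm c + 1) * N (f t)" by (rule mult_right_mono) auto
    ultimately show ?thesis unfolding N_scale by linarith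
  qed
  then show "\<exists>K. compact K \<and> (\<forall>t. t \<notin> K \<longrightarrow> N (c \<odot> f t) < \<epsilon>)" using K(1) by blast
qed

lemma G_bmix:
  assumes f: "f \<in> G" and g: "g \<in> G" and \<phi>: "continuous_on UNIV \<phi>" "\<forall>s. 0 \<le> \<phi> s \<and> \<phi> s \<le> 1"
  shows "(\<lambda>t. bmix (\<phi> t) (f t) (g t)) \<in> G"
  unfolding mem_G_iff
proof (intro conjI allI impI)
  show "selection (\<lambda>t. bmix (\<phi> t) (f t) (g t))" using f g by (simp add: selection_def)
  show "continuous_on UNIV (\<lambda>t. bmix (\<phi> t) (f t) (g t))"
    using f g by (intro cont_bmix_comp G_continuous \<phi>(1)) auto
  fix \<epsilon> :: real assume \<epsilon>: "\<epsilon> > 0"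
  obtain K where K: "compact K" "\<forall>t. t \<notin> K \<longrightarrow> N (f t) < \<epsilon>" by (rule G_small_outside_compact[OF f \<epsilon>])
  obtain K' where K': "compact K'" "\<forall>t. t \<notin> K' \<longrightarrow> N (g t) < \<epsilon>" by (rule G_small_outside_compact[OF g \<epsilon>])
  have "N (bmix (\<phi> t) (f t) (g t)) < \<epsilon>" if "t \<notin> K \<union> K'" for t
  proof -
    have "N (bmix (\<phi> t) (f t) (g t)) \<le> \<phi> t * N (f t) + (1 - \<phi> t) * N (g t)"
      by (rule N_bmix) (use f g \<phi> in auto)
    also have "\<dots> < \<epsilon>" by (rule convex_less) (use that K(2) K'(2) \<phi>(2) in auto)
    finally show ?thesis .
  qed
  then show "\<exists>K. compact K \<and> (\<forall>t. t \<notin> K \<longrightarrow> N (bmix (\<phi> t) (f t) (g t)) < \<epsilon>)"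
    using compact_Un[OF K(1) K'(1)] by blast
qed

text \<open>An upper semicontinuous function is bounded above on a compact set, since the open sets
  \<open>N (f t) < k\<close> cover it. The sum over a finite subcover bounds all its indices, also
  when it is empty.\<close>

lemma G_bounded:
  assumes f: "f \<in> G" shows "bdd_above (range (\<lambda>t. N (f t)))"
proof -
  obtain K where K: "compact K" "\<forall>t. t \<notin> K \<longrightarrow> N (f t) < 1" by (rule G_small_outside_compact[OF f zero_less_one])
  have op: "open {t. N (f t) < real k}" for k by (rule open_N_less[OF G_continuous[OF f]])
  have "K \<subseteq> (\<Union>k\<in>UNIV. {t. N (f t) < real k})" by (auto intro: reals_Archimedean2)
  then obtain S where S: "finite S" "K \<subseteq> (\<Union>k\<in>S. {t. N (f t) < real k})"
    using compactE_image[OF K(1), of UNIV "\<lambda>k. {t. N (f t) < real k}"] op by metis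
  have "N (f t) \<le> 1 + (\<Sum>k\<in>S. real k)" for t
  proof (cases "t \<in> K")
    case True
    then obtain k where k: "k \<in> S" "N (f t) < real k" using S by auto
    then have "real k \<le> (\<Sum>k\<in>S. real k)" using member_le_sum[of k S real] S by simp
    with k show ?thesis by simp
  next
    case False
    then have "N (f t) < 1" using K by blast
    moreover have "0 \<le> (\<Sum>k\<in>S. real k)" by (simp add: sum_nonneg)
    ultimately show ?thesis by linarith
  qed
  then show ?thesis by (rule bdd_aboveI2)
qed

lemma N_le_SN: "f \<in> G \<Longrightarrow> N (f t) \<le> SN f"
  unfolding SN_def by (rule cSUP_upper) (auto intro: G_bounded)

lemma SN_le: "(\<And>t. N (f t) \<le> B) \<Longrightarrow> SN f \<le> B"
  unfolding SN_def by (rule cSUP_least) auto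

lemma SN_scale:
  assumes f: "f \<in> G" shows "SN (\<lambda>t. c \<odot> f t) = norm c * SN f"
proof (rule antisym)
  show "SN (\<lambda>t. c \<odot> f t) \<le> norm c * SN f"
    by (rule SN_le) (simp add: N_scale mult_left_mono N_le_SN[OF f])
  show "norm c * SN f \<le> SN (\<lambda>t. c \<odot> f t)"
  proof (cases "c = 0")
    case True
    then show ?thesis
      using order_trans[OF N_ge_0 N_le_SN[OF G_scale[OF f, of c]]] by simp
  next
    case False
    have "SN f \<le> SN (\<lambda>t. c \<odot> f t) / norm c"
    proof (rule SN_le)
      fix t
      show "N (f t) \<le> SN (\<lambda>t. c \<odot> f t) / norm c"
        using N_le_SN[OF G_scale[OF f, of c], of t] False by (simp add: N_scale field_simps)
    qed
    then show ?thesis using False by (simp add: field_simps)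
  qed
qed

lemma knorm_Gamma0: "knorm (Gamma0 \<xi>)"
proof
  show "vector_space_axioms_on (Gamma0 \<xi>)"
    unfolding vector_space_axioms_on_def Gamma0_simps
  proof (intro conjI ballI allI ext)
    fix f assume f: "f \<in> G"
    show "\<exists>g\<in>G. (\<lambda>t. f t \<oplus> g t) = bzero \<xi>"
      by (rule bexI[of _ "\<lambda>t. - 1 \<odot> f t"]) (use f G_scale[OF f, of "- 1"] in auto)
    fix c e t
    show "(c + e) \<odot> f t = c \<odot> f t \<oplus> e \<odot> f t"
      using kspace.add_scale[OF kspace_fiber, of "f t" t] f by simp
    show "(c * e) \<odot> f t = c \<odot> e \<odot> f t"
      using kspace.scale_scale[OF kspace_fiber, of "f t" t] f by simp
    show "bzero \<xi> t \<oplus> f t = f t"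
      using kspace.zero_add[OF kspace_fiber, of "f t" t] f by simp
    fix g assume g: "g \<in> G"
    show "f t \<oplus> g t = g t \<oplus> f t"
      using kspace.add_commute[OF kspace_fiber, of "f t" t "g t"] f g by simp
    show "c \<odot> (f t \<oplus> g t) = c \<odot> f t \<oplus> c \<odot> g t"
      using kspace.scale_add[OF kspace_fiber, of "f t" t "g t"] f g by simp
    fix h assume h: "h \<in> G"
    show "f t \<oplus> g t \<oplus> h t = f t \<oplus> (g t \<oplus> h t)"
      using kspace.add_assoc[OF kspace_fiber, of "f t" t "g t" "h t"] f g h by simp
  qed (simp_all add: G_zero G_add G_scale)
  show "norm_axioms_on (Gamma0 \<xi>)"
    unfolding norm_axioms_on_def Gamma0_simps
  proof (intro conjI ballI allI)
    fix f assume f: "f \<in> G"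
    show nonneg: "0 \<le> SN f" using order_trans[OF N_ge_0 N_le_SN[OF f]] .
    show "SN f = 0 \<longleftrightarrow> f = bzero \<xi>"
    proof
      assume "SN f = 0"
      then have N0: "N (f t) = 0" for t using N_le_SN[OF f, of t] N_ge_0[of "f t"] by linarith
      show "f = bzero \<xi>"
      proof
        fix t show "f t = bzero \<xi> t"
          using knorm.n_eq_0_iff[OF knorm_fiber, of "f t" t] N0 f by simp
      qed
    next
      assume "f = bzero \<xi>"
      then have "SN f \<le> 0" by (intro SN_le) simp
      with nonneg show "SN f = 0" by simp
    qed
    show "SN (\<lambda>t. c \<odot> f t) = norm c * SN f" for c by (rule SN_scale[OF f])
    fix g assume g: "g \<in> G"
    show "SN (\<lambda>t. f t \<oplus> g t) \<le> SN f + SN g"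
    proof (rule SN_le)
      fix t
      have "N (f t \<oplus> g t) \<le> N (f t) + N (g t)" by (rule N_add) (use f g in auto)
      then show "N (f t \<oplus> g t) \<le> SN f + SN g" using N_le_SN[OF f, of t] N_le_SN[OF g, of t] by linarith
    qed
  qed
qed

lemma osc_le_of_osc_less: "osc_less \<epsilon> f t \<Longrightarrow> osc_le \<epsilon> f t"
  unfolding osc_le_def osc_less_def by (meson less_trans)

end

section \<open>Existence of sections\<close>

context lc_bundle
begin

context
  fixes F
  assumes sub: "banach_subbundle \<xi> F"
begin

lemma F_fiber_closed: "closed_subspace (fiber \<xi> t) (p -` {t} \<inter> F)"
  using sub by (simp add: banach_subbundle_def)

lemma F_zero: "bzero \<xi> t \<in> F"
  and F_add: "x \<in> F \<Longrightarrow> y \<in> F \<Longrightarrow> p x = p y \<Longrightarrow> x \<oplus> y \<in> F"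
  and F_scale: "x \<in> F \<Longrightarrow> c \<odot> x \<in> F"
  using F_fiber_closed[of t] F_fiber_closed[of "p x"] unfolding closed_subspace_def by auto

lemma F_bmix: "x \<in> F \<Longrightarrow> y \<in> F \<Longrightarrow> p x = p y \<Longrightarrow> bmix r x y \<in> F"
  unfolding bmix_def by (intro F_add F_scale) auto

lemma F_closed:
  assumes "\<And>e. e > 0 \<Longrightarrow> \<exists>y\<in>F. p y = p x \<and> d x y < e"
  shows "x \<in> F"
proof -
  have "\<forall>e>0. \<exists>y\<in>p -` {p x} \<inter> F. d x y < e" using assms by blast
  then show ?thesis
    using F_fiber_closed[of "p x"] knorm.closedin_iff[OF knorm_fiber, of "p x" "p -` {p x} \<inter> F"]
    unfolding closed_subspace_def by auto
qed

lemma open_image_F: assumes "open W" shows "open (p ` (W \<inter> F))"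
proof -
  have "openin (top_of_set F) (F \<inter> W)" using assms by (rule openin_open_Int)
  then have "openin euclidean (p ` (F \<inter> W))"
    using sub unfolding banach_subbundle_def open_map_def by blast
  then show ?thesis by (simp add: Int_commute)
qed

text \<open>Continuity is left out on purpose; it is gained only in a limit. Compact support
  survives combinations and makes uniform limits vanish at infinity.\<close>

definition cs_selections :: "('t \<Rightarrow> 'e) set" where
  "cs_selections = {f. selection f \<and> (\<forall>t. f t \<in> F) \<and> (\<exists>K. compact K \<and> (\<forall>t. t \<notin> K \<longrightarrow> f t = bzero \<xi> t))}"

lemma cs_zero: "bzero \<xi> \<in> cs_selections"
  using F_zero by (auto simp: cs_selections_def selection_zero intro: exI[of _ "{}"])

lemma cs_selection: "f \<in> cs_selections \<Longrightarrow> selection f"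
  and cs_F: "f \<in> cs_selections \<Longrightarrow> f t \<in> F"
  by (simp_all add: cs_selections_def)

lemma cs_bmix:
  assumes f: "f \<in> cs_selections" and g: "g \<in> cs_selections"
  shows "(\<lambda>s. bmix (\<phi> s) (f s) (g s)) \<in> cs_selections"
proof -
  obtain K K' where "compact K" "\<forall>t. t \<notin> K \<longrightarrow> f t = bzero \<xi> t"
    and "compact K'" "\<forall>t. t \<notin> K' \<longrightarrow> g t = bzero \<xi> t"
    using f g unfolding cs_selections_def by blast
  then have "compact (K \<union> K')" "\<forall>t. t \<notin> K \<union> K' \<longrightarrow> bmix (\<phi> t) (f t) (g t) = bzero \<xi> t"
    by (auto intro: compact_Un)
  moreover have "selection (\<lambda>s. bmix (\<phi> s) (f s) (g s))"
    using cs_selection[OF f] cs_selection[OF g] by (simp add: selection_def)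
  moreover have "bmix (\<phi> s) (f s) (g s) \<in> F" for s
    by (rule F_bmix) (use cs_F f g cs_selection[OF f] cs_selection[OF g] in auto)
  ultimately show ?thesis unfolding cs_selections_def by blast
qed

text \<open>Any two points of one fiber in the small open set \<open>U0\<close> are
  \<open>\<epsilon>\<close>-close, so every choice of points of \<open>U0 \<inter> F\<close> has
  oscillation at most \<open>\<epsilon>\<close> over the base points where a choice exists. Openness
  of \<open>p\<close> on \<open>F\<close> makes these an open set; elsewhere the selection is
  0.\<close>

lemma local_selection:
  assumes e: "e \<in> F" and \<epsilon>: "\<epsilon> > 0" and W: "open W" "e \<in> W"
  obtains g H where "g \<in> cs_selections" "g (p e) = e" "open H" "p e \<in> H"
    "\<forall>s\<in>H. osc_le \<epsilon> g s \<and> g s \<in> W"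
proof -
  obtain U U' where U: "open U" "open U'" "e \<in> U" "e \<in> U'" "\<forall>u\<in>U. \<forall>v\<in>U'. p u = p v \<longrightarrow> d u v < \<epsilon>"
    by (rule nbhds_d_less[of e e \<epsilon>]) (use \<epsilon> in auto)
  define U0 where "U0 = U \<inter> U' \<inter> W"
  have U0: "open U0" "e \<in> U0" "\<And>u v. u \<in> U0 \<Longrightarrow> v \<in> U0 \<Longrightarrow> p u = p v \<Longrightarrow> d u v < \<epsilon>"
    using U W by (auto simp: U0_def)
  obtain H0 K where H0: "open H0" "compact K" "p e \<in> H0" "H0 \<subseteq> K" by (rule compact_nbhd)
  define H where "H = H0 \<inter> p ` (U0 \<inter> F)"
  have H: "open H" "p e \<in> H" using H0 U0 e open_image_F[OF U0(1)] by (auto simp: H_def)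
  have "\<exists>x. x \<in> U0 \<and> x \<in> F \<and> p x = s" if "s \<in> H" for s using that by (auto simp: H_def)
  then obtain c where c: "\<And>s. s \<in> H \<Longrightarrow> c s \<in> U0 \<and> c s \<in> F \<and> p (c s) = s" by metis
  define g where "g s = (if s = p e then e else if s \<in> H then c s else bzero \<xi> s)" for s
  have g: "g s \<in> U0" "g s \<in> F" "p (g s) = s" if "s \<in> H" for s
    using c[OF that] U0 e by (auto simp: g_def that)
  have out: "g s = bzero \<xi> s" if "s \<notin> H" for s using that H(2) by (auto simp: g_def)
  have "selection g" unfolding selection_def
  proof
    fix s show "p (g s) = s" using g(3) out by (cases "s \<in> H") auto
  qed
  moreover have "g s \<in> F" for s using g(2) out F_zero by (cases "s \<in> H") auto
  moreover have "\<forall>t. t \<notin> K \<longrightarrow> g t = bzero \<xi> t" using out H0(4) by (auto simp: H_def)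
  ultimately have "g \<in> cs_selections" using H0(2) unfolding cs_selections_def by blast
  moreover have "g (p e) = e" by (simp add: g_def)
  moreover have "osc_le \<epsilon> g s \<and> g s \<in> W" if s: "s \<in> H" for s
  proof
    show "g s \<in> W" using g(1)[OF s] by (simp add: U0_def)
    have "osc_less \<epsilon> g s"
      unfolding osc_less_def
    proof (intro exI[of _ "U0 \<inter> p -` H"] conjI ballI)
      show "open (U0 \<inter> p -` H)" using U0 H open_vimage_p by auto
      show "s \<in> p ` (U0 \<inter> p -` H)" by (rule image_eqI[of _ _ "g s"]) (use g s in auto)
      fix x assume "x \<in> U0 \<inter> p -` H"
      then show "d x (g (p x)) < \<epsilon>" using U0(3) g by auto
    qed
    then show "osc_le \<epsilon> g s" by (rule osc_le_of_osc_less)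
  qed
  ultimately show ?thesis using that H by blast
qed

text \<open>The prescribed value at \<open>p e\<close> is made part of the glued property; it
  survives because a convex combination of \<open>e\<close> with itself is \<open>e\<close>. Away
  from \<open>p e\<close> the zero selection will do.\<close>

lemma ex_selection_through:
  assumes e: "e \<in> F" and \<epsilon>: "\<epsilon> > 0"
  shows "\<exists>f\<in>cs_selections. f (p e) = e \<and> (\<forall>t. osc_le \<epsilon> f t)"
proof -
  have "\<exists>f\<in>cs_selections. \<forall>t. osc_le \<epsilon> f t \<and> (t = p e \<longrightarrow> f t = e)"
  proof (rule glue[where K = "{p e}" and ?f0.0 = "bzero \<xi>"])
    show "(\<lambda>s. bmix (\<phi> s) (f s) (g s)) \<in> cs_selections" if "f \<in> cs_selections" "g \<in> cs_selections" for f g \<phi>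
      using that by (rule cs_bmix)
    show "osc_le \<epsilon> (\<lambda>s. bmix (\<phi> s) (f s) (g s)) t \<and> (t = p e \<longrightarrow> bmix (\<phi> t) (f t) (g t) = e)"
      if "f \<in> cs_selections" "g \<in> cs_selections" "continuous_on UNIV \<phi>" "\<forall>s. 0 \<le> \<phi> s \<and> \<phi> s \<le> 1"
        "osc_le \<epsilon> f t \<and> (t = p e \<longrightarrow> f t = e)" "osc_le \<epsilon> g t \<and> (t = p e \<longrightarrow> g t = e)" for f g \<phi> t
      using that by (auto intro!: osc_le_bmix cs_selection)
    show "osc_le \<epsilon> g t \<and> (t = p e \<longrightarrow> g t = e)"
      if "open H" "t \<in> H" "\<forall>s\<in>H. f s = g s" "osc_le \<epsilon> f t \<and> (t = p e \<longrightarrow> f t = e)" for f g H t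
      using osc_le_cong[of \<epsilon> f t H g] that by auto
    show "\<exists>f\<in>cs_selections. \<exists>H. open H \<and> t \<in> H \<and> (\<forall>s\<in>H. osc_le \<epsilon> f s \<and> (s = p e \<longrightarrow> f s = e))"
      if "t \<in> {p e}" for t
    proof -
      obtain g H where "g \<in> cs_selections" "g (p e) = e" "open H" "p e \<in> H"
        "\<forall>s\<in>H. osc_le \<epsilon> g s \<and> g s \<in> UNIV"
        by (rule local_selection[OF e \<epsilon> open_UNIV UNIV_I])
      with that show ?thesis by blast
    qed
  qed (use \<epsilon> cs_zero cs_selection osc_le_zero in auto)
  then show ?thesis by blast
qed

text \<open>Near a point of the support, a finer local selection through the value of
  \<open>h\<close> stays close to \<open>h\<close> because the oscillation of \<open>h\<close> is
  small. Outside the support 0 is good. The result replaces \<open>h\<close>; nothing but its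
  distance to \<open>h\<close> is kept under control.\<close>

lemma refine_selection:
  assumes h: "h \<in> cs_selections" "\<And>t. osc_le \<epsilon> h t" and \<epsilon>: "\<epsilon> > 0" "\<epsilon>' > 0"
  shows "\<exists>f\<in>cs_selections. \<forall>t. osc_le \<epsilon>' f t \<and> d (f t) (h t) \<le> 3 * \<epsilon>"
proof -
  obtain K where K: "compact K" "\<forall>t. t \<notin> K \<longrightarrow> h t = bzero \<xi> t"
    using h(1) unfolding cs_selections_def by blast
  have hs: "selection h" by (rule cs_selection[OF h(1)])
  show ?thesis
  proof (rule glue[where K = K and ?f0.0 = "bzero \<xi>"])
    show "(\<lambda>s. bmix (\<phi> s) (f s) (g s)) \<in> cs_selections" if "f \<in> cs_selections" "g \<in> cs_selections" for f g \<phi>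
      using that by (rule cs_bmix)
    show "osc_le \<epsilon>' (\<lambda>s. bmix (\<phi> s) (f s) (g s)) t \<and> d (bmix (\<phi> t) (f t) (g t)) (h t) \<le> 3 * \<epsilon>"
      if f: "f \<in> cs_selections" and g: "g \<in> cs_selections" and \<phi>: "continuous_on UNIV \<phi>" "\<forall>s. 0 \<le> \<phi> s \<and> \<phi> s \<le> 1"
        and Q: "osc_le \<epsilon>' f t \<and> d (f t) (h t) \<le> 3 * \<epsilon>" "osc_le \<epsilon>' g t \<and> d (g t) (h t) \<le> 3 * \<epsilon>" for f g \<phi> t
    proof
      show "osc_le \<epsilon>' (\<lambda>s. bmix (\<phi> s) (f s) (g s)) t"
        by (rule osc_le_bmix) (use f g \<phi> Q cs_selection in auto)
      have "d (bmix (\<phi> t) (f t) (g t)) (h t) \<le> \<phi> t * d (f t) (h t) + (1 - \<phi> t) * d (g t) (h t)"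
        by (rule d_bmix_right) (use \<phi> hs cs_selection[OF f] cs_selection[OF g] in auto)
      also have "\<dots> \<le> 3 * \<epsilon>" by (rule convex_bound_le) (use Q \<phi> in auto)
      finally show "d (bmix (\<phi> t) (f t) (g t)) (h t) \<le> 3 * \<epsilon>" .
    qed
    show "osc_le \<epsilon>' g t \<and> d (g t) (h t) \<le> 3 * \<epsilon>"
      if "open H" "t \<in> H" "\<forall>s\<in>H. f s = g s" "osc_le \<epsilon>' f t \<and> d (f t) (h t) \<le> 3 * \<epsilon>" for f g H t
      using osc_le_cong[of \<epsilon>' f t H g] that by auto
    show "\<exists>f\<in>cs_selections. \<exists>H. open H \<and> t \<in> H \<and> (\<forall>s\<in>H. osc_le \<epsilon>' f s \<and> d (f s) (h s) \<le> 3 * \<epsilon>)"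
      if "t \<in> K" for t
    proof -
      \<comment> \<open>Any factor above 1 is admissible here. The path from \<open>g s\<close> to
        \<open>h s\<close> through a point \<open>x\<close> of the witness has two legs below this
        bound, whence the factor 3.\<close>
      have "\<epsilon> < 3 * \<epsilon> / 2" using \<epsilon> by simp
      then have "osc_less (3 * \<epsilon> / 2) h t" using h(2)[of t] unfolding osc_le_def by blast
      then obtain U1 where U1: "open U1" "t \<in> p ` U1" "\<forall>x\<in>U1. d x (h (p x)) < 3 * \<epsilon> / 2"
        unfolding osc_less_def by blast
      then obtain x0 where x0: "x0 \<in> U1" "p x0 = t" by auto
      obtain U2 U3 where U2: "open U2" "open U3" "x0 \<in> U2" "h t \<in> U3"
        "\<forall>u\<in>U2. \<forall>v\<in>U3. p u = p v \<longrightarrow> d u v < 3 * \<epsilon> / 2"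
        by (rule nbhds_d_less[of x0 "h t" "3 * \<epsilon> / 2"]) (use x0 U1 hs in auto)
      obtain g H where g: "g \<in> cs_selections" and H: "open H" "p (h t) \<in> H"
        "\<forall>s\<in>H. osc_le \<epsilon>' g s \<and> g s \<in> U3"
        by (rule local_selection[OF cs_F[OF h(1)] \<epsilon>(2) U2(2,4)])
      let ?H = "H \<inter> p ` (U1 \<inter> U2)"
      have "t \<in> p ` (U1 \<inter> U2)" by (rule image_eqI[of _ _ x0]) (use x0 U2 in auto)
      then have "open ?H" "t \<in> ?H" using H U1 U2 hs by (auto intro!: open_Int open_image_p)
      moreover have "d (g s) (h s) \<le> 3 * \<epsilon>" if s: "s \<in> ?H" for s
      proof -
        obtain x where x: "x \<in> U1" "x \<in> U2" "p x = s" using s by auto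
        have gs: "p (g s) = s" using cs_selection[OF g] by simp
        have "d (g s) (h s) \<le> d (g s) x + d x (h s)" by (rule d_triangle) (use x gs hs in auto)
        moreover have "d (g s) x = d x (g s)" by (rule d_commute) (use x gs in auto)
        moreover have "d x (g s) < 3 * \<epsilon> / 2" using U2(5) x s H(3) gs by auto
        moreover have "d x (h s) < 3 * \<epsilon> / 2" using U1(3) x by auto
        ultimately show ?thesis by linarith
      qed
      ultimately show ?thesis using g H(3) by blast
    qed
    show "osc_le \<epsilon>' (bzero \<xi>) t \<and> d (bzero \<xi> t) (h t) \<le> 3 * \<epsilon>" if "t \<notin> K" for t
      using K(2)[rule_format, OF that] \<epsilon> osc_le_zero[of \<epsilon>' t] by simp
  qed (fact K cs_zero cs_selection)+
qed

text \<open>Selections of oscillation \<open>\<epsilon> / 2 ^ k\<close> with summable distances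
  converge uniformly; the oscillation of the limit is 0, so it is continuous. Completeness of the
  fibers gives the pointwise limits, and closedness of the fibers of \<open>F\<close> keeps them in
  \<open>F\<close>. Refinement moves the value over \<open>p e\<close>, so \<open>e\<close> is only
  approximated.\<close>

theorem ex_section_near:
  assumes e: "e \<in> F" and \<delta>: "\<delta> > 0"
  obtains f where "f \<in> Gamma0_sub \<xi> F" "d (f (p e)) e < \<delta>"
proof -
  \<comment> \<open>The steps \<open>3 * \<epsilon> / 2 ^ k\<close> add up to
    \<open>6 * \<epsilon>\<close>, which must be below \<open>\<delta>\<close>. The same 7 reappears
    below as 6 for the distance to the limit plus 1 for the oscillation.\<close>
  define \<epsilon> where "\<epsilon> = \<delta> / 7"
  have \<epsilon>: "\<epsilon> > 0" using \<delta> by (simp add: \<epsilon>_def)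
  have pos: "\<epsilon> / 2 ^ k > 0" for k :: nat using \<epsilon> by simp
  have "\<exists>f. \<forall>k. (f k \<in> cs_selections \<and> (\<forall>t. osc_le (\<epsilon> / 2 ^ k) (f k) t) \<and> (k = 0 \<longrightarrow> f k (p e) = e)) \<and>
      (\<forall>t. d (f (Suc k) t) (f k t) \<le> 3 * (\<epsilon> / 2 ^ k))"
  proof (rule dependent_nat_choice)
    show "\<exists>f. f \<in> cs_selections \<and> (\<forall>t. osc_le (\<epsilon> / 2 ^ 0) f t) \<and> (0 = (0::nat) \<longrightarrow> f (p e) = e)"
      using ex_selection_through[OF e \<epsilon>] by auto
  next
    fix h and k :: nat
    assume "h \<in> cs_selections \<and> (\<forall>t. osc_le (\<epsilon> / 2 ^ k) h t) \<and> (k = 0 \<longrightarrow> h (p e) = e)"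
    then show "\<exists>f. (f \<in> cs_selections \<and> (\<forall>t. osc_le (\<epsilon> / 2 ^ Suc k) f t) \<and> (Suc k = 0 \<longrightarrow> f (p e) = e)) \<and>
        (\<forall>t. d (f t) (h t) \<le> 3 * (\<epsilon> / 2 ^ k))"
      using refine_selection[of h "\<epsilon> / 2 ^ k" "\<epsilon> / 2 ^ Suc k"] pos by blast
  qed
  then obtain f where
    ff: "\<forall>k. (f k \<in> cs_selections \<and> (\<forall>t. osc_le (\<epsilon> / 2 ^ k) (f k) t) \<and> (k = 0 \<longrightarrow> f k (p e) = e)) \<and>
      (\<forall>t. d (f (Suc k) t) (f k t) \<le> 3 * (\<epsilon> / 2 ^ k))" ..
  have f: "f k \<in> cs_selections" "osc_le (\<epsilon> / 2 ^ k) (f k) t" "f 0 (p e) = e" for k t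
    using ff[rule_format, of k] ff[rule_format, of 0] by simp_all
  have step: "d (f (Suc k) t) (f k t) \<le> (3 * \<epsilon>) / 2 ^ k" for k t
    using ff[rule_format, of k] by simp
  have fs: "p (f k t) = t" for k t using cs_selection[OF f(1)] by simp
  have "\<exists>x. p x = t \<and> (\<forall>k. d x (f k t) \<le> 2 * (3 * \<epsilon>) / 2 ^ k)" for t
  proof -
    obtain x where "x \<in> vcarrier (fiber \<xi> t)" "\<And>k. d x (f k t) \<le> 2 * (3 * \<epsilon>) / 2 ^ k"
      using knorm.limit_of_geometric[OF knorm_fiber, of t "\<lambda>k. f k t" "3 * \<epsilon>"] complete_fiber[of t] fs step
      by auto
    then show ?thesis by auto
  qed
  then obtain g where g: "\<And>t. p (g t) = t" "\<And>t k. d (g t) (f k t) \<le> 2 * (3 * \<epsilon>) / 2 ^ k" by metis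
  have gs: "selection g" using g(1) by (simp add: selection_def)
  have small: "\<exists>k. 7 * \<epsilon> / 2 ^ k < \<eta>" if "\<eta> > 0" for \<eta>
  proof -
    have "(\<lambda>k. 7 * \<epsilon> / 2 ^ k) \<longlonglongrightarrow> 0" by (rule LIMSEQ_divide_realpow_zero) simp
    from order_tendstoD(2)[OF this that] show ?thesis unfolding eventually_sequentially by blast
  qed
  have split: "7 * \<epsilon> / 2 ^ k = \<epsilon> / 2 ^ k + 2 * (3 * \<epsilon>) / 2 ^ k" for k :: nat
    by (simp add: field_simps)
  have near: "\<exists>k. \<forall>t. d (g t) (f k t) < \<eta>" if \<eta>: "\<eta> > 0" for \<eta>
  proof -
    obtain k where k: "7 * \<epsilon> / 2 ^ k < \<eta>" using small[OF \<eta>] by blast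
    have "d (g t) (f k t) < \<eta>" for t using g(2)[of t k] split[of k] pos[of k] k by linarith
    then show ?thesis by blast
  qed
  have "g t \<in> F" for t
  proof (rule F_closed)
    fix \<eta> :: real assume "\<eta> > 0"
    then obtain k where "\<forall>t. d (g t) (f k t) < \<eta>" using near by blast
    then show "\<exists>y\<in>F. p y = p (g t) \<and> d (g t) y < \<eta>"
      using cs_F[OF f(1)] fs g(1) by (intro bexI[of _ "f k t"]) auto
  qed
  moreover have "g \<in> G"
    unfolding mem_G_iff
  proof (intro conjI allI impI)
    show "continuous_on UNIV g"
    proof (rule continuous_of_osc_less[OF gs])
      fix \<eta> :: real and t assume \<eta>: "\<eta> > 0"
      obtain k where k: "7 * \<epsilon> / 2 ^ k < \<eta>" using small[OF \<eta>] by blast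
      have "\<epsilon> / 2 ^ k < \<eta> - 2 * (3 * \<epsilon>) / 2 ^ k" using k split[of k] by linarith
      then have "osc_less (\<eta> - 2 * (3 * \<epsilon>) / 2 ^ k) (f k) t"
        using f(2)[of k t] unfolding osc_le_def by blast
      moreover have "d (f k s) (g s) \<le> 2 * (3 * \<epsilon>) / 2 ^ k" for s
        using g(2)[of s k] d_commute[of "f k s" "g s"] fs g(1) by simp
      ultimately have "osc_less (\<eta> - 2 * (3 * \<epsilon>) / 2 ^ k + 2 * (3 * \<epsilon>) / 2 ^ k) g t"
        by (rule osc_less_perturb[OF _ cs_selection[OF f(1)] gs])
      then show "osc_less \<eta> g t" by simp
    qed
  next
    fix \<eta> :: real assume "\<eta> > 0"
    then obtain k where k: "\<forall>t. d (g t) (f k t) < \<eta>" using near by blast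
    obtain K where K: "compact K" "\<forall>t. t \<notin> K \<longrightarrow> f k t = bzero \<xi> t"
      using f(1)[of k] unfolding cs_selections_def by blast
    have "N (g t) < \<eta>" if "t \<notin> K" for t
      using k[rule_format, of t] K(2) that g(1)[of t] by simp
    then show "\<exists>K. compact K \<and> (\<forall>t. t \<notin> K \<longrightarrow> N (g t) < \<eta>)" using K(1) by blast
  qed (rule gs)
  moreover have "d (g (p e)) e < \<delta>"
    using g(2)[of "p e" 0] f(3) \<epsilon> by (simp add: \<epsilon>_def)
  ultimately show ?thesis by (intro that) (auto simp: Gamma0_sub_def)
qed

end

end

section \<open>M-ideals of the section space\<close>

context knorm
begin

text \<open>Needed because sections approximating points of the unit ball have norm slightly above
  1.\<close>

lemma three_ball_scaled:
  assumes Y: "closed_subspace V Y" and ball: "three_ball V Y" and c: "c > 0" and e: "e > 0"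
    and x: "x \<in> C" "n x \<le> c" and y: "\<And>i. i < 3 \<Longrightarrow> y i \<in> Y" "\<And>i. i < (3::nat) \<Longrightarrow> n (y i) \<le> c"
  obtains z where "z \<in> Y" "\<forall>i<3. n (x \<oplus> y i \<oplus> z) \<le> c * (1 + e)"
proof -
  note [simp] = Y_sub[OF Y]
  let ?s = "\<lambda>v. of_real (1 / c) \<odot> v"
  have n_s: "n (?s v) \<le> 1" if "v \<in> C" "n v \<le> c" for v
    using that c by (simp add: n_scale norm_divide)
  have y_s: "?s (y i) \<in> Y" "n (?s (y i)) \<le> 1" if "i < 3" for i
    using that n_s y Y_scale[OF Y] by auto
  have "\<exists>z\<in>Y. \<forall>v\<in>{?s (y 0), ?s (y 1), ?s (y 2)}. n (?s x \<oplus> v \<oplus> z) \<le> 1 + e"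
    by (rule ball[unfolded three_ball_def, rule_format, OF _ _ _ _ e])
      (use x n_s y_s in auto)
  then obtain z where z: "z \<in> Y" "\<forall>v\<in>{?s (y 0), ?s (y 1), ?s (y 2)}. n (?s x \<oplus> v \<oplus> z) \<le> 1 + e" ..
  have "n (x \<oplus> y i \<oplus> of_real c \<odot> z) \<le> c * (1 + e)" if i: "i < 3" for i
  proof -
    have "i = 0 \<or> i = 1 \<or> i = 2" using i by auto
    then have le: "n (?s x \<oplus> ?s (y i) \<oplus> z) \<le> 1 + e" using z(2) by auto
    have "of_real c \<odot> (?s x \<oplus> ?s (y i) \<oplus> z) = x \<oplus> y i \<oplus> of_real c \<odot> z"
      using x y(1)[OF i] z(1) c by (simp add: scale_add scale_scale flip: of_real_mult)
    then have "n (x \<oplus> y i \<oplus> of_real c \<odot> z) = c * n (?s x \<oplus> ?s (y i) \<oplus> z)"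
      using n_scale[of "?s x \<oplus> ?s (y i) \<oplus> z" "of_real c"] x y(1)[OF i] z(1) c by simp
    then show ?thesis using le c by simp
  qed
  with that[of "of_real c \<odot> z"] Y_scale[OF Y z(1)] show ?thesis by blast
qed

text \<open>
  If \<open>T\<close> behaves like multiplication by a function with values in \<open>[0, 1]\<close>, then its adjoint \<open>T*\<close>
  satisfies \<open>\<parallel>T* f\<parallel> + \<parallel>f - T* f\<parallel> = \<parallel>f\<parallel>\<close>, which for \<open>f\<close> in the annihilator leaves no room for a
  component of \<open>T* f\<close> in the complement of the annihilator.
\<close>

lemma M_ideal_invariant:
  assumes M: "M_ideal V Y"
    and TC: "\<And>x. x \<in> C \<Longrightarrow> T x \<in> C"
    and T_add: "\<And>x y. x \<in> C \<Longrightarrow> y \<in> C \<Longrightarrow> T (x \<oplus> y) = T x \<oplus> T y"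
    and T_scale: "\<And>c x. x \<in> C \<Longrightarrow> T (c \<odot> x) = c \<odot> T x"
    and T_mix: "\<And>x y. x \<in> C \<Longrightarrow> y \<in> C \<Longrightarrow> n x \<le> 1 \<Longrightarrow> n y \<le> 1 \<Longrightarrow> n (T x \<oplus> (y \<oplus> neg (T y))) \<le> 1"
    and y: "y \<in> Y"
  shows "T y \<in> Y"
proof -
  have Y: "closed_subspace V Y" using M by (simp add: M_ideal_def)
  note [simp] = Y_sub[OF Y] TC
  obtain Z where "closed_complement (dual V) (annihilator V Y) Z"
    and Zn: "\<And>a b. a \<in> annihilator V Y \<Longrightarrow> b \<in> Z \<Longrightarrow> dn (\<lambda>x. a x + b x) = dn a + dn b"
    using M unfolding M_ideal_def by auto
  then have ZD: "b \<in> Z \<Longrightarrow> b \<in> D" and Zadd: "b \<in> Z \<Longrightarrow> b' \<in> Z \<Longrightarrow> (\<lambda>x. b x + b' x) \<in> Z"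
    and Zint: "b \<in> annihilator V Y \<Longrightarrow> b \<in> Z \<Longrightarrow> b = (\<lambda>x. 0)"
    and Zdec: "f \<in> D \<Longrightarrow> \<exists>a\<in>annihilator V Y. \<exists>b\<in>Z. f = (\<lambda>x. a x + b x)" for b b' f
    unfolding closed_complement_def closed_subspace_def by auto
  have T_zero: "T \<zero> = \<zero>" using T_scale[of \<zero> 0] by simp
  have T_unit: "n (T x) \<le> 1" if "x \<in> C" "n x \<le> 1" for x
    using T_mix[of x \<zero>] that by (simp add: T_zero)
  have T_le: "n (T x) \<le> n x" if x: "x \<in> C" for x
  proof (cases "x = \<zero>")
    case True
    then show ?thesis by (simp add: T_zero)
  next
    case False
    obtain v where v: "v \<in> C" "n v = 1" "x = of_real (n x) \<odot> v" "n x > 0" by (rule normalize[OF x False])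
    have "n (T x) = n (T (of_real (n x) \<odot> v))" using v(3) by simp
    also have "\<dots> = n x * n (T v)" using v(1,4) by (simp add: T_scale n_scale)
    also have "\<dots> \<le> n x" using T_unit[OF v(1)] v(2,4) by (simp add: mult_left_le)
    finally show ?thesis .
  qed
  show ?thesis
  proof (rule annihilator_separates[OF Y])
    show "T y \<in> C" using y by simp
    fix f assume f: "f \<in> annihilator V Y"
    have fD: "f \<in> D" by (rule annihilatorD(1)[OF Y f])
    define g where "g x = (if x \<in> C then f (T x) else 0)" for x
    have gD: "g \<in> D"
    proof (rule DI)
      fix x assume x: "x \<in> C"
      have "norm (g x) \<le> dn f * n (T x)" using dual_bound[OF fD, of "T x"] x by (simp add: g_def)
      also have "\<dots> \<le> dn f * n x" by (rule mult_left_mono[OF T_le[OF x] dn_ge_0[OF fD]])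
      finally show "norm (g x) \<le> dn f * n x" .
    qed (use fD in \<open>simp_all add: g_def T_add T_scale D_add D_scale\<close>)
    define h where "h = (\<lambda>x. f x - g x)"
    have hD: "h \<in> D" unfolding h_def by (rule D_diffI[OF fD gD])
    \<comment> \<open>For \<open>x\<close> and \<open>x'\<close> in the unit ball,
      \<open>T x + (x' - T x')\<close> is again in it, and \<open>f\<close> takes the value
      \<open>g x + h x'\<close> there; so almost norming points of \<open>g\<close> and
      \<open>h\<close> can be combined into one point for \<open>f\<close>.\<close>
    have split: "dn g + dn h \<le> dn f"
    proof (rule le_if_le_add_eps_mult)
      fix e :: real assume e: "e > 0"
      obtain x where x: "x \<in> C" "n x \<le> 1" "dn g - e < repart (g x)" by (rule dn_approx[OF gD e])
      obtain x' where x': "x' \<in> C" "n x' \<le> 1" "dn h - e < repart (h x')" by (rule dn_approx[OF hD e])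
      have "g x + h x' = f (T x \<oplus> (x' \<oplus> neg (T x')))"
        using x x' fD by (simp add: g_def h_def D_add D_neg)
      then have "repart (g x) + repart (h x') \<le> norm (f (T x \<oplus> (x' \<oplus> neg (T x'))))"
        using repart_le_norm by (metis repart_add)
      also have "\<dots> \<le> dn f"
        by (rule norm_le_dn[OF fD]) (use x x' T_mix in auto)
      finally show "dn g + dn h \<le> dn f + e * 2" using x(3) x'(3) by simp
    qed simp
    obtain a b where 1: "a \<in> annihilator V Y" "b \<in> Z" "g = (\<lambda>x. a x + b x)" using Zdec[OF gD] by blast
    obtain a' b' where 2: "a' \<in> annihilator V Y" "b' \<in> Z" "h = (\<lambda>x. a' x + b' x)" using Zdec[OF hD] by blast
    note aD = annihilatorD(1)[OF Y 1(1)] and aD' = annihilatorD(1)[OF Y 2(1)]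
    have f_eq: "f x = a x + a' x + (b x + b' x)" for x
    proof -
      have "f x = g x + h x" by (simp add: h_def)
      then show ?thesis unfolding 1(3) 2(3) by (simp add: algebra_simps)
    qed
    have "(\<lambda>x. b x + b' x) = (\<lambda>x. 0)"
    proof (rule Zint)
      show "(\<lambda>x. b x + b' x) \<in> Z" by (rule Zadd[OF 1(2) 2(2)])
      show "(\<lambda>x. b x + b' x) \<in> annihilator V Y"
      proof (rule annihilatorI[OF Y])
        show "(\<lambda>x. b x + b' x) \<in> D" by (intro D_addI ZD 1 2)
        fix v assume v: "v \<in> Y"
        show "b v + b' v = 0"
          using f_eq[of v] annihilatorD(2)[OF Y f v] annihilatorD(2)[OF Y 1(1) v]
            annihilatorD(2)[OF Y 2(1) v] by simp
      qed
    qed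
    then have "b x + b' x = 0" for x by (rule fun_cong)
    then have "f = (\<lambda>x. a x + a' x)" using f_eq by (intro ext) simp
    \<comment> \<open>Here \<open>dn f\<close> is at most \<open>dn a + dn a'\<close>, while
      \<open>dn g + dn h\<close> exceeds this by \<open>dn b + dn b'\<close>. By
      \<open>split\<close> there is no room for \<open>b\<close>, so \<open>g = a\<close> vanishes
      at \<open>y\<close>.\<close>
    then have "dn f \<le> dn a + dn a'" using dn_add[OF aD aD'] by simp
    moreover have "dn g = dn a + dn b" "dn h = dn a' + dn b'"
      using Zn 1 2 by simp_all
    ultimately have "dn b \<le> 0" using split dn_ge_0[OF ZD[OF 2(2)]] by linarith
    then have "dn b = 0" using dn_ge_0[OF ZD[OF 1(2)]] by linarith
    then have "b = (\<lambda>x. 0)" using dn_eq_0_iff[OF ZD[OF 1(2)]] by simp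
    then have "g y = 0" using 1(3) annihilatorD(2)[OF Y 1(1) y] by simp
    then show "f (T y) = 0" using y by (simp add: g_def)
  qed
qed

end

section \<open>From fibers to sections\<close>

context lc_bundle
begin

lemma N_add_le_shift:
  assumes "p w = p v" "p z = p v"
  shows "N (w \<oplus> z) \<le> N (w \<oplus> v) + d z v"
proof -
  interpret V: knorm "fiber \<xi> (p v)" by (rule knorm_fiber)
  have "w \<oplus> z \<oplus> - 1 \<odot> (w \<oplus> v) = z \<oplus> - 1 \<odot> v"
    using assms V.add_add_swap[of w z "- 1 \<odot> w" "- 1 \<odot> v"] V.scale_add[of w v "- 1"] V.zero_add[of "z \<oplus> - 1 \<odot> v"]
    by simp
  then show ?thesis using N_le_add_d[of "w \<oplus> z" "w \<oplus> v"] assms by simp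
qed

lemma Gamma0_sub_bmix:
  assumes "banach_subbundle \<xi> F" "f \<in> Gamma0_sub \<xi> F" "g \<in> Gamma0_sub \<xi> F"
    "continuous_on UNIV \<phi>" "\<forall>s. 0 \<le> \<phi> s \<and> \<phi> s \<le> 1"
  shows "(\<lambda>s. bmix (\<phi> s) (f s) (g s)) \<in> Gamma0_sub \<xi> F"
  using assms by (auto simp: Gamma0_sub_def intro!: G_bmix F_bmix)

lemma three_ball_Gamma0_sub:
  assumes sub: "banach_subbundle \<xi> F"
    and ball: "\<And>t. three_ball (fiber \<xi> t) (p -` {t} \<inter> F)"
  shows "three_ball (Gamma0 \<xi>) (Gamma0_sub \<xi> F)"
  unfolding three_ball_def Gamma0_simps
proof (intro ballI allI impI)
  fix f g1 g2 g3 and e :: real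
  assume f: "f \<in> G" and g': "g1 \<in> Gamma0_sub \<xi> F" "g2 \<in> Gamma0_sub \<xi> F" "g3 \<in> Gamma0_sub \<xi> F"
    and e: "e > 0" and le: "SN f \<le> 1" "SN g1 \<le> 1" "SN g2 \<le> 1" "SN g3 \<le> 1"
  define S where "S = {g1, g2, g3}"
  have g: "g \<in> G" "g t \<in> F" "N (g t) \<le> 1" if "g \<in> S" for g t
    using that g' le order_trans[OF N_le_SN, of g 1 t] by (auto simp: S_def Gamma0_sub_def)
  have p': "p (f t \<oplus> g t) = t" if "g \<in> S" for g t using f g(1)[OF that] by simp
  obtain K where K: "compact K" "\<forall>t. t \<notin> K \<longrightarrow> N (f t) < e" by (rule G_small_outside_compact[OF f e])
  have sel: "selection z" if "z \<in> Gamma0_sub \<xi> F" for z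
    using that by (simp add: Gamma0_sub_def G_selection)
  \<comment> \<open>The inequality is strict so that it holds on an open set once it holds at a
    point. Outside \<open>K\<close> the zero section satisfies it, since the norm of
    \<open>f\<close> is below \<open>e\<close> there and those of the members of \<open>S\<close>
    are at most 1.\<close>
  have "\<exists>z\<in>Gamma0_sub \<xi> F. \<forall>t. \<forall>g\<in>S. N (f t \<oplus> g t \<oplus> z t) < 1 + e"
  proof (rule glue[where K = K and ?f0.0 = "bzero \<xi>"])
    show "selection z" if "z \<in> Gamma0_sub \<xi> F" for z by (rule sel[OF that])
    show "(\<lambda>s. bmix (\<phi> s) (z s) (z' s)) \<in> Gamma0_sub \<xi> F"
      if "z \<in> Gamma0_sub \<xi> F" "z' \<in> Gamma0_sub \<xi> F" "continuous_on UNIV \<phi>" "\<forall>s. 0 \<le> \<phi> s \<and> \<phi> s \<le> 1" for z z' \<phi>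
      using that by (rule Gamma0_sub_bmix[OF sub])
    show "\<forall>g\<in>S. N (f t \<oplus> g t \<oplus> bmix (\<phi> t) (z t) (z' t)) < 1 + e"
      if z: "z \<in> Gamma0_sub \<xi> F" "z' \<in> Gamma0_sub \<xi> F" and \<phi>: "\<forall>s. 0 \<le> \<phi> s \<and> \<phi> s \<le> 1"
        and Q: "\<forall>g\<in>S. N (f t \<oplus> g t \<oplus> z t) < 1 + e" "\<forall>g\<in>S. N (f t \<oplus> g t \<oplus> z' t) < 1 + e" for z z' \<phi> t
    proof
      fix g assume gS: "g \<in> S"
      have "f t \<oplus> g t \<oplus> bmix (\<phi> t) (z t) (z' t) = bmix (\<phi> t) (f t \<oplus> g t \<oplus> z t) (f t \<oplus> g t \<oplus> z' t)"
        by (rule add_bmix) (use p'[OF gS] sel z in auto)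
      also have "N \<dots> \<le> \<phi> t * N (f t \<oplus> g t \<oplus> z t) + (1 - \<phi> t) * N (f t \<oplus> g t \<oplus> z' t)"
        by (rule N_bmix) (use p'[OF gS] sel z \<phi> in auto)
      also have "\<dots> < 1 + e" by (rule convex_less) (use Q gS \<phi> in auto)
      finally show "N (f t \<oplus> g t \<oplus> bmix (\<phi> t) (z t) (z' t)) < 1 + e" .
    qed
    show "\<forall>g\<in>S. N (f t \<oplus> g t \<oplus> z' t) < 1 + e"
      if "t \<in> H" "\<forall>s\<in>H. z s = z' s" "\<forall>g\<in>S. N (f t \<oplus> g t \<oplus> z t) < 1 + e" for z z' H t
      using that by simp
    show "bzero \<xi> \<in> Gamma0_sub \<xi> F" using F_zero[OF sub] G_zero by (simp add: Gamma0_sub_def)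
    show "\<forall>g\<in>S. N (f t \<oplus> g t \<oplus> bzero \<xi> t) < 1 + e" if t: "t \<notin> K" for t
    proof
      fix g assume gS: "g \<in> S"
      have "N (f t \<oplus> g t) \<le> N (f t) + N (g t)" by (rule N_add) (use f g(1)[OF gS] in simp)
      moreover have "N (f t) < e" using K(2) t by blast
      ultimately show "N (f t \<oplus> g t \<oplus> bzero \<xi> t) < 1 + e" using g(3)[OF gS, of t] p'[OF gS] by simp
    qed
    show "\<exists>z\<in>Gamma0_sub \<xi> F. \<exists>H. open H \<and> t \<in> H \<and> (\<forall>s\<in>H. \<forall>g\<in>S. N (f s \<oplus> g s \<oplus> z s) < 1 + e)" for t
    proof -
      \<comment> \<open>Half of \<open>e\<close> is kept for replacing the fiber solution
        \<open>v\<close> by the value of a section.\<close>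
      have "\<exists>v\<in>p -` {t} \<inter> F. \<forall>w\<in>{g1 t, g2 t, g3 t}. N (f t \<oplus> w \<oplus> v) \<le> 1 + e / 2"
        by (rule ball[of t, unfolded three_ball_def fiber_simps, rule_format])
          (use f g e order_trans[OF N_le_SN[OF f] le(1)] in \<open>auto simp: S_def\<close>)
      then obtain v where v: "p v = t" "v \<in> F" "\<forall>g\<in>S. N (f t \<oplus> g t \<oplus> v) \<le> 1 + e / 2"
        by (auto simp: S_def)
      obtain z where z: "z \<in> Gamma0_sub \<xi> F" "d (z (p v)) v < e / 2"
        by (rule ex_section_near[OF sub v(2), of "e / 2"]) (use e in auto)
      have zG: "z \<in> G" using z by (simp add: Gamma0_sub_def)
      have cont: "continuous_on UNIV (\<lambda>s. f s \<oplus> g s \<oplus> z s)" if "g \<in> S" for g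
        using f g(1)[OF that] zG by (intro cont_add_comp G_continuous) auto
      let ?H = "\<Inter>g\<in>S. {s. N (f s \<oplus> g s \<oplus> z s) < 1 + e}"
      have "open ?H" by (rule open_INT) (use open_N_less[OF cont] in \<open>auto simp: S_def\<close>)
      moreover have "N (f t \<oplus> g t \<oplus> z t) < 1 + e" if gS: "g \<in> S" for g
      proof -
        have "N (f t \<oplus> g t \<oplus> z t) \<le> N (f t \<oplus> g t \<oplus> v) + d (z t) v"
          by (rule N_add_le_shift) (use p'[OF gS] v zG in auto)
        then show ?thesis using v(1,3) z(2) gS by fastforce
      qed
      ultimately show ?thesis using z(1) by (intro bexI[OF _ z(1)] exI[of _ ?H]) auto
    qed
  qed (rule K)
  then obtain z where z: "z \<in> Gamma0_sub \<xi> F" "\<forall>t. \<forall>g\<in>S. N (f t \<oplus> g t \<oplus> z t) < 1 + e" ..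
  have "SN (\<lambda>t. f t \<oplus> g t \<oplus> z t) \<le> 1 + e" if "g \<in> S" for g
    by (rule SN_le) (use z(2) that in \<open>auto intro: less_imp_le\<close>)
  then show "\<exists>z\<in>Gamma0_sub \<xi> F. \<forall>g\<in>{g1, g2, g3}. SN (\<lambda>t. f t \<oplus> g t \<oplus> z t) \<le> 1 + e"
    using z(1) unfolding S_def by blast
qed

text \<open>Makes the existence of sections near a given point available for the bundle
  itself.\<close>

lemma subbundle_UNIV: "banach_subbundle \<xi> UNIV"
proof -
  have "closed_subspace (fiber \<xi> t) (p -` {t})" for t
    unfolding closed_subspace_def
    using knorm.closedin_iff[OF knorm_fiber, of t "p -` {t}"] by auto
  then show ?thesis
    using is_bundle unfolding banach_subbundle_def banach_bundle_def by simp
qed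

section \<open>From an M-ideal of sections to its subbundle\<close>

context
  fixes L
  assumes M: "M_ideal (Gamma0 \<xi>) L"
begin

lemma L_subspace: "closed_subspace (Gamma0 \<xi>) L"
  using M by (simp add: M_ideal_def)

lemma L_G: "f \<in> L \<Longrightarrow> f \<in> G"
  and L_zero: "bzero \<xi> \<in> L"
  and L_add: "f \<in> L \<Longrightarrow> g \<in> L \<Longrightarrow> (\<lambda>t. f t \<oplus> g t) \<in> L"
  and L_scale: "f \<in> L \<Longrightarrow> (\<lambda>t. c \<odot> f t) \<in> L"
  using L_subspace unfolding closed_subspace_def by auto

lemma L_closed:
  assumes "f \<in> G" "\<And>e. e > 0 \<Longrightarrow> \<exists>g\<in>L. SN (\<lambda>t. f t \<oplus> - 1 \<odot> g t) < e"
  shows "f \<in> L"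
  using L_subspace assms unfolding closed_subspace_def knorm.closedin_iff[OF knorm_Gamma0] by auto

lemma L_mult:
  assumes f: "f \<in> L" and \<phi>: "continuous_on UNIV \<phi>" "\<forall>s. 0 \<le> \<phi> s \<and> \<phi> s \<le> 1"
  shows "(\<lambda>t. of_real (\<phi> t) \<odot> f t) \<in> L"
proof -
  interpret X: knorm "Gamma0 \<xi>" by (rule knorm_Gamma0)
  let ?T = "\<lambda>f t. of_real (\<phi> t) \<odot> f t"
  have TG: "?T f \<in> G" if "f \<in> G" for f
    using G_bmix[OF that G_zero \<phi>] that by (simp add: bmix_def)
  \<comment> \<open>This identity yields the norm hypothesis of \<open>M_ideal_invariant\<close>:
    the combination of two sections of the unit ball is convex at each point.\<close>
  have mix: "?T f t \<oplus> (g t \<oplus> - 1 \<odot> ?T g t) = bmix (\<phi> t) (f t) (g t)" if "f \<in> G" "g \<in> G" for f g t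
  proof -
    interpret V: knorm "fiber \<xi> t" by (rule knorm_fiber)
    have "g t \<oplus> - 1 \<odot> of_real (\<phi> t) \<odot> g t = of_real (1 - \<phi> t) \<odot> g t"
      using that V.scale_scale[of "g t" "- 1" "of_real (\<phi> t)"] V.add_scale[of "g t" 1 "- of_real (\<phi> t)"]
      by simp
    then show ?thesis by (simp add: bmix_def)
  qed
  show ?thesis
  proof (rule X.M_ideal_invariant[OF M, where T = ?T, unfolded Gamma0_simps])
    fix f g assume fg: "f \<in> G" "g \<in> G"
    show "?T (\<lambda>t. f t \<oplus> g t) = (\<lambda>t. ?T f t \<oplus> ?T g t)"
    proof
      fix t show "?T (\<lambda>t. f t \<oplus> g t) t = ?T f t \<oplus> ?T g t"
        using kspace.scale_add[OF kspace_fiber, of "f t" t "g t"] fg by simp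
    qed
    assume le: "SN f \<le> 1" "SN g \<le> 1"
    show "SN (\<lambda>t. ?T f t \<oplus> (g t \<oplus> - 1 \<odot> ?T g t)) \<le> 1"
      unfolding mix[OF fg]
    proof (rule SN_le)
      fix t
      have "N (bmix (\<phi> t) (f t) (g t)) \<le> \<phi> t * N (f t) + (1 - \<phi> t) * N (g t)"
        by (rule N_bmix) (use fg \<phi> in auto)
      also have "\<dots> \<le> 1"
        by (rule convex_bound_le)
          (use \<phi>(2) order_trans[OF N_le_SN[OF fg(1)] le(1)] order_trans[OF N_le_SN[OF fg(2)] le(2)] in auto)
      finally show "N (bmix (\<phi> t) (f t) (g t)) \<le> 1" .
    qed
  next
    fix c f assume f: "f \<in> G"
    show "?T (\<lambda>t. c \<odot> f t) = (\<lambda>t. c \<odot> ?T f t)"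
    proof
      fix t
      show "?T (\<lambda>t. c \<odot> f t) t = c \<odot> ?T f t"
        using kspace.scale_scale[OF kspace_fiber, of "f t" t] f by (simp add: mult.commute)
    qed
  qed (use TG f in auto)
qed

lemma L_bmix:
  assumes f: "f \<in> L" and g: "g \<in> L" and \<phi>: "continuous_on UNIV \<phi>" "\<forall>s. 0 \<le> \<phi> s \<and> \<phi> s \<le> 1"
  shows "(\<lambda>t. bmix (\<phi> t) (f t) (g t)) \<in> L"
  unfolding bmix_def
  by (intro L_add L_mult f g) (use \<phi> in \<open>auto intro!: continuous_intros\<close>)

text \<open>Each fiber is the norm closure of the values of \<open>L\<close> at its base point, not
  the trace of a closure in the bundle space.\<close>

definition closure_bundle :: "'e set" where
  "closure_bundle = {x. \<forall>e>0. \<exists>f\<in>L. d x (f (p x)) < e}"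

lemma L_closure_bundle: "f \<in> L \<Longrightarrow> f t \<in> closure_bundle"
  unfolding closure_bundle_def using L_G by (auto intro!: bexI[of _ f])

lemma closure_bundleD:
  assumes "x \<in> closure_bundle" "e > 0"
  obtains f where "f \<in> L" "d x (f (p x)) < e"
  using assms unfolding closure_bundle_def by blast

lemma closure_bundle_fiber: "closed_subspace (fiber \<xi> t) (p -` {t} \<inter> closure_bundle)"
  unfolding closed_subspace_def fiber_simps
proof (intro conjI ballI allI)
  interpret V: knorm "fiber \<xi> t" by (rule knorm_fiber)
  show "bzero \<xi> t \<in> p -` {t} \<inter> closure_bundle" using L_closure_bundle[OF L_zero] by simp
  fix x assume "x \<in> p -` {t} \<inter> closure_bundle"
  then have x: "p x = t" "x \<in> closure_bundle" by auto
  show "c \<odot> x \<in> p -` {t} \<inter> closure_bundle" for c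
  proof -
    have "\<exists>f\<in>L. d (c \<odot> x) (f (p (c \<odot> x))) < e" if e: "e > 0" for e
    proof -
      have c: "norm c + 1 > 0" by (simp add: add_nonneg_pos)
      obtain f where f: "f \<in> L" "d x (f (p x)) < e / (norm c + 1)"
        by (rule closure_bundleD[OF x(2), of "e / (norm c + 1)"]) (use e c in auto)
      have "c \<odot> x \<oplus> - 1 \<odot> c \<odot> f t = c \<odot> (x \<oplus> - 1 \<odot> f t)"
        using x L_G[OF f(1)] V.scale_add[of x "- 1 \<odot> f t" c] V.scale_scale[of "f t" c "- 1"]
          V.scale_scale[of "f t" "- 1" c] by simp
      then have "d (c \<odot> x) (c \<odot> f t) = norm c * d x (f t)" by (simp add: N_scale)
      also have "\<dots> \<le> (norm c + 1) * d x (f t)" by (rule mult_right_mono) auto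
      also have "\<dots> < e" using f(2) c x(1) by (simp add: less_divide_eq mult.commute)
      finally show ?thesis using L_scale[OF f(1), of c] x(1) by (intro bexI[of _ "\<lambda>t. c \<odot> f t"]) auto
    qed
    then show ?thesis using x by (simp add: closure_bundle_def)
  qed
  fix y assume "y \<in> p -` {t} \<inter> closure_bundle"
  then have y: "p y = t" "y \<in> closure_bundle" by auto
  have "\<exists>f\<in>L. d (x \<oplus> y) (f (p (x \<oplus> y))) < e" if e: "e > 0" for e
  proof -
    have e2: "e / 2 > 0" using e by simp
    obtain f where f: "f \<in> L" "d x (f (p x)) < e / 2" by (rule closure_bundleD[OF x(2) e2])
    obtain g where g: "g \<in> L" "d y (g (p y)) < e / 2" by (rule closure_bundleD[OF y(2) e2])
    note fg = L_G[OF f(1)] L_G[OF g(1)]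
    have "x \<oplus> y \<oplus> - 1 \<odot> (f t \<oplus> g t) = x \<oplus> - 1 \<odot> f t \<oplus> (y \<oplus> - 1 \<odot> g t)"
      using x y fg V.scale_add[of "f t" "g t" "- 1"] V.add_add_swap[of x y "- 1 \<odot> f t" "- 1 \<odot> g t"] by simp
    then have "d (x \<oplus> y) (f t \<oplus> g t) \<le> d x (f t) + d y (g t)"
      using N_add[of "x \<oplus> - 1 \<odot> f t" "y \<oplus> - 1 \<odot> g t"] x y fg by simp
    also have "\<dots> < e" using f(2) g(2) x y by simp
    finally show ?thesis using L_add[OF f(1) g(1)] x y by (intro bexI[of _ "\<lambda>t. f t \<oplus> g t"]) auto
  qed
  then show "x \<oplus> y \<in> p -` {t} \<inter> closure_bundle" using x y by (simp add: closure_bundle_def)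
next
  have "x \<in> closure_bundle" if x: "p x = t" and lim: "\<forall>e>0. \<exists>y\<in>p -` {t} \<inter> closure_bundle. d x y < e" for x
    unfolding closure_bundle_def
  proof (intro CollectI allI impI)
    fix e :: real assume e: "e > 0"
    then have e2: "e / 2 > 0" by simp
    obtain y where y: "p y = t" "y \<in> closure_bundle" "d x y < e / 2" using lim[rule_format, OF e2] by auto
    obtain f where f: "f \<in> L" "d y (f (p y)) < e / 2" by (rule closure_bundleD[OF y(2) e2])
    have "d x (f t) \<le> d x y + d y (f t)" by (rule d_triangle) (use x y L_G[OF f(1)] in auto)
    then show "\<exists>f\<in>L. d x (f (p x)) < e" using f y x by (intro bexI[OF _ f(1)]) simp
  qed
  then show "closedin (vtopology (fiber \<xi> t)) (p -` {t} \<inter> closure_bundle)"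
    unfolding knorm.closedin_iff[OF knorm_fiber] by auto
qed auto

text \<open>For openness of the projection: near a point of this set in an open \<open>W\<close>
  there is a value of some \<open>f \<in> L\<close>, so close that it lies in \<open>W\<close> too;
  by continuity \<open>f\<close> stays in \<open>W\<close> over a neighbourhood.\<close>

lemma closure_bundle_subbundle: "banach_subbundle \<xi> closure_bundle"
  unfolding banach_subbundle_def
proof (intro conjI allI closure_bundle_fiber)
  have "t \<in> p ` closure_bundle" for t
    by (rule image_eqI[of _ _ "bzero \<xi> t"]) (use L_closure_bundle[OF L_zero] in auto)
  then show "p ` closure_bundle = UNIV" by blast
  have "open (p ` (closure_bundle \<inter> W))" if W: "open W" for W
  proof (subst open_subopen, intro ballI)
    fix t assume "t \<in> p ` (closure_bundle \<inter> W)"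
    then obtain x where x: "x \<in> closure_bundle" "x \<in> W" "p x = t" by auto
    obtain U \<delta> where U: "open U" "x \<in> U" "\<delta> > 0" "\<forall>b\<in>U. \<forall>y. p y = p b \<longrightarrow> d y b < \<delta> \<longrightarrow> y \<in> W"
      by (rule nbhd_tube[OF W x(2)])
    obtain f where f: "f \<in> L" "d x (f (p x)) < \<delta>" by (rule closure_bundleD[OF x(1) U(3)])
    have "d (f t) x < \<delta>" using f x L_G[OF f(1)] d_commute[of x "f t"] by simp
    then have "f t \<in> W" using U(2,4) x L_G[OF f(1)] by auto
    moreover have "open (f -` W)" by (rule open_vimage[OF W G_continuous[OF L_G[OF f(1)]]])
    moreover have "f -` W \<subseteq> p ` (closure_bundle \<inter> W)"
    proof
      fix s assume "s \<in> f -` W"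
      then show "s \<in> p ` (closure_bundle \<inter> W)"
        by (intro image_eqI[of _ _ "f s"]) (use L_closure_bundle f L_G in auto)
    qed
    ultimately show "\<exists>S. open S \<and> t \<in> S \<and> S \<subseteq> p ` (closure_bundle \<inter> W)" by blast
  qed
  then show "open_map (top_of_set closure_bundle) euclidean p"
    unfolding open_map_def by (auto simp: openin_open)
qed

text \<open>An argument of Stone-Weierstrass type: approximation by \<open>L\<close> at a point
  persists nearby by upper semicontinuity, and outside a compact set 0 is close enough. Closedness
  of \<open>L\<close> finishes the proof.\<close>

lemma Gamma0_sub_closure_bundle: "Gamma0_sub \<xi> closure_bundle = L"
proof
  show "L \<subseteq> Gamma0_sub \<xi> closure_bundle"
    using L_closure_bundle L_G by (auto simp: Gamma0_sub_def)
  show "Gamma0_sub \<xi> closure_bundle \<subseteq> L"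
  proof
    fix g assume "g \<in> Gamma0_sub \<xi> closure_bundle"
    then have g: "g \<in> G" "\<And>t. g t \<in> closure_bundle" by (auto simp: Gamma0_sub_def)
    show "g \<in> L"
    proof (rule L_closed[OF g(1)])
      fix e :: real assume e: "e > 0"
      then have e2: "e / 2 > 0" by simp
      obtain K where K: "compact K" "\<forall>t. t \<notin> K \<longrightarrow> N (g t) < e / 2"
        by (rule G_small_outside_compact[OF g(1) e2])
      have "\<exists>f\<in>L. \<forall>t. d (g t) (f t) < e / 2"
      proof (rule glue[where K = K and ?f0.0 = "bzero \<xi>"])
        show "selection f" if "f \<in> L" for f by (rule G_selection[OF L_G[OF that]])
        show "(\<lambda>s. bmix (\<phi> s) (f s) (f' s)) \<in> L"
          if "f \<in> L" "f' \<in> L" "continuous_on UNIV \<phi>" "\<forall>s. 0 \<le> \<phi> s \<and> \<phi> s \<le> 1" for f f' \<phi>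
          using that by (rule L_bmix)
        show "d (g t) (bmix (\<phi> t) (f t) (f' t)) < e / 2"
          if f: "f \<in> L" "f' \<in> L" and \<phi>: "\<forall>s. 0 \<le> \<phi> s \<and> \<phi> s \<le> 1"
            and Q: "d (g t) (f t) < e / 2" "d (g t) (f' t) < e / 2" for f f' \<phi> t
        proof -
          have "d (bmix (\<phi> t) (g t) (g t)) (bmix (\<phi> t) (f t) (f' t))
              \<le> \<phi> t * d (g t) (f t) + (1 - \<phi> t) * d (g t) (f' t)"
            by (rule d_bmix) (use g(1) L_G f \<phi> in auto)
          also have "\<dots> < e / 2" by (rule convex_less) (use Q \<phi> in auto)
          finally show ?thesis by simp
        qed
        show "d (g t) (f' t) < e / 2" if "t \<in> H" "\<forall>s\<in>H. f s = f' s" "d (g t) (f t) < e / 2" for f f' H t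
          using that by simp
        show "d (g t) (bzero \<xi> t) < e / 2" if "t \<notin> K" for t
          using K(2) that g(1) by simp
        show "\<exists>f\<in>L. \<exists>H. open H \<and> t \<in> H \<and> (\<forall>s\<in>H. d (g s) (f s) < e / 2)" for t
        proof -
          obtain f where f: "f \<in> L" "d (g t) (f (p (g t))) < e / 2" by (rule closure_bundleD[OF g(2) e2])
          have "continuous_on UNIV (\<lambda>s. g s \<oplus> - 1 \<odot> f s)"
            using g(1) L_G[OF f(1)] by (intro cont_diff_comp G_continuous) auto
          then have "open {s. d (g s) (f s) < e / 2}" by (rule open_N_less)
          moreover have "t \<in> {s. d (g s) (f s) < e / 2}" using f(2) g(1) by simp
          ultimately show ?thesis using f(1) by blast
        qed
      qed (fact K L_zero)+
      then obtain f where f: "f \<in> L" "\<And>t. d (g t) (f t) < e / 2" by blast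
      have "SN (\<lambda>t. g t \<oplus> - 1 \<odot> f t) \<le> e / 2" by (rule SN_le) (use f(2) in \<open>auto intro: less_imp_le\<close>)
      then show "\<exists>f\<in>L. SN (\<lambda>t. g t \<oplus> - 1 \<odot> f t) < e" using f(1) e by (intro bexI[OF _ f(1)]) simp
    qed
  qed
qed

text \<open>The set where the norm of \<open>f\<close> is below \<open>c\<close> is a neighbourhood
  of \<open>t\<close> by upper semicontinuity; cutting off inside it bounds the norm without
  changing the value at \<open>t\<close>. Elements of \<open>L\<close> stay in \<open>L\<close> by
  \<open>L_mult\<close>.\<close>

lemma ex_cutoff:
  assumes f: "f \<in> G" and c: "N (f t) < c"
  obtains \<phi> where "continuous_on UNIV \<phi>" "\<forall>s. 0 \<le> \<phi> s \<and> \<phi> s \<le> (1::real)" "\<phi> t = 1"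
    "SN (\<lambda>s. of_real (\<phi> s) \<odot> f s) \<le> c"
proof -
  have c0: "c > 0" using c N_ge_0[of "f t"] by linarith
  obtain \<phi> V M where \<phi>: "continuous_on UNIV \<phi>" "\<forall>s. 0 \<le> \<phi> s \<and> \<phi> s \<le> (1::real)"
    and V: "open V" "{t} \<subseteq> V" "\<forall>s\<in>V. \<phi> s = 1"
    and M: "open M" "- {s. N (f s) < c} \<subseteq> M" "\<forall>s\<in>M. \<phi> s = 0"
    by (rule bump[of "{t}" "{s. N (f s) < c}"]) (use open_N_less[OF G_continuous[OF f]] c in auto)
  have "N (of_real (\<phi> s) \<odot> f s) \<le> c" for s
  proof (cases "N (f s) < c")
    case True
    have "\<phi> s * N (f s) \<le> 1 * N (f s)" by (rule mult_right_mono) (use \<phi>(2) in auto)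
    with True show ?thesis using \<phi>(2) by (simp add: N_scale)
  next
    case False
    then have "\<phi> s = 0" using M by auto
    then show ?thesis using c0 f by simp
  qed
  then have "SN (\<lambda>s. of_real (\<phi> s) \<odot> f s) \<le> c" by (rule SN_le)
  then show ?thesis using that[OF \<phi>] V by auto
qed

lemma three_ball_closure_bundle: "three_ball (fiber \<xi> t) (p -` {t} \<inter> closure_bundle)"
  unfolding three_ball_def fiber_simps
proof (intro ballI allI impI)
  interpret X: knorm "Gamma0 \<xi>" by (rule knorm_Gamma0)
  have ballL: "three_ball (Gamma0 \<xi>) L" by (rule X.three_ball_of_M_ideal[OF L_subspace M])
  fix x y1 y2 y3 and e :: real
  assume x: "x \<in> p -` {t}" "N x \<le> 1" and y': "y1 \<in> p -` {t} \<inter> closure_bundle" "y2 \<in> p -` {t} \<inter> closure_bundle"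
    "y3 \<in> p -` {t} \<inter> closure_bundle" "N y1 \<le> 1" "N y2 \<le> 1" "N y3 \<le> 1" and e: "e > 0"
  define y where "y i = [y1, y2, y3] ! i" for i
  have y: "p (y i) = t" "y i \<in> closure_bundle" "N (y i) \<le> 1" if "i < 3" for i
    using that y' by (auto simp: y_def less_Suc_eq numeral_3_eq_3)
  \<comment> \<open>The final bound \<open>(1 + \<eta>) * (1 + \<eta>) + \<eta> + \<eta>\<close> is
    at most \<open>1 + 5 * \<eta>\<close> when \<open>\<eta> \<le> 1\<close>.\<close>
  define \<eta> where "\<eta> = min 1 (e / 5)"
  have \<eta>: "\<eta> > 0" "\<eta> \<le> 1" "5 * \<eta> \<le> e" using e by (auto simp: \<eta>_def)
  obtain f0 where f0: "f0 \<in> Gamma0_sub \<xi> UNIV" "d (f0 (p x)) x < \<eta>"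
    by (rule ex_section_near[OF subbundle_UNIV UNIV_I \<eta>(1)])
  then have f0G: "f0 \<in> G" by (simp add: Gamma0_sub_def)
  have "N (f0 t) < 1 + \<eta>"
    using N_le_add_d[of "f0 t" x] f0(2) f0G x by simp
  then obtain \<phi> where \<phi>: "continuous_on UNIV \<phi>" "\<forall>s. 0 \<le> \<phi> s \<and> \<phi> s \<le> (1::real)" "\<phi> t = 1"
    "SN (\<lambda>s. of_real (\<phi> s) \<odot> f0 s) \<le> 1 + \<eta>"
    by (rule ex_cutoff[OF f0G])
  define f where "f = (\<lambda>s. of_real (\<phi> s) \<odot> f0 s)"
  have f: "f \<in> G" "SN f \<le> 1 + \<eta>" "d (f t) x < \<eta>"
    using G_bmix[OF f0G G_zero \<phi>(1,2)] f0G \<phi>(3,4) f0(2) x by (simp_all add: f_def bmix_def)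
  have "\<exists>g. g \<in> L \<and> SN g \<le> 1 + \<eta> \<and> d (g t) (y i) < \<eta>" if i: "i < 3" for i
  proof -
    obtain g0 where g0: "g0 \<in> L" "d (y i) (g0 (p (y i))) < \<eta>" by (rule closure_bundleD[OF y(2)[OF i] \<eta>(1)])
    have g0G: "g0 \<in> G" by (rule L_G[OF g0(1)])
    have near: "d (g0 t) (y i) < \<eta>" using g0(2) d_commute[of "y i" "g0 t"] y(1)[OF i] g0G by simp
    have "N (g0 t) < 1 + \<eta>"
      using N_le_add_d[of "g0 t" "y i"] near g0G y[OF i] by simp
    then obtain \<psi> where \<psi>: "continuous_on UNIV \<psi>" "\<forall>s. 0 \<le> \<psi> s \<and> \<psi> s \<le> (1::real)" "\<psi> t = 1"
      "SN (\<lambda>s. of_real (\<psi> s) \<odot> g0 s) \<le> 1 + \<eta>"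
      by (rule ex_cutoff[OF g0G])
    show ?thesis
      by (rule exI[of _ "\<lambda>s. of_real (\<psi> s) \<odot> g0 s"]) (use L_mult[OF g0(1) \<psi>(1,2)] \<psi> near in auto)
  qed
  then obtain g where g: "\<And>i. i < 3 \<Longrightarrow> g i \<in> L" "\<And>i. i < 3 \<Longrightarrow> SN (g i) \<le> 1 + \<eta>"
    "\<And>i. i < 3 \<Longrightarrow> d (g i t) (y i) < \<eta>"
    by metis
  have pos: "1 + \<eta> > 0" using \<eta> by simp
  obtain z where z: "z \<in> L" "\<forall>i<3. SN (X.plus (X.plus f (g i)) z) \<le> (1 + \<eta>) * (1 + \<eta>)"
    by (rule X.three_ball_scaled[OF L_subspace ballL pos \<eta>(1) f(1,2) g(1,2)])
  note zG = L_G[OF z(1)]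
  have "N (x \<oplus> y i \<oplus> z t) \<le> 1 + e" if i: "i < 3" for i
  proof -
    interpret V: knorm "fiber \<xi> t" by (rule knorm_fiber)
    note gG = L_G[OF g(1)[OF i]]
    have ps: "p x = t" "p (y i) = t" "p (f t) = t" "p (g i t) = t" "p (z t) = t"
      using x y(1)[OF i] f(1) gG zG by auto
    have "X.plus (X.plus f (g i)) z \<in> G" using G_add[OF G_add[OF f(1) gG] zG] by simp
    then have "N (X.plus (X.plus f (g i)) z t) \<le> SN (X.plus (X.plus f (g i)) z)" by (rule N_le_SN)
    then have "N (f t \<oplus> g i t \<oplus> z t) \<le> SN (X.plus (X.plus f (g i)) z)" by simp
    also have "\<dots> \<le> (1 + \<eta>) * (1 + \<eta>)" using z(2) i by blast
    finally have 1: "N (f t \<oplus> g i t \<oplus> z t) \<le> (1 + \<eta>) * (1 + \<eta>)" .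
    \<comment> \<open>First \<open>x\<close> is exchanged for \<open>f t\<close>, then
      \<open>y i\<close> for \<open>g i t\<close>, at a cost below \<open>\<eta>\<close> each. The
      reorderings bring the summand to be exchanged to the end, where \<open>N_add_le_shift\<close>
      expects it.\<close>
    have "x \<oplus> y i \<oplus> z t = y i \<oplus> z t \<oplus> x" "y i \<oplus> z t \<oplus> f t = f t \<oplus> z t \<oplus> y i"
      "f t \<oplus> z t \<oplus> g i t = f t \<oplus> g i t \<oplus> z t"
      using ps V.add_ac by simp_all
    then have "N (x \<oplus> y i \<oplus> z t) \<le> N (f t \<oplus> g i t \<oplus> z t) + d x (f t) + d (y i) (g i t)"
      using N_add_le_shift[of "y i \<oplus> z t" "f t" x] N_add_le_shift[of "f t \<oplus> z t" "g i t" "y i"] ps by simp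
    also have "d x (f t) = d (f t) x" by (rule d_commute) (use ps in simp)
    also have "d (y i) (g i t) = d (g i t) (y i)" by (rule d_commute) (use ps in simp)
    finally have "N (x \<oplus> y i \<oplus> z t) \<le> (1 + \<eta>) * (1 + \<eta>) + \<eta> + \<eta>"
      using 1 f(3) g(3)[OF i] by linarith
    also have "\<dots> = 1 + 4 * \<eta> + \<eta> * \<eta>" by (simp add: algebra_simps)
    also have "\<dots> \<le> 1 + 5 * \<eta>" using \<eta> mult_left_le[of \<eta> \<eta>] by simp
    finally show ?thesis using \<eta>(3) by linarith
  qed
  from this[of 0] this[of 1] this[of 2]
  have "\<forall>w\<in>{y1, y2, y3}. N (x \<oplus> w \<oplus> z t) \<le> 1 + e" by (simp add: y_def)
  moreover have "z t \<in> p -` {t} \<inter> closure_bundle" using L_closure_bundle[OF z(1)] zG by simp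
  ultimately show "\<exists>z\<in>p -` {t} \<inter> closure_bundle. \<forall>w\<in>{y1, y2, y3}. N (x \<oplus> w \<oplus> z) \<le> 1 + e" by blast
qed

end

end

theorem theorem4p7:
  fixes \<xi> :: "('k::real_or_complex, 'e::topological_space, 't::t2_space) bundle_data"
    and L :: "('t \<Rightarrow> 'e) set"
  assumes "banach_bundle \<xi>"
    and "locally_compact_space (euclidean :: 't topology)"
    and "closed_subspace (Gamma0 \<xi>) L"
  shows "M_ideal (Gamma0 \<xi>) L \<longleftrightarrow>
    (\<exists>\<F>. banach_subbundle \<xi> \<F> \<and> L = Gamma0_sub \<xi> \<F> \<and>
       (\<forall>t. M_ideal (fiber \<xi> t) (proj \<xi> -` {t} \<inter> \<F>)))"
proof -
  interpret lc_bundle \<xi> by unfold_locales (fact assms)+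
  note M_iff = knorm.M_ideal_iff_three_ball
  show ?thesis
  proof
    assume M: "M_ideal (Gamma0 \<xi>) L"
    show "\<exists>\<F>. banach_subbundle \<xi> \<F> \<and> L = Gamma0_sub \<xi> \<F> \<and>
        (\<forall>t. M_ideal (fiber \<xi> t) (proj \<xi> -` {t} \<inter> \<F>))"
      using closure_bundle_subbundle[OF M] Gamma0_sub_closure_bundle[OF M] three_ball_closure_bundle[OF M]
        M_iff[OF knorm_fiber closure_bundle_fiber[OF M]] by metis
  next
    assume "\<exists>\<F>. banach_subbundle \<xi> \<F> \<and> L = Gamma0_sub \<xi> \<F> \<and>
        (\<forall>t. M_ideal (fiber \<xi> t) (proj \<xi> -` {t} \<inter> \<F>))"
    then obtain \<F> where sub: "banach_subbundle \<xi> \<F>" and L: "L = Gamma0_sub \<xi> \<F>"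
      and M: "\<And>t. M_ideal (fiber \<xi> t) (proj \<xi> -` {t} \<inter> \<F>)" by blast
    have "three_ball (fiber \<xi> t) (proj \<xi> -` {t} \<inter> \<F>)" for t
      using M M_iff[OF knorm_fiber F_fiber_closed[OF sub]] by blast
    then have "three_ball (Gamma0 \<xi>) L" unfolding L by (rule three_ball_Gamma0_sub[OF sub])
    then show "M_ideal (Gamma0 \<xi>) L" using M_iff[OF knorm_Gamma0 assms(3)] by blast
  qed
qed

end
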